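(* Let $n\ge1$ and let $h_t(r,\phi)$ be the subelliptic heat kernel on $\mathbb{CP}^{2n+1}$ associated to the sub-Laplacian $\mathcal{L}$ lifted from $\mathbb{HP}^n$. For $t>0$, $r\in[0,\frac{\pi}{2})$, $\phi\in[0,\frac{\pi}{2}]$, $$h_t(r,\phi)=\sum_{m=0}^{+\infty}\sum_{k=0}^{+\infty}\sigma_{k,m}\,e^{-[4k(k+2n+2m+1)+8nm]t}\,(\cos r)^{2m}\,P_m^{0,0}(\cos2\phi)\,P_k^{2n-1,2m+1}(\cos 2r),$$ where $\sigma_{k,m}=\frac{\Gamma(2n)}{4\pi^{2n+2}}(2k+2m+2n+1)(2m+1)\binom{k+2m+2n}{2n-1}$ and $P_k^{a,b}$ denotes the Jacobi polynomials.
   Context: $\mathbb{S}^{4n+3}=\{q\in\mathbb{H}^{n+1}:\|q\|=1\}$ ($\mathbb{H}$ the quaternions) with its round metric. The unit quaternions $\mathbf{SU}(2)$ act isometrically by $g\cdot(q_1,\dots,q_{n+1})=(gq_1,\dots,gq_{n+1})$ with quotient $\mathbb{HP}^n$; the subgroup $\mathbb{S}^1=\{e^{I\theta}\}$ has quotient $\mathbb{CP}^{2n+1}$, which induces the fibration $\mathbf{SU}(2)/\mathbb{S}^1=\mathbb{CP}^1\to\mathbb{CP}^{2n+1}\to\mathbb{HP}^n$ (quotient metrics making the projections Riemannian submersions). $\mathcal{L}$ is the lift to $\mathbb{CP}^{2n+1}$ of the Laplace–Beltrami operator of $\mathbb{HP}^n$. Coordinates: $r\in[0,\pi/2)$ with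 $|q_{n+1}|=\cos r$ is the distance on $\mathbb{HP}^n$ from the image of the north pole $(0,\dots,0,1)$; $\phi\in[0,\pi/2]$ is the distance on $\mathbb{CP}^1$ from the class of the identity to the class of $q_{n+1}/|q_{n+1}|$ (writing $q_{n+1}/|q_{n+1}|=a+bJ$ with $a,b\in\mathrm{span}_{\mathbb{R}}(1,I)$, $|a|=\cos\phi$). On functions of $(r,\phi)$, $\mathcal{L}$ acts as $\frac{\partial^2}{\partial r^2}+((4n-1)\cot r-3\tan r)\frac{\partial}{\partial r}+\tan^2r\left(\frac{\partial^2}{\partial\phi^2}+2\cot2\phi\frac{\partial}{\partial\phi}\right)$. $h_t$ is the heat kernel of $e^{t\mathcal{L}}$ issued from the image of the north pole; it depends only on $(r,\phi)$, and is taken with respect to the multiple of the Riemannian measure which on functions of $(r,\phi)$ reads $\frac{8\pi^{2n+2}}{\Gamma(2n)}(\sin r)^{4n-1}(\cos r)^3\sin2\phi\,dr\,d\phi$. Jacobi polynomials: $P_k^{a,b}(x)=\frac{(-1)^k}{2^kk!(1-x)^a(1+x)^b}\frac{d^k}{dx^k}\left((1-x)^{a+k}(1+x)^{b+k}\right)$. *)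

theory Defs
  imports "HOL-Analysis.Analysis" "HOL-Computational_Algebra.Polynomial"
begin

text \<open>The pair \<open>(a, b)\<close> stands for the quaternion \<open>a + b J\<close>, with complex \<open>a, b\<close> in
  \<open>span (1, I)\<close>; the product comes from \<open>J z = cnj z J\<close> and \<open>J\<^sup>2 = -1\<close>. The inner product and
  norm of the product type are the usual ones of the quaternions.\<close>

type_synonym quat = "complex \<times> complex"

definition qmult :: "quat \<Rightarrow> quat \<Rightarrow> quat" where
  "qmult p q = (fst p * fst q - snd p * cnj (snd q), fst p * snd q + snd p * cnj (fst q))"

text \<open>With \<open>n = CARD('n)\<close>, a vector \<open>(q\<^sub>1, \<dots>, q\<^sub>n\<^sub>+\<^sub>1)\<close> is the pair of \<open>(q\<^sub>1, \<dots>, q\<^sub>n)\<close> and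
  \<open>q\<^sub>n\<^sub>+\<^sub>1\<close>. The unit sphere of dimension \<open>4n+3\<close> is \<open>sphere 0 1\<close> in this type.\<close>

type_synonym 'n hvec = "(quat ^ 'n) \<times> quat"

definition qscale :: "quat \<Rightarrow> 'n::finite hvec \<Rightarrow> 'n hvec" where
  "qscale g q = ((\<chi> i. qmult g (fst q $ i)), qmult g (snd q))"

definition north :: "'n::finite hvec" where
  "north = (0, (1, 0))"

text \<open>Points of \<open>CP\<^sup>2\<^sup>n\<^sup>+\<^sup>1\<close> are the orbits of the circle \<open>{e\<^sup>I\<^sup>\<theta>}\<close> on the sphere.\<close>

type_synonym 'n cp_point = "'n hvec set"

definition cp_class :: "'n::finite hvec \<Rightarrow> 'n cp_point" where
  "cp_class q = range (\<lambda>\<theta>::real. qscale (cis \<theta>, 0) q)"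

definition CP :: "'n::finite cp_point set" where
  "CP = cp_class ` sphere 0 1"

text \<open>The coordinates \<open>r\<close> and \<open>\<phi>\<close> are invariant under the circle, and are given on the sphere.
  The angle \<open>\<phi>\<close> is meaningful only where \<open>q\<^sub>n\<^sub>+\<^sub>1\<close> does not vanish, that is for \<open>r < \<pi>/2\<close>.\<close>

definition coord_r :: "'n::finite hvec \<Rightarrow> real" where
  "coord_r q = arccos (norm (snd q))"

definition coord_phi :: "'n::finite hvec \<Rightarrow> real" where
  "coord_phi q = arccos (norm (fst (snd q)) / norm (snd q))"

text \<open>The horizontal space at \<open>q\<close> is the orthogonal complement of the quaternionic line through
  \<open>q\<close>, which is spanned by the normal \<open>q\<close> and the vertical vectors \<open>I q\<close>, \<open>J q\<close>, \<open>K q\<close>.\<close>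

definition horizontal_space :: "'n::finite hvec \<Rightarrow> 'n hvec set" where
  "horizontal_space q = {v. \<forall>g. v \<bullet> qscale g q = 0}"

definition horizontal_frame :: "'n::finite hvec \<Rightarrow> 'n hvec set \<Rightarrow> bool" where
  "horizontal_frame q B \<longleftrightarrow>
     pairwise orthogonal B \<and> (\<forall>v\<in>B. norm v = 1) \<and> span B = horizontal_space q"

text \<open>The Laplace--Beltrami operator of \<open>HP\<^sup>n\<close> at a point is the sum of the second derivatives
  along the unit speed geodesics issued in the directions of an orthonormal basis. Its lift to
  \<open>CP\<^sup>2\<^sup>n\<^sup>+\<^sup>1\<close> is the sum of the second derivatives along the horizontal lifts of these geodesics.
  The horizontal lifts are the images of the great circles of the sphere tangent to a
  horizontal vector. For a function of class \<open>C\<^sup>2\<close> the value depends neither on the frame nor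
  on the representative \<open>q\<close> of the point of \<open>CP\<^sup>2\<^sup>n\<^sup>+\<^sup>1\<close>.\<close>

definition sub_laplacian :: "('n::finite cp_point \<Rightarrow> real) \<Rightarrow> 'n hvec \<Rightarrow> real" where
  "sub_laplacian f q =
     (\<Sum>v\<in>(SOME B. horizontal_frame q B).
        (deriv ^^ 2) (\<lambda>s. f (cp_class (cos s *\<^sub>R q + sin s *\<^sub>R v))) 0)"

text \<open>Surface measure of the unit sphere, as a cone measure.\<close>

definition sphere_measure :: "'a::euclidean_space measure" where
  "sphere_measure = scale_measure (of_nat DIM('a))
     (distr (restrict_space lborel (cball 0 1 - {0})) (restrict_space borel (sphere 0 1))
        (\<lambda>x. x /\<^sub>R norm x))"

text \<open>Image of the surface measure on the quotient. Since all fibres are great circles, it is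
  \<open>2 \<pi>\<close> times the Riemannian measure of \<open>CP\<^sup>2\<^sup>n\<^sup>+\<^sup>1\<close>.\<close>

definition cp_volume :: "'n::finite cp_point measure" where
  "cp_volume = distr sphere_measure
     (sigma CP {A. A \<subseteq> CP \<and> {q \<in> sphere 0 1. cp_class q \<in> A} \<in> sets borel}) cp_class"

definition radial_measure :: "nat \<Rightarrow> (real \<times> real) measure" where
  "radial_measure n = density lborel (\<lambda>(r, \<phi>).
     if r \<in> {0..pi/2} \<and> \<phi> \<in> {0..pi/2}
     then ennreal (8 * pi ^ (2*n+2) / Gamma (2 * real n)
            * sin r ^ (4*n-1) * cos r ^ 3 * sin (2*\<phi>))
     else 0)"

text \<open>The multiple of the Riemannian measure whose image under \<open>(r, \<phi>)\<close> is \<open>radial_measure\<close>.\<close>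

definition reference_measure :: "'n::finite cp_point measure" where
  "reference_measure = scale_measure
     (THE c. distr (scale_measure c (sphere_measure :: 'n hvec measure)) borel
               (\<lambda>q. (coord_r q, coord_phi q)) = radial_measure CARD('n))
     cp_volume"

definition C2_on :: "'a::real_normed_vector set \<Rightarrow> ('a \<Rightarrow> real) \<Rightarrow> bool" where
  "C2_on U F \<longleftrightarrow> (\<exists>(D :: 'a \<Rightarrow> 'a \<Rightarrow>\<^sub>L real) (D2 :: 'a \<Rightarrow> 'a \<Rightarrow>\<^sub>L 'a \<Rightarrow>\<^sub>L real).
     (\<forall>x\<in>U. (F has_derivative blinfun_apply (D x)) (at x)) \<and>
     (\<forall>x\<in>U. (D has_derivative blinfun_apply (D2 x)) (at x)) \<and>
     continuous_on U D2)"

text \<open>A function on \<open>CP\<^sup>2\<^sup>n\<^sup>+\<^sup>1\<close> is of class \<open>C\<^sup>2\<close> if and only if its lift to the sphere is, if and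
  only if the extension of the lift that is constant along rays is.\<close>

definition C2_on_CP :: "('n::finite cp_point \<Rightarrow> real) \<Rightarrow> bool" where
  "C2_on_CP f \<longleftrightarrow> C2_on (- {0}) (\<lambda>x. f (cp_class (x /\<^sub>R norm x)))"

text \<open>Classical solutions of the Cauchy problem. By the maximum principle there is at most one
  with a given continuous initial value \<open>f = u 0\<close>, and it is \<open>u t = e\<^sup>t\<^sup>L f\<close>.\<close>

definition heat_solution :: "(real \<Rightarrow> 'n::finite cp_point \<Rightarrow> real) \<Rightarrow> bool" where
  "heat_solution u \<longleftrightarrow>
     continuous_on ({0..} \<times> sphere 0 1) (\<lambda>(t, q). u t (cp_class q)) \<and>
     (\<forall>t>0. C2_on_CP (u t)) \<and>
     (\<forall>t>0. \<forall>q\<in>sphere 0 1.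
        ((\<lambda>s. u s (cp_class q)) has_real_derivative sub_laplacian (u t) q) (at t))"

text \<open>The kernel of \<open>e\<^sup>t\<^sup>L\<close> issued from \<open>p\<close>: the continuous function \<open>H t\<close> such that
  \<open>(e\<^sup>t\<^sup>L f)(p)\<close> is the integral of \<open>H t * f\<close>. Requiring this for those \<open>f\<close> whose evolution
  \<open>u t = e\<^sup>t\<^sup>L f\<close> is a classical solution is no restriction, since by hypoellipticity this is the
  case for every continuous \<open>f\<close>.\<close>

definition subelliptic_heat_kernel ::
    "'n::finite cp_point \<Rightarrow> (real \<Rightarrow> 'n cp_point \<Rightarrow> real) \<Rightarrow> bool" where
  "subelliptic_heat_kernel p H \<longleftrightarrow>
     (\<forall>t>0. continuous_on (sphere 0 1) (\<lambda>q. H t (cp_class q))) \<and>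
     (\<forall>u. heat_solution u \<longrightarrow>
        (\<forall>t>0. u t p = (LINT x|reference_measure. H t x * u 0 x)))"

text \<open>Rodrigues' formula for natural parameters. The division of polynomials is exact; unlike
  the pointwise quotient, it also gives the right value at \<open>x = 1\<close> and \<open>x = -1\<close>.\<close>

definition jacobi_poly :: "nat \<Rightarrow> nat \<Rightarrow> nat \<Rightarrow> real poly" where
  "jacobi_poly k a b = smult ((-1) ^ k / (2 ^ k * fact k))
     ((pderiv ^^ k) ([:1, -1:] ^ (a + k) * [:1, 1:] ^ (b + k)) div ([:1, -1:] ^ a * [:1, 1:] ^ b))"

definition sigma_coeff :: "nat \<Rightarrow> nat \<Rightarrow> nat \<Rightarrow> real" where
  "sigma_coeff n k m = Gamma (2 * real n) / (4 * pi ^ (2*n+2))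
     * real (2*k + 2*m + 2*n + 1) * real (2*m + 1) * real ((k + 2*m + 2*n) choose (2*n - 1))"

definition kernel_term :: "nat \<Rightarrow> real \<Rightarrow> real \<Rightarrow> real \<Rightarrow> nat \<Rightarrow> nat \<Rightarrow> real" where
  "kernel_term n t r \<phi> m k =
     sigma_coeff n k m * exp (- real (4*k*(k + 2*n + 2*m + 1) + 8*n*m) * t)
     * cos r ^ (2*m) * poly (jacobi_poly m 0 0) (cos (2*\<phi>))
     * poly (jacobi_poly k (2*n - 1) (2*m + 1)) (cos (2*r))"

end

theory Submission
  imports Defs
begin

text \<open>Write \<open>v = cos\<^sup>2 r\<close> and \<open>p = cos\<^sup>2 \<phi>\<close>; then \<open>x = v p\<close> and \<open>y = v (1 - p)\<close> are the squared moduli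
  of the two complex components of the last quaternion. On functions of \<open>(x, y)\<close> the operator \<open>\<L>\<close>
  is \<open>4 (1 - (x + y)) \<Delta> - 8 n E\<close> with the Euler field \<open>E\<close> and
  \<open>\<Delta> = x \<partial>\<^sub>x\<^sub>x + y \<partial>\<^sub>y\<^sub>y + \<partial>\<^sub>x + \<partial>\<^sub>y\<close>. The product of a homogeneous \<open>\<Delta>\<close>-harmonic polynomial (a
  Legendre polynomial in \<open>p\<close> times \<open>v\<^sup>m\<close>) and a Jacobi polynomial in \<open>v\<close> is therefore an
  eigenfunction, and damping it exponentially gives a classical solution of the heat equation.
  Inserting these solutions into the defining property of the kernel gives all its Fourier
  coefficients with respect to an orthogonal basis of polynomials. The norms of the basis functions
  are known and the damping makes the series converge uniformly, so that by the Weierstrass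
  approximation theorem it equals the continuous kernel.\<close>

subsection \<open>Shifted Jacobi polynomials\<close>

text \<open>The kernel is accessible only through integrals against classical solutions: a separated
  solution turns its value at the north pole into one Fourier coefficient, and
  \<open>sigma_coeff\<close> is that value divided by a squared norm. The measure is proportional to
  (1 - v)^(2n-1) v dv dp, and the factor v^m carried by both the kernel component and the test
  function turns v into v^(2m+1). Hence the Jacobi parameters 2n-1 and 2m+1. As the second depends
  on m, this is no product basis; the Legendre components are separated first and each is then
  expanded in its own Jacobi basis, so that completeness in one variable suffices. Convergence is
  the other obstacle. For k = 0 the damping in m is only exp(-8nmt), with t arbitrarily small, so
  the Legendre factor must be bounded without exponential growth. The Jacobi factor may be estimated
  crudely, since its growth meets exp(-4k(k+2n+2m+1)t). Finally p is lost at v = 0, where the kernel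
  is not given as a function of the coordinates. Polynomials in x and y and a continuous section of
  the coordinates bridge this locus.\<close>

lemma higher_pderiv_mult:
  fixes f g :: "'a::{comm_semiring_1,semiring_no_zero_divisors} poly"
  shows "(pderiv ^^ k) (f * g) =
    (\<Sum>s\<le>k. of_nat (k choose s) * ((pderiv ^^ s) f * (pderiv ^^ (k - s)) g))"
proof (induction k)
  case (Suc k)
  let ?F = "\<lambda>i j. (pderiv ^^ i) f * (pderiv ^^ j) g"
  have D: "pderiv (of_nat c * h) = of_nat c * pderiv h" for c and h :: "'a poly"
    by (simp add: pderiv_mult)
  have "(pderiv ^^ Suc k) (f * g) =
      pderiv (\<Sum>s\<le>k. of_nat (k choose s) * ?F s (k - s))"
    using Suc by simp
  also have "\<dots> = (\<Sum>s\<le>k. of_nat (k choose s) * (?F (Suc s) (k - s) + ?F s (Suc k - s)))"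
    unfolding higher_pderiv_sum[of 1, simplified]
    by (intro sum.cong refl) (simp add: D pderiv_mult Suc_diff_le algebra_simps)
  also have "\<dots> = (\<Sum>s\<le>k. of_nat (k choose s) * ?F (Suc s) (k - s))
      + (\<Sum>s\<le>k. of_nat (k choose s) * ?F s (Suc k - s))"
    by (simp add: distrib_left sum.distrib)
  also have "(\<Sum>s\<le>k. of_nat (k choose s) * ?F s (Suc k - s)) =
      (\<Sum>s\<le>Suc k. of_nat (k choose s) * ?F s (Suc k - s))"
    by (simp add: binomial_eq_0)
  also have "\<dots> = ?F 0 (Suc k) + (\<Sum>s\<le>k. of_nat (k choose Suc s) * ?F (Suc s) (k - s))"
    by (subst sum.atMost_Suc_shift) simp
  also have "(\<Sum>s\<le>k. of_nat (k choose s) * ?F (Suc s) (k - s)) + \<dots> =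
      ?F 0 (Suc k) + (\<Sum>s\<le>k. of_nat (Suc k choose Suc s) * ?F (Suc s) (k - s))"
    by (simp add: sum.distrib algebra_simps)
  also have "\<dots> = (\<Sum>s\<le>Suc k. of_nat (Suc k choose s) * ?F s (Suc k - s))"
    by (subst sum.atMost_Suc_shift) simp
  finally show ?case .
qed simp

lemma higher_pderiv_linear_power:
  fixes c d :: real
  assumes "i \<le> n"
  shows "(pderiv ^^ i) ([:c, d:] ^ n) = smult (fact n / fact (n - i) * d ^ i) ([:c, d:] ^ (n - i))"
  using assms
proof (induction i)
  case (Suc i)
  then have "(pderiv ^^ Suc i) ([:c, d:] ^ n) =
      smult (fact n / fact (n - i) * d ^ i) (pderiv ([:c, d:] ^ (n - i)))"
    by (simp add: pderiv_smult)
  also have "pderiv ([:c, d:] ^ (n - i)) = smult (real (n - i) * d) ([:c, d:] ^ (n - Suc i))"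
    by (simp add: pderiv_power pderiv_pCons)
  finally have "(pderiv ^^ Suc i) ([:c, d:] ^ n) =
      smult (fact n / fact (n - i) * d ^ i * (real (n - i) * d)) ([:c, d:] ^ (n - Suc i))"
    by simp
  moreover have "fact n / fact (n - i) * d ^ i * (real (n - i) * d) = fact n / fact (n - Suc i) * d ^ Suc i"
  proof -
    have "n - i = Suc (n - Suc i)"
      using Suc.prems by simp
    then have "(fact (n - i) :: real) = real (n - i) * fact (n - Suc i)"
      by simp
    moreover have "real (n - i) \<noteq> 0"
      using Suc.prems by simp
    ultimately show ?thesis
      by (simp del: of_nat_diff)
  qed
  ultimately show ?case
    by simp
qed simp

lemma fact_choose_Rodrigues:
  assumes "s \<le> k"
  shows "real (k choose s) * (fact (a + k) / fact (a + k - s)) * (fact (b + k) / fact (b + k - (k - s))) =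
    fact k * (real ((a + k) choose s) * real ((b + k) choose (k - s)))"
  using assms by (simp add: binomial_fact field_simps)

text \<open>At most k derivatives fall on either power, so every Leibniz term keeps the factors with
  exponents a and b; having them in front makes the division in \<open>jacobi_poly\<close> exact.
  The linear factors are arbitrary because the formula serves both [-1, 1] and [0, 1].\<close>

lemma higher_pderiv_linear_powers:
  fixes c1 d1 c2 d2 :: real
  shows "(pderiv ^^ k) ([:c1, d1:] ^ (a + k) * [:c2, d2:] ^ (b + k)) =
    [:c1, d1:] ^ a * [:c2, d2:] ^ b * smult (fact k)
     (\<Sum>s\<le>k. smult (real ((a + k) choose s) * real ((b + k) choose (k - s)) * d1 ^ s * d2 ^ (k - s))
        ([:c1, d1:] ^ (k - s) * [:c2, d2:] ^ s))" (is "_ = ?p ^ a * ?q ^ b * _")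
proof -
  have "of_nat (k choose s) * ((pderiv ^^ s) (?p ^ (a + k)) * (pderiv ^^ (k - s)) (?q ^ (b + k))) =
    ?p ^ a * ?q ^ b * smult (fact k) (smult (real ((a + k) choose s) * real ((b + k) choose (k - s)) * d1 ^ s * d2 ^ (k - s))
        (?p ^ (k - s) * ?q ^ s))" (is "?l = ?r") if "s \<in> {..k}" for s
  proof -
    have s: "s \<le> k" using that by simp
    have e: "a + k - s = a + (k - s)" "b + k - (k - s) = b + s" using s by auto
    have n: "of_nat c * (f :: real poly) = smult (real c) f" for c f
      by (simp add: of_nat_poly)
    have "?l = smult (real (k choose s) * (fact (a + k) / fact (a + k - s)) * (fact (b + k) / fact (b + k - (k - s)))
        * d1 ^ s * d2 ^ (k - s)) (?p ^ (a + k - s) * ?q ^ (b + k - (k - s)))"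
      using s by (simp add: higher_pderiv_linear_power n mult_ac)
    also have "\<dots> = smult (fact k * (real ((a + k) choose s) * real ((b + k) choose (k - s)))
        * d1 ^ s * d2 ^ (k - s)) (?p ^ (a + (k - s)) * ?q ^ (b + s))"
      using fact_choose_Rodrigues[OF s, of a b] unfolding e by simp
    also have "\<dots> = ?r"
      by (simp add: power_add mult_ac)
    finally show ?thesis .
  qed
  then have "(pderiv ^^ k) (?p ^ (a + k) * ?q ^ (b + k)) = (\<Sum>s\<le>k. ?p ^ a * ?q ^ b * smult (fact k)
      (smult (real ((a + k) choose s) * real ((b + k) choose (k - s)) * d1 ^ s * d2 ^ (k - s)) (?p ^ (k - s) * ?q ^ s)))"
    unfolding higher_pderiv_mult by (rule sum.cong[OF refl])
  also have "\<dots> = ?p ^ a * ?q ^ b * (\<Sum>s\<le>k. [:fact k:] *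
      smult (real ((a + k) choose s) * real ((b + k) choose (k - s)) * d1 ^ s * d2 ^ (k - s)) (?p ^ (k - s) * ?q ^ s))"
    unfolding sum_distrib_left by (simp add: mult_ac)
  finally show ?thesis
    unfolding sum_distrib_left[symmetric] by (simp add: mult_ac)
qed

lemma jacobi_poly_explicit:
  "poly (jacobi_poly k a b) x =
    (\<Sum>s\<le>k. real ((a + k) choose s) * real ((b + k) choose (k - s)) * ((x - 1) / 2) ^ (k - s) * ((x + 1) / 2) ^ s)"
proof -
  let ?W = "[:1, -1:] ^ a * [:1, 1:] ^ b :: real poly"
  let ?S = "\<Sum>s\<le>k. smult (real ((a + k) choose s) * real ((b + k) choose (k - s)) * (-1) ^ s * 1 ^ (k - s))
        ([:1, -1:] ^ (k - s) * [:1, 1:] ^ s) :: real poly"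
  have W: "?W \<noteq> 0" by simp
  have "jacobi_poly k a b = smult ((-1) ^ k / (2 ^ k * fact k)) (smult (fact k) ?S)"
    unfolding jacobi_poly_def higher_pderiv_linear_powers
    by (subst nonzero_mult_div_cancel_left[OF W]) simp
  then have "poly (jacobi_poly k a b) x = (-1) ^ k / 2 ^ k *
     (\<Sum>s\<le>k. real ((a + k) choose s) * real ((b + k) choose (k - s)) * (-1) ^ s * ((1 - x) ^ (k - s) * (1 + x) ^ s))"
    by (simp add: poly_sum)
  also have "\<dots> = (\<Sum>s\<le>k. real ((a + k) choose s) * real ((b + k) choose (k - s)) * ((x - 1) / 2) ^ (k - s) * ((x + 1) / 2) ^ s)"
    unfolding sum_distrib_left
  proof (intro sum.cong refl)
    fix s assume "s \<in> {..k}"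
    then obtain i where k: "k = s + i" using le_Suc_ex by auto
    have "(x - 1) ^ i = (-1) ^ i * (1 - x) ^ i"
      using power_mult_distrib[of "-1" "1 - x" i] by simp
    then show "(-1) ^ k / 2 ^ k * (real ((a + k) choose s) * real ((b + k) choose (k - s)) * (-1) ^ s * ((1 - x) ^ (k - s) * (1 + x) ^ s))
      = real ((a + k) choose s) * real ((b + k) choose (k - s)) * ((x - 1) / 2) ^ (k - s) * ((x + 1) / 2) ^ s"
      by (simp add: k power_add power_divide add.commute mult_ac)
  qed
  finally show ?thesis .
qed

text \<open>The Jacobi polynomial in y = (x + 1) / 2, with weight (1 - y)^a y^b on [0, 1]; for x =
  cos 2r the new variable is cos^2 r. Expanded in products of powers of y - 1 and y, so that both
  end point values are single terms.\<close>

definition shifted_jacobi :: "nat \<Rightarrow> nat \<Rightarrow> nat \<Rightarrow> real poly" where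
  "shifted_jacobi k a b = (\<Sum>s\<le>k. smult (real ((a + k) choose (k - s)) * real ((b + k) choose s))
     ([:-1, 1:] ^ s * [:0, 1:] ^ (k - s)))"

lemma poly_shifted_jacobi:
  "poly (shifted_jacobi k a b) y =
    (\<Sum>s\<le>k. real ((a + k) choose (k - s)) * real ((b + k) choose s) * ((y - 1) ^ s * y ^ (k - s)))"
  by (simp add: shifted_jacobi_def poly_sum)

lemma poly_jacobi_poly:
  "poly (jacobi_poly k a b) (2 * y - 1) = poly (shifted_jacobi k a b) y"
  unfolding jacobi_poly_explicit poly_shifted_jacobi
  by (rule sum.reindex_bij_witness[of _ "\<lambda>s. k - s" "\<lambda>s. k - s"])
     (auto simp: diff_divide_distrib mult_ac)

lemma shifted_jacobi_Rodrigues: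
  "smult (fact k) ([:1, -1:] ^ a * [:0, 1:] ^ b * shifted_jacobi k a b) =
   smult ((-1) ^ k) ((pderiv ^^ k) ([:1, -1:] ^ (a + k) * [:0, 1:] ^ (b + k)))"
proof -
  have "smult ((-1) ^ k) (\<Sum>s\<le>k. smult (real ((a + k) choose s) * real ((b + k) choose (k - s)) * (-1) ^ s * 1 ^ (k - s))
        ([:1, -1:] ^ (k - s) * [:0, 1:] ^ s)) = shifted_jacobi k a b" (is "?l = _")
  proof (rule poly_eq_poly_eq_iff[THEN iffD1, OF ext])
    fix x
    have "poly ?l x = (-1) ^ k * (\<Sum>s\<le>k. real ((a + k) choose s) * real ((b + k) choose (k - s)) * (-1) ^ s * ((1 - x) ^ (k - s) * x ^ s))"
      by (simp add: poly_sum)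
    also have "\<dots> = (\<Sum>s\<le>k. real ((a + k) choose s) * real ((b + k) choose (k - s)) * ((x - 1) ^ (k - s) * x ^ s))"
      unfolding sum_distrib_left
    proof (intro sum.cong refl)
      fix s assume "s \<in> {..k}"
      then obtain i where k: "k = s + i" using le_Suc_ex by auto
      have "(x - 1) ^ i = (-1) ^ i * (1 - x) ^ i"
        using power_mult_distrib[of "-1" "1 - x" i] by simp
      then show "(-1) ^ k * (real ((a + k) choose s) * real ((b + k) choose (k - s)) * (-1) ^ s * ((1 - x) ^ (k - s) * x ^ s))
        = real ((a + k) choose s) * real ((b + k) choose (k - s)) * ((x - 1) ^ (k - s) * x ^ s)"
        by (simp add: k power_add mult_ac)
    qed
    also have "\<dots> = poly (shifted_jacobi k a b) x"
      unfolding poly_shifted_jacobi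
      by (rule sum.reindex_bij_witness[of _ "\<lambda>s. k - s" "\<lambda>s. k - s"]) (auto simp: mult_ac)
    finally show "poly ?l x = poly (shifted_jacobi k a b) x" .
  qed
  then have "[:1, -1:] ^ a * [:0, 1:] ^ b * smult (fact k) ?l =
      [:1, -1:] ^ a * [:0, 1:] ^ b * smult (fact k) (shifted_jacobi k a b)"
    by (rule arg_cong)
  then show ?thesis
    unfolding higher_pderiv_linear_powers by (simp add: mult.commute)
qed

lemma degree_shifted_jacobi_le: "degree (shifted_jacobi k a b) \<le> k"
  unfolding shifted_jacobi_def
proof (intro degree_sum_le)
  fix s assume s: "s \<in> {..k}"
  have "degree ([:-1, 1:] ^ s * [:0, 1::real:] ^ (k - s)) = k"
    using s by (subst degree_mult_eq) (auto simp: degree_linear_power)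
  then show "degree (smult (real ((a + k) choose (k - s)) * real ((b + k) choose s))
     ([:-1, 1:] ^ s * [:0, 1:] ^ (k - s))) \<le> k"
    using degree_smult_le by (metis)
qed simp

text \<open>Each product (y - 1)^s y^(k-s) is monic of degree k, so the leading coefficient is a
  Vandermonde sum.\<close>

lemma coeff_shifted_jacobi: "coeff (shifted_jacobi k a b) k = real ((2 * k + a + b) choose k)"
proof -
  have "coeff ([:-1, 1:] ^ s * [:0, 1::real:] ^ (k - s)) k = 1" if "s \<in> {..k}" for s
  proof -
    have "degree ([:-1, 1:] ^ s * [:0, 1::real:] ^ (k - s)) = k"
      using that by (subst degree_mult_eq) (auto simp: degree_linear_power)
    moreover have "lead_coeff ([:-1, 1:] ^ s * [:0, 1::real:] ^ (k - s)) = 1"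
      by (simp add: lead_coeff_mult lead_coeff_power)
    ultimately show ?thesis by simp
  qed
  then have "coeff (shifted_jacobi k a b) k = (\<Sum>s\<le>k. real ((a + k) choose (k - s)) * real ((b + k) choose s))"
    unfolding shifted_jacobi_def coeff_sum coeff_smult by (intro sum.cong refl) simp
  also have "\<dots> = real (((b + k) + (a + k)) choose k)"
    unfolding vandermonde[symmetric] of_nat_sum of_nat_mult by (simp only: mult.commute)
  finally show ?thesis by (simp add: algebra_simps mult_2 mult_2_right)
qed

lemma poly_shifted_jacobi_1: "poly (shifted_jacobi k a b) 1 = real ((a + k) choose k)"
proof -
  have "poly (shifted_jacobi k a b) 1 = (\<Sum>s\<in>{0}. real ((a + k) choose (k - s)) * real ((b + k) choose s))"
    unfolding poly_shifted_jacobi by (intro sum.mono_neutral_cong_right) auto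
  then show ?thesis by simp
qed

lemma poly_shifted_jacobi_0: "poly (shifted_jacobi k a b) 0 = (-1) ^ k * real ((b + k) choose k)"
proof -
  have "poly (shifted_jacobi k a b) 0 =
      (\<Sum>s\<in>{k}. real ((a + k) choose (k - s)) * real ((b + k) choose s) * (-1) ^ k)"
    unfolding poly_shifted_jacobi by (intro sum.mono_neutral_cong_right) auto
  then show ?thesis by simp
qed

text \<open>The two binomials are treated differently because b will be 2m + 1: for k = 0 the bound
  must not grow with b, so the second binomial is bounded by a k-th power and only the first is
  summed to a power of 2.\<close>

lemma abs_poly_shifted_jacobi_le:
  assumes "0 \<le> y" "y \<le> 1"
  shows "\<bar>poly (shifted_jacobi k a b) y\<bar> \<le> 2 ^ (a + k) * real (b + k + 1) ^ k"
proof -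
  have "\<bar>poly (shifted_jacobi k a b) y\<bar> \<le>
      (\<Sum>s\<le>k. \<bar>real ((a + k) choose (k - s)) * real ((b + k) choose s) * ((y - 1) ^ s * y ^ (k - s))\<bar>)"
    unfolding poly_shifted_jacobi by (rule sum_abs)
  also have "\<dots> \<le> (\<Sum>s\<le>k. real ((a + k) choose (k - s)) * real (b + k + 1) ^ k)"
  proof (intro sum_mono)
    fix s assume s: "s \<in> {..k}"
    have "(b + k) choose s \<le> (b + k) ^ s"
      using s by (intro binomial_le_pow) auto
    also have "\<dots> \<le> (b + k + 1) ^ s"
      by (intro power_mono) auto
    also have "\<dots> \<le> (b + k + 1) ^ k"
      using s by (intro power_increasing) auto
    finally have 1: "real ((b + k) choose s) \<le> real (b + k + 1) ^ k"
      by (metis of_nat_le_iff of_nat_power)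
    have "\<bar>y - 1\<bar> ^ s * \<bar>y\<bar> ^ (k - s) \<le> 1"
      using assms by (intro mult_le_one power_le_one) auto
    then have "real ((b + k) choose s) * (\<bar>y - 1\<bar> ^ s * \<bar>y\<bar> ^ (k - s)) \<le> real (b + k + 1) ^ k * 1"
      using 1 by (intro mult_mono) auto
    then show "\<bar>real ((a + k) choose (k - s)) * real ((b + k) choose s) * ((y - 1) ^ s * y ^ (k - s))\<bar>
        \<le> real ((a + k) choose (k - s)) * real (b + k + 1) ^ k"
      by (simp add: abs_mult power_abs mult.assoc mult_left_mono)
  qed
  also have "\<dots> = (\<Sum>s\<le>k. real ((a + k) choose s)) * real (b + k + 1) ^ k"
    unfolding sum_distrib_right
    by (rule sum.reindex_bij_witness[of _ "\<lambda>s. k - s" "\<lambda>s. k - s"]) auto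
  also have "\<dots> \<le> (\<Sum>s\<le>a + k. real ((a + k) choose s)) * real (b + k + 1) ^ k"
    by (intro mult_right_mono sum_mono2) auto
  also have "(\<Sum>s\<le>a + k. real ((a + k) choose s)) = 2 ^ (a + k)"
    using choose_row_sum[of "a + k"] by (simp flip: of_nat_sum)
  finally show ?thesis .
qed

subsection \<open>The Jacobi differential equation\<close>

text \<open>The Jacobi operator maps (y - 1)^s y^i to a combination of itself and its two neighbours
  of the same total degree. Written with differences of neighbours, the result is ready for
  telescoping.\<close>

lemma shifted_jacobi_ode_term:
  fixes y :: real
  defines "M \<equiv> \<lambda>s i. [:-1, 1:] ^ s * [:0, 1:] ^ i :: real poly"
  shows "y * (1 - y) * poly (pderiv (pderiv (M s i))) y
      + (real (b + 1) - real (a + b + 2) * y) * poly (pderiv (M s i)) y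
      + real ((s + i) * (s + i + a + b + 1)) * poly (M s i) y
    = real (s * (s + a)) * (poly (M s i) y - poly (M (s - 1) (Suc i)) y)
      + real (i * (i + b)) * (poly (M s i) y - poly (M (Suc s) (i - 1)) y)"
proof -
  define X where "X = y - 1"
  \<comment> \<open>The numerical factors vanish exactly where the truncated exponents
    \<open>s - 1\<close> and \<open>s - 2\<close> would be wrong. Multiplication by X or y therefore
    restores the expected powers in all cases, and the claim becomes a polynomial identity.\<close>
  define u1 where "u1 = real s * X ^ (s - 1)"
  define u2 where "u2 = real s * (real (s - 1) * X ^ (s - 2))"
  define v1 where "v1 = real i * y ^ (i - 1)"
  define v2 where "v2 = real i * (real (i - 1) * y ^ (i - 2))"
  have u: "X * u1 = real s * X ^ s" "X * u2 = (real s - 1) * u1"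
    unfolding u1_def u2_def by (cases s; cases "s - 1"; simp)+
  have v: "y * v1 = real i * y ^ i" "y * v2 = (real i - 1) * v1"
    unfolding v1_def v2_def by (cases i; cases "i - 1"; simp)+
  have M: "poly (M s i) y = X ^ s * y ^ i"
    "poly (pderiv (M s i)) y = u1 * y ^ i + X ^ s * v1"
    "poly (pderiv (pderiv (M s i))) y = u2 * y ^ i + 2 * u1 * v1 + X ^ s * v2"
    unfolding M_def X_def u1_def u2_def v1_def v2_def
    by (simp_all add: pderiv_mult pderiv_power pderiv_smult pderiv_add pderiv_pCons numeral_2_eq_2 algebra_simps)
  have M': "real s * poly (M (s - 1) (Suc i)) y = u1 * (y * y ^ i)"
    "real i * poly (M (Suc s) (i - 1)) y = X * X ^ s * v1"
    unfolding M_def X_def u1_def v1_def by (simp_all add: algebra_simps)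
  have y: "1 - y = - X" by (simp add: X_def)
  have 1: "y * (1 - y) * poly (pderiv (pderiv (M s i))) y =
      - (y * y ^ i * ((real s - 1) * u1) + 2 * (real s * X ^ s) * (real i * y ^ i) + X * X ^ s * ((real i - 1) * v1))"
    unfolding M y u[symmetric] v[symmetric] by (simp add: algebra_simps)
  have 2: "(real (b + 1) - real (a + b + 2) * y) * poly (pderiv (M s i)) y =
      - (real b + 1) * (real s * X ^ s * y ^ i + X * X ^ s * v1) - (real a + 1) * (u1 * (y * y ^ i) + X ^ s * (real i * y ^ i))"
    unfolding M u[symmetric] v[symmetric] by (simp add: X_def algebra_simps)
  have 3: "real (s * (s + a)) * (poly (M s i) y - poly (M (s - 1) (Suc i)) y)
      = (real s + real a) * (real s * (X ^ s * y ^ i) - u1 * (y * y ^ i))"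
    unfolding M'[symmetric] M by (simp add: algebra_simps)
  have 4: "real (i * (i + b)) * (poly (M s i) y - poly (M (Suc s) (i - 1)) y)
      = (real i + real b) * (real i * (X ^ s * y ^ i) - X * X ^ s * v1)"
    unfolding M'[symmetric] M by (simp add: algebra_simps)
  show ?thesis
    unfolding 1 2 3 4 unfolding M of_nat_add of_nat_mult of_nat_1 by algebra
qed

text \<open>The coefficients satisfy (s+1)(s+1+a) c(s+1) = (k-s)(k-s+b) c(s). This is what makes the
  forward difference in one term the negative of the backward difference in the next, so the sum
  telescopes.\<close>

lemma shifted_jacobi_ode:
  "y * (1 - y) * poly (pderiv (pderiv (shifted_jacobi k a b))) y
    + (real (b + 1) - real (a + b + 2) * y) * poly (pderiv (shifted_jacobi k a b)) y
    + real (k * (k + a + b + 1)) * poly (shifted_jacobi k a b) y = 0"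
proof -
  define M where "M s = ([:-1, 1:] ^ s * [:0, 1:] ^ (k - s) :: real poly)" for s :: nat
  \<comment> \<open>Extended by 0 beyond k, so that \<open>d (Suc k) = 0\<close>; together with
    \<open>d 0 = 0\<close> this removes both boundary terms of the telescoping sum.\<close>
  define c where "c s = (if s \<le> k then real ((a + k) choose (k - s)) * real ((b + k) choose s) else 0)" for s
  define d where "d s = real (s * (s + a)) * c s" for s
  have J: "shifted_jacobi k a b = (\<Sum>s\<le>k. smult (c s) (M s))"
    by (simp add: shifted_jacobi_def c_def M_def)
  have d: "d (Suc s) = real ((k - s) * (k - s + b)) * c s" if sk: "s < k" for s
  proof -
    obtain i where k: "k = Suc s + i"
      using less_imp_Suc_add[OF sk] by auto
    have absorb: "real (Suc j) * real (N choose Suc j) = real (N - j) * real (N choose j)" for N j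
      by (simp only: binomial_absorption binomial_absorb_comp flip: of_nat_mult)
    note 1 = absorb[of s "b + k"]
    have 2: "real (Suc s + a) * real ((a + k) choose i) = real (Suc i) * real ((a + k) choose Suc i)"
      unfolding absorb by (simp add: k)
    have "d (Suc s) = (real (Suc s) * real ((b + k) choose Suc s)) * (real (Suc s + a) * real ((a + k) choose i))"
      by (simp add: d_def c_def k algebra_simps)
    also have "\<dots> = (real (b + k - s) * real ((b + k) choose s)) * (real (Suc i) * real ((a + k) choose Suc i))"
      unfolding 1 2 ..
    finally show ?thesis
      by (simp add: c_def k algebra_simps Suc_diff_le)
  qed
  define m where "m s = poly (M s) y" for s
  have "y * (1 - y) * poly (pderiv (pderiv (shifted_jacobi k a b))) y
    + (real (b + 1) - real (a + b + 2) * y) * poly (pderiv (shifted_jacobi k a b)) y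
    + real (k * (k + a + b + 1)) * poly (shifted_jacobi k a b) y
    = (\<Sum>s\<le>k. c s * (y * (1 - y) * poly (pderiv (pderiv (M s))) y
    + (real (b + 1) - real (a + b + 2) * y) * poly (pderiv (M s)) y
    + real (k * (k + a + b + 1)) * poly (M s) y))"
    unfolding J higher_pderiv_sum[of 1, simplified] pderiv_smult poly_sum poly_smult
    by (simp add: sum_distrib_left sum.distrib[symmetric] algebra_simps)
  also have "\<dots> = (\<Sum>s\<le>k. d s * (m s - m (s - 1)) + d (Suc s) * (m s - m (Suc s)))"
  proof (intro sum.cong refl)
    fix s assume "s \<in> {..k}"
    then obtain i where k: "k = s + i" using le_Suc_ex by auto
    have M: "M s = [:-1, 1:] ^ s * [:0, 1:] ^ i"
      by (simp add: M_def k)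
    have 1: "real (s * (s + a)) * (poly (M s) y - poly ([:-1, 1:] ^ (s - 1) * [:0, 1:] ^ Suc i) y)
        = real (s * (s + a)) * (m s - m (s - 1))"
      by (cases s) (simp_all add: m_def M_def k)
    have 2: "c s * (real (i * (i + b)) * (poly (M s) y - poly ([:-1, 1:] ^ Suc s * [:0, 1:] ^ (i - 1)) y))
        = d (Suc s) * (m s - m (Suc s))"
    proof (cases i)
      case 0
      then have "d (Suc s) = 0" by (simp add: d_def c_def k)
      then show ?thesis using 0 by simp
    next
      case (Suc j)
      then have "d (Suc s) = real (i * (i + b)) * c s"
        using d[of s] by (simp add: k)
      then show ?thesis using Suc by (simp add: m_def M_def k)
    qed
    have "c s * (y * (1 - y) * poly (pderiv (pderiv (M s))) y
        + (real (b + 1) - real (a + b + 2) * y) * poly (pderiv (M s)) y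
        + real (k * (k + a + b + 1)) * poly (M s) y) =
      c s * (real (s * (s + a)) * (poly (M s) y - poly ([:-1, 1:] ^ (s - 1) * [:0, 1:] ^ Suc i) y)) +
      c s * (real (i * (i + b)) * (poly (M s) y - poly ([:-1, 1:] ^ Suc s * [:0, 1:] ^ (i - 1)) y))"
      unfolding k M shifted_jacobi_ode_term by (rule distrib_left)
    also have "\<dots> = d s * (m s - m (s - 1)) + d (Suc s) * (m s - m (Suc s))"
      unfolding 1 2 d_def[of s] by (simp only: mult_ac)
    finally show "c s * (y * (1 - y) * poly (pderiv (pderiv (M s))) y
        + (real (b + 1) - real (a + b + 2) * y) * poly (pderiv (M s)) y
        + real (k * (k + a + b + 1)) * poly (M s) y) =
      d s * (m s - m (s - 1)) + d (Suc s) * (m s - m (Suc s))" .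
  qed
  also have "\<dots> = (\<Sum>s\<le>k. d s * (m s - m (s - 1)) - d (Suc s) * (m (Suc s) - m s))"
    by (intro sum.cong refl) (simp add: algebra_simps)
  also have "\<dots> = d 0 * (m 0 - m (0 - 1)) - d (Suc k) * (m (Suc k) - m k)"
    using sum_telescope[of "\<lambda>s. d s * (m s - m (s - 1))" k] by simp
  also have "\<dots> = 0"
    by (simp add: d_def c_def)
  finally show ?thesis .
qed

text \<open>The energy \<open>f\<^sup>2 + y (1 - y) f'\<^sup>2 / (m (m + 1))\<close> of a solution of Legendre's equation decreases
  on the left half of the interval and increases on the right half.\<close>

lemma abs_poly_shifted_legendre_le:
  assumes y: "0 \<le> y" "y \<le> 1"
  shows "\<bar>poly (shifted_jacobi m 0 0) y\<bar> \<le> 1"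
proof (cases "m = 0")
  case True
  then show ?thesis by (simp add: shifted_jacobi_def)
next
  case False
  define f f' f'' where "f = poly (shifted_jacobi m 0 0)" and "f' = poly (pderiv (shifted_jacobi m 0 0))"
    and "f'' = poly (pderiv (pderiv (shifted_jacobi m 0 0)))"
  define \<mu> where "\<mu> = real (m * (m + 1))"
  have \<mu>: "\<mu> > 0" using False unfolding \<mu>_def by (simp only: of_nat_0_less_iff) simp
  define E where "E x = (f x)\<^sup>2 + x * (1 - x) * (f' x)\<^sup>2 / \<mu>" for x
  have D: "(E has_real_derivative - (1 - 2 * x) * (f' x)\<^sup>2 / \<mu>) (at x)" for x
  proof -
    have ode: "x * (1 - x) * f'' x = - (1 - 2 * x) * f' x - \<mu> * f x"
      using shifted_jacobi_ode[of x m 0 0] unfolding f_def f'_def f''_def \<mu>_def by (simp add: algebra_simps)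
    have "(E has_real_derivative 2 * f x * f' x + ((1 - 2 * x) * (f' x)\<^sup>2 + x * (1 - x) * (2 * f' x * f'' x)) / \<mu>) (at x)"
      unfolding E_def f_def f'_def f''_def using \<mu>
      by (auto intro!: derivative_eq_intros poly_DERIV simp: algebra_simps add_divide_distrib diff_divide_distrib power2_eq_square)
    also have "x * (1 - x) * (2 * f' x * f'' x) = 2 * f' x * (- (1 - 2 * x) * f' x - \<mu> * f x)"
      unfolding ode[symmetric] by (simp add: algebra_simps)
    also have "2 * f x * f' x + ((1 - 2 * x) * (f' x)\<^sup>2 + 2 * f' x * (- (1 - 2 * x) * f' x - \<mu> * f x)) / \<mu>
        = - (1 - 2 * x) * (f' x)\<^sup>2 / \<mu>"
      using \<mu> by (simp add: field_simps power2_eq_square)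
    finally show ?thesis .
  qed
  \<comment> \<open>At both end points the derivative term of E vanishes and f is 1 or -1, so E
    equals 1 there; each half of the interval is compared with its own end point.\<close>
  have "E y \<le> 1"
  proof (cases "y \<le> 1/2")
    case True
    have "E y \<le> E 0"
    proof (rule DERIV_nonpos_imp_nonincreasing[OF y(1)])
      fix x assume "0 \<le> x" "x \<le> y"
      then show "\<exists>D. (E has_real_derivative D) (at x) \<and> D \<le> 0"
        using D[of x] True \<mu> by (intro exI[of _ "- (1 - 2 * x) * (f' x)\<^sup>2 / \<mu>"]) (auto intro!: divide_nonpos_pos mult_nonpos_nonneg)
    qed
    then show ?thesis
      by (simp add: E_def f_def poly_shifted_jacobi_0 power_mult[symmetric] flip: power_mult)
  next
    case False
    have "E y \<le> E 1"
    proof (rule DERIV_nonneg_imp_nondecreasing[OF y(2)])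
      fix x assume "y \<le> x" "x \<le> 1"
      then show "\<exists>D. (E has_real_derivative D) (at x) \<and> 0 \<le> D"
        using D[of x] False \<mu> by (intro exI[of _ "- (1 - 2 * x) * (f' x)\<^sup>2 / \<mu>"]) (auto intro!: divide_nonneg_pos mult_nonneg_nonneg)
    qed
    then show ?thesis
      by (simp add: E_def f_def poly_shifted_jacobi_1)
  qed
  moreover have "(f y)\<^sup>2 \<le> E y"
    using y \<mu> by (simp add: E_def)
  ultimately have "(f y)\<^sup>2 \<le> 1" by simp
  then show ?thesis
    unfolding f_def by (simp add: abs_square_le_1)
qed

subsection \<open>Orthogonality of the Jacobi polynomials\<close>

text \<open>A functional on polynomials instead of functions: integrability is automatic and
  integration by parts is the product rule for \<open>pderiv\<close>.\<close>

definition poly_integral :: "real poly \<Rightarrow> real" where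
  "poly_integral p = integral {0..1} (poly p)"

lemma poly_integrable: "poly p integrable_on {0..1::real}"
  by (intro integrable_continuous_real continuous_intros)

lemma poly_integral_add: "poly_integral (p + q) = poly_integral p + poly_integral q"
  using integral_add[OF poly_integrable poly_integrable, of p q]
  unfolding poly_integral_def poly_add[symmetric] .

lemma poly_integral_diff: "poly_integral (p - q) = poly_integral p - poly_integral q"
  using integral_diff[OF poly_integrable poly_integrable, of p q]
  unfolding poly_integral_def poly_diff[symmetric] .

lemma poly_integral_smult: "poly_integral (smult c p) = c * poly_integral p"
  using integral_mult_right[of "{0..1}" c "poly p"] unfolding poly_integral_def poly_smult[symmetric] .

lemma poly_integral_0 [simp]: "poly_integral 0 = 0"
  using poly_integral_smult[of 0 0] by simp

lemma poly_integral_pderiv: "poly_integral (pderiv p) = poly p 1 - poly p 0"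
  unfolding poly_integral_def
  by (intro integral_unique fundamental_theorem_of_calculus)
     (auto simp flip: has_real_derivative_iff_has_vector_derivative intro: poly_DERIV DERIV_subset)

lemma poly_integral_by_parts:
  assumes "poly p 0 = 0" "poly p 1 = 0"
  shows "poly_integral (pderiv p * q) = - poly_integral (p * pderiv q)"
  using poly_integral_pderiv[of "p * q"] assms
  by (simp add: pderiv_mult poly_integral_add mult.commute)

lemma poly_integral_higher_by_parts:
  assumes "\<And>i. i < k \<Longrightarrow> poly ((pderiv ^^ i) p) 0 = 0" "\<And>i. i < k \<Longrightarrow> poly ((pderiv ^^ i) p) 1 = 0"
  shows "poly_integral ((pderiv ^^ k) p * q) = (-1) ^ k * poly_integral (p * (pderiv ^^ k) q)"
  using assms
proof (induction k arbitrary: q)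
  case (Suc k)
  have "poly_integral ((pderiv ^^ Suc k) p * q) = - poly_integral ((pderiv ^^ k) p * pderiv q)"
    using Suc.prems by (simp add: poly_integral_by_parts)
  also have "\<dots> = - ((-1) ^ k * poly_integral (p * (pderiv ^^ k) (pderiv q)))"
    using Suc by simp
  finally show ?case
    by (simp add: funpow_swap1)
qed simp

text \<open>The derivative of (1 - y)^(i+1) y^(j+1) integrates to 0, which trades a factor y for a
  factor 1 - y; hence the induction on j with arbitrary i.\<close>

lemma poly_integral_beta:
  "poly_integral ([:1, -1:] ^ i * [:0, 1:] ^ j) = fact i * fact j / fact (i + j + 1)"
proof (induction j arbitrary: i)
  case 0
  have "[:1, -1:] ^ i = smult (- 1 / real (i + 1)) (pderiv ([:1, -1:] ^ Suc i))"
    by (simp add: pderiv_power pderiv_pCons del: power_Suc)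
  then have "poly_integral ([:1, -1:] ^ i) = 1 / real (i + 1)"
    by (simp only: poly_integral_smult poly_integral_pderiv) simp
  then show ?case by simp
next
  case (Suc j)
  have "pderiv ([:1, -1:] ^ Suc i * [:0, 1:] ^ Suc j :: real poly) =
     smult (real (Suc j)) ([:1, -1:] ^ Suc i * [:0, 1:] ^ j) - smult (real (Suc i)) ([:1, -1:] ^ i * [:0, 1:] ^ Suc j)"
    unfolding pderiv_mult pderiv_power_Suc by (simp add: pderiv_pCons mult.commute)
  then have "poly_integral (smult (real (Suc j)) ([:1, -1:] ^ Suc i * [:0, 1:] ^ j)
     - smult (real (Suc i)) ([:1, -1:] ^ i * [:0, 1:] ^ Suc j)) = 0"
    using poly_integral_pderiv[of "[:1, -1:] ^ Suc i * [:0, 1:] ^ Suc j"] by simp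
  then have "real (Suc i) * poly_integral ([:1, -1:] ^ i * [:0, 1:] ^ Suc j) =
      real (Suc j) * (fact (Suc i) * fact j / fact (Suc i + j + 1))"
    unfolding poly_integral_diff poly_integral_smult Suc.IH by simp
  also have "real (Suc j) * (fact (Suc i) * fact j / fact (Suc i + j + 1)) =
      real (Suc i) * (fact i * fact (Suc j) / fact (i + Suc j + 1))"
    by (simp only: fact_Suc of_nat_mult of_nat_fact add_Suc add_Suc_right times_divide_eq_right mult_ac)
  finally show ?case
    by (simp only: mult_cancel_left of_nat_eq_0_iff) simp
qed

text \<open>Each derivative costs at most one linear factor. This is what kills the boundary terms
  in the repeated integration by parts.\<close>

lemma linear_power_dvd_higher_pderiv:
  fixes p :: "real poly"
  shows "[:c, d:] ^ (n + i) dvd p \<Longrightarrow> [:c, d:] ^ n dvd (pderiv ^^ i) p"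
proof (induction i arbitrary: n)
  case (Suc i)
  then have "[:c, d:] ^ Suc n dvd (pderiv ^^ i) p"
    by (simp del: power_Suc flip: add_Suc)
  then obtain r where r: "(pderiv ^^ i) p = [:c, d:] ^ Suc n * r"
    by (elim dvdE)
  have "pderiv ([:c, d:] ^ Suc n * r) = [:c, d:] ^ n * ([:c, d:] * pderiv r + smult (real (Suc n) * d) r)"
    unfolding pderiv_mult pderiv_power_Suc by (simp add: pderiv_pCons algebra_simps)
  then show ?case
    by (simp only: funpow.simps o_apply r dvd_triv_left)
qed simp

text \<open>Rodrigues' formula and k integrations by parts: the weight (1 - y)^(a+k) y^(b+k)
  vanishes to order at least k at both ends, and the signs of the two operations cancel.
  Orthogonality and norm both follow by a choice of q.\<close>

lemma poly_integral_shifted_jacobi: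
  "poly_integral ([:1, -1:] ^ a * [:0, 1:] ^ b * shifted_jacobi k a b * q) =
   poly_integral ([:1, -1:] ^ (a + k) * [:0, 1:] ^ (b + k) * (pderiv ^^ k) q) / fact k"
proof -
  let ?W = "[:1, -1:] ^ (a + k) * [:0, 1:] ^ (b + k) :: real poly"
  have z: "poly ((pderiv ^^ i) ?W) 0 = 0" "poly ((pderiv ^^ i) ?W) 1 = 0" if "i < k" for i
  proof -
    have "[:0, 1:] ^ 1 dvd (pderiv ^^ i) ?W" "[:1, -1:] ^ 1 dvd (pderiv ^^ i) ?W"
      using that by (intro linear_power_dvd_higher_pderiv dvd_mult dvd_mult2 le_imp_power_dvd; simp)+
    then obtain r0 r1 where "(pderiv ^^ i) ?W = [:0, 1:] ^ 1 * r0" "(pderiv ^^ i) ?W = [:1, -1:] ^ 1 * r1"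
      by (elim dvdE)
    then have "poly ((pderiv ^^ i) ?W) 0 = poly ([:0, 1:] ^ 1 * r0) 0" "poly ((pderiv ^^ i) ?W) 1 = poly ([:1, -1:] ^ 1 * r1) 1"
      by (simp_all only:)
    then show "poly ((pderiv ^^ i) ?W) 0 = 0" "poly ((pderiv ^^ i) ?W) 1 = 0"
      by simp_all
  qed
  have "fact k * poly_integral ([:1, -1:] ^ a * [:0, 1:] ^ b * shifted_jacobi k a b * q) =
     poly_integral (smult (fact k) ([:1, -1:] ^ a * [:0, 1:] ^ b * shifted_jacobi k a b) * q)"
    by (simp add: poly_integral_smult)
  also have "\<dots> = (-1) ^ k * poly_integral ((pderiv ^^ k) ?W * q)"
    unfolding shifted_jacobi_Rodrigues by (simp add: poly_integral_smult)
  also have "\<dots> = poly_integral (?W * (pderiv ^^ k) q)"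
    by (simp add: poly_integral_higher_by_parts z)
  finally show ?thesis
    by (simp add: field_simps)
qed

lemma shifted_jacobi_orthogonal_lower:
  assumes "degree q < k"
  shows "poly_integral ([:1, -1:] ^ a * [:0, 1:] ^ b * shifted_jacobi k a b * q) = 0"
proof -
  have "(pderiv ^^ k) q = 0"
    using assms by (intro poly_eqI) (simp add: coeff_higher_pderiv coeff_eq_0)
  then show ?thesis
    by (simp add: poly_integral_shifted_jacobi)
qed

lemma shifted_jacobi_orthogonal:
  assumes "j \<noteq> k"
  shows "poly_integral ([:1, -1:] ^ a * [:0, 1:] ^ b * shifted_jacobi j a b * shifted_jacobi k a b) = 0"
proof (cases "j < k")
  case True
  then have "poly_integral ([:1, -1:] ^ a * [:0, 1:] ^ b * shifted_jacobi k a b * shifted_jacobi j a b) = 0"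
    using degree_shifted_jacobi_le[of j a b] by (intro shifted_jacobi_orthogonal_lower) simp
  then show ?thesis by (simp add: mult_ac)
next
  case False
  then show ?thesis
    using assms degree_shifted_jacobi_le[of k a b] by (intro shifted_jacobi_orthogonal_lower) simp
qed

text \<open>With q the polynomial itself, its k-th derivative is k! times the leading coefficient,
  and a Beta integral remains.\<close>

lemma shifted_jacobi_norm:
  "poly_integral ([:1, -1:] ^ a * [:0, 1:] ^ b * shifted_jacobi k a b * shifted_jacobi k a b) =
   fact (k + a) * fact (k + b) / (real (2 * k + a + b + 1) * fact k * fact (k + a + b))"
proof -
  have "(pderiv ^^ k) (shifted_jacobi k a b) = [:fact k * real ((2 * k + a + b) choose k):]"
  proof (rule poly_eqI)
    fix i
    show "coeff ((pderiv ^^ k) (shifted_jacobi k a b)) i = coeff [:fact k * real ((2 * k + a + b) choose k):] i"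
    proof (cases i)
      case 0
      then show ?thesis
        by (simp add: coeff_higher_pderiv coeff_shifted_jacobi pochhammer_fact)
    next
      case (Suc j)
      then have "coeff (shifted_jacobi k a b) (i + k) = 0"
        using degree_shifted_jacobi_le[of k a b] by (intro coeff_eq_0) simp
      then show ?thesis using Suc
        by (simp add: coeff_higher_pderiv)
    qed
  qed
  then have "poly_integral ([:1, -1:] ^ a * [:0, 1:] ^ b * shifted_jacobi k a b * shifted_jacobi k a b) =
     real ((2 * k + a + b) choose k) * poly_integral ([:1, -1:] ^ (a + k) * [:0, 1:] ^ (b + k))"
    unfolding poly_integral_shifted_jacobi by (simp add: poly_integral_smult)
  also have "real ((2 * k + a + b) choose k) = fact (2 * k + a + b) / (fact k * fact (k + a + b))"
    using binomial_fact[of k "2 * k + a + b", where 'a = real] by (simp add: mult_2 add.assoc)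
  also have "poly_integral ([:1, -1:] ^ (a + k) * [:0, 1:] ^ (b + k)) =
      fact (k + a) * fact (k + b) / fact (Suc (2 * k + a + b))"
    unfolding poly_integral_beta by (simp only: mult_2 add_ac Suc_eq_plus1)
  also have "fact (2 * k + a + b) / (fact k * fact (k + a + b)) * (fact (k + a) * fact (k + b) / fact (Suc (2 * k + a + b)))
      = fact (k + a) * fact (k + b) / (real (2 * k + a + b + 1) * fact k * fact (k + a + b))"
    by (simp only: fact_Suc Suc_eq_plus1) (simp add: divide_simps)
  finally show ?thesis .
qed

subsection \<open>Completeness of polynomials on the unit interval\<close>

text \<open>By orthogonality the integral of f^2 equals that of f (f - q) for every polynomial q,
  and a Bernstein polynomial of f makes the latter arbitrarily small.\<close>

lemma continuous_orthogonal_all_polys: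
  fixes f :: "real \<Rightarrow> real"
  assumes f: "continuous_on {0..1} f"
    and orth: "\<And>q. integral {0..1} (\<lambda>x. f x * poly q x) = 0"
    and x: "x \<in> {0..1}"
  shows "f x = 0"
proof -
  obtain M where M: "\<And>x. x \<in> {0..1} \<Longrightarrow> \<bar>f x\<bar> \<le> M" and "M > 0"
    using compact_imp_bounded[OF compact_continuous_image[OF f compact_Icc]]
    unfolding bounded_pos by (auto simp del: atLeastAtMost_iff)
  have int: "g integrable_on {0..1}" if "continuous_on {0..1} g" for g :: "real \<Rightarrow> real"
    using that by (rule integrable_continuous_real)
  have "integral {0..1} (\<lambda>x. f x * f x) \<le> 0 + e" if "e > 0" for e
  proof -
    from \<open>M > 0\<close> that have "e / M > 0" by simp
    from Bernstein_Weierstrass[OF f this] obtain N where N: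
      "\<And>n x. N \<le> n \<Longrightarrow> x \<in> {0..1} \<Longrightarrow> \<bar>f x - (\<Sum>k\<le>n. f (k / n) * Bernstein n k x)\<bar> < e / M"
      by blast
    define q where "q = (\<Sum>k\<le>N. smult (f (k / N)) (smult (real (N choose k)) ([:0, 1:] ^ k * [:1, -1:] ^ (N - k))))"
    have q: "poly q x = (\<Sum>k\<le>N. f (k / N) * Bernstein N k x)" for x
      by (simp add: q_def poly_sum Bernstein_def mult.assoc)
    have "integral {0..1} (\<lambda>x. f x * f x) = integral {0..1} (\<lambda>x. f x * (f x - poly q x) + f x * poly q x)"
      by (intro integral_cong) (simp add: algebra_simps)
    also have "\<dots> = integral {0..1} (\<lambda>x. f x * (f x - poly q x))"
      using orth[of q] by (subst integral_add) (auto intro!: int continuous_intros f)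
    also have "\<dots> \<le> integral {0..1} (\<lambda>x::real. e)"
    proof (intro integral_le int continuous_intros f)
      fix x :: real assume x: "x \<in> {0..1}"
      have "f x * (f x - poly q x) \<le> \<bar>f x\<bar> * \<bar>f x - poly q x\<bar>"
        by (simp flip: abs_mult)
      also have "\<dots> \<le> M * (e / M)"
        using N[of N x] M[OF x] x \<open>M > 0\<close> unfolding q[symmetric] by (intro mult_mono) auto
      finally show "f x * (f x - poly q x) \<le> e"
        using \<open>M > 0\<close> by simp
    qed
    finally show ?thesis by simp
  qed
  then have "integral {0..1} (\<lambda>x. f x * f x) \<le> 0"
    by (rule field_le_epsilon)
  moreover have "integral {0..1} (\<lambda>x. f x * f x) \<ge> 0"
    by (intro integral_nonneg int continuous_intros f) auto
  ultimately have "integral {0..1} (\<lambda>x. f x * f x) = 0"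
    by simp
  then have "\<forall>x\<in>{0..1}. f x * f x = 0"
    by (subst (asm) integral_eq_0_iff) (auto intro!: continuous_intros f)
  with x show ?thesis by simp
qed

text \<open>Since B k has exact degree k, subtracting a multiple of it lowers the degree; the family
  spans all polynomials by induction on the degree.\<close>

lemma continuous_orthogonal_poly_basis:
  fixes f :: "real \<Rightarrow> real" and B :: "nat \<Rightarrow> real poly"
  assumes f: "continuous_on {0..1} f"
    and B: "\<And>k. degree (B k) \<le> k" "\<And>k. coeff (B k) k \<noteq> 0"
    and orth: "\<And>k. integral {0..1} (\<lambda>x. f x * poly (B k) x) = 0"
    and x: "x \<in> {0..1}"
  shows "f x = 0"
proof (rule continuous_orthogonal_all_polys[OF f _ x])
  have int: "(\<lambda>x. f x * poly q x) integrable_on {0..1}" for q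
    by (intro integrable_continuous_real continuous_intros f)
  have "integral {0..1} (\<lambda>x. f x * poly q x) = 0" if "degree q < d" for d q
    using that
  proof (induction d arbitrary: q)
    case (Suc d)
    define c where "c = coeff q d / coeff (B d) d"
    define q' where "q' = q - smult c (B d)"
    have *: "integral {0..1} (\<lambda>x. f x * poly q' x) = 0"
    proof (cases "q' = 0")
      case False
      have "degree q' \<le> d"
        unfolding q'_def using Suc.prems B(1)[of d] by (intro degree_diff_le) auto
      moreover have "coeff q' d = 0"
        using B(2)[of d] by (simp add: q'_def c_def)
      ultimately have "degree q' < d"
        using False by (metis eq_zero_or_degree_less)
      then show ?thesis by (rule Suc.IH)
    qed simp
    have "integral {0..1} (\<lambda>x. f x * poly q x) =
        integral {0..1} (\<lambda>x. f x * poly q' x + c * (f x * poly (B d) x))"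
      by (intro integral_cong) (simp add: q'_def algebra_simps)
    also have "\<dots> = 0"
      using * orth[of d] int[of q'] integrable_on_mult_right[OF int[of "B d"], of c]
      by (subst integral_add) auto
    finally show ?case .
  qed simp
  then show "integral {0..1} (\<lambda>x. f x * poly q x) = 0" for q
    by blast
qed

section \<open>Uniformly dominated series\<close>

lemma continuous_on_suminf_M_test:
  fixes f :: "nat \<Rightarrow> 'a::topological_space \<Rightarrow> real"
  assumes "\<And>k. continuous_on S (f k)" "\<And>k x. x \<in> S \<Longrightarrow> \<bar>f k x\<bar> \<le> M k" "summable M"
  shows "continuous_on S (\<lambda>x. \<Sum>k. f k x)"
  using assms
  by (intro uniform_limit_theorem[OF _ Weierstrass_m_test[of S f M]] always_eventually allI continuous_on_sum) auto

lemma integral_sums_M_test: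
  fixes f :: "nat \<Rightarrow> real \<Rightarrow> real"
  assumes f: "\<And>k. continuous_on {0..1} (f k)" "\<And>k x. x \<in> {0..1} \<Longrightarrow> \<bar>f k x\<bar> \<le> M k" "summable M"
  shows "(\<lambda>k. integral {0..1} (f k)) sums integral {0..1} (\<lambda>x. \<Sum>k. f k x)"
proof -
  have "uniform_limit {0..1} (\<lambda>n x. \<Sum>i<n. f i x) (\<lambda>x. suminf (\<lambda>i. f i x)) sequentially"
    using f by (intro Weierstrass_m_test[of _ f M]) auto
  from uniform_limit_integral[OF this]
  obtain I J where I: "\<And>n. ((\<lambda>x. \<Sum>i<n. f i x) has_integral I n) {0..1}"
    and J: "((\<lambda>x. \<Sum>k. f k x) has_integral J) {0..1}" and IJ: "I \<longlonglongrightarrow> J"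
    using f by (auto intro!: continuous_on_sum)
  have "I n = (\<Sum>i<n. integral {0..1} (f i))" for n
    using integral_unique[OF I[of n]] f
    by (subst (asm) integral_sum) (auto intro: integrable_continuous_real)
  then have "I = (\<lambda>n. \<Sum>i<n. integral {0..1} (f i))"
    by (rule ext)
  then show ?thesis
    using IJ J by (simp add: sums_def integral_unique)
qed

subsection \<open>Bounds for the spectral expansion\<close>

text \<open>A single term of the exponential series is below its sum.\<close>

lemma power_le_fact_exp:
  fixes x q :: real
  assumes "x \<ge> 0" "q > 0"
  shows "x ^ P \<le> fact P / q ^ P * exp (q * x)"
proof -
  have "(\<Sum>i\<in>{P}. (q * x) ^ i /\<^sub>R fact i) \<le> exp (q * x)"
    unfolding exp_def using assms
    by (intro sum_le_suminf summable_exp_generic) auto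
  then show ?thesis
    using assms by (simp add: field_simps power_mult_distrib)
qed

lemma summable_power_exp_linear:
  fixes c q :: real
  assumes "c \<ge> 0" "q > 0"
  shows "summable (\<lambda>m. (2 * real m + c) ^ P * exp (- (q * real m)))"
proof (rule summable_comparison_test)
  \<comment> \<open>The rate q/4 acting on 2m + c spends half of the decay exp(-qm) on the
    polynomial factor; the other half leaves a geometric series.\<close>
  define C where "C = fact P / (q / 4) ^ P * exp (q / 4 * c)"
  have "norm ((2 * real m + c) ^ P * exp (- (q * real m))) \<le> C * exp (- (q / 2)) ^ m" for m
  proof -
    have "(2 * real m + c) ^ P \<le> fact P / (q / 4) ^ P * exp (q / 4 * (2 * real m + c))"
      using assms by (intro power_le_fact_exp) auto
    then have "(2 * real m + c) ^ P * exp (- (q * real m)) \<le>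
        fact P / (q / 4) ^ P * exp (q / 4 * (2 * real m + c)) * exp (- (q * real m))"
      by (intro mult_right_mono) auto
    also have "\<dots> = fact P / (q / 4) ^ P * (exp (q / 4 * (2 * real m + c)) * exp (- (q * real m)))"
      by simp
    also have "exp (q / 4 * (2 * real m + c)) * exp (- (q * real m)) = exp (q / 4 * c) * exp (- (q / 2)) ^ m"
      by (simp add: exp_of_nat_mult[symmetric] algebra_simps flip: exp_add)
    finally show ?thesis using assms by (simp add: C_def)
  qed
  then show "\<exists>N. \<forall>m\<ge>N. norm ((2 * real m + c) ^ P * exp (- (q * real m))) \<le> C * exp (- (q / 2)) ^ m"
    by blast
  show "summable (\<lambda>m. C * exp (- (q / 2)) ^ m)"
    using assms by (intro summable_mult summable_geometric) auto
qed

text \<open>The Gaussian factor is exp(-qk)^k, so all exponential factors combine into one k-th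
  power whose base tends to 0 and is eventually below 1/2.\<close>

lemma summable_power_exp_quadratic:
  fixes K q :: real
  assumes K: "K > 0" and q: "q > 0"
  shows "summable (\<lambda>k. real (k + 1) ^ P * K ^ k * exp (- (q * real k ^ 2)))"
proof -
  have "(\<lambda>k. exp 1 * K * exp (- (q * real k))) \<longlonglongrightarrow> 0"
    proof -
    have "(\<lambda>k. exp 1 * K * exp (- q) ^ k) \<longlonglongrightarrow> 0"
      using q by (intro tendsto_mult_right_zero LIMSEQ_power_zero) simp
    then show ?thesis by (simp add: exp_of_nat_mult[symmetric] mult_ac)
  qed
  then have "\<forall>\<^sub>F k in sequentially. exp 1 * K * exp (- (q * real k)) < 1 / 2"
    by (rule order_tendstoD) simp
  then have ev: "\<forall>\<^sub>F k in sequentially. norm (real (k + 1) ^ P * K ^ k * exp (- (q * real k ^ 2))) \<le> fact P * exp 1 * (1 / 2) ^ k"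
  proof eventually_elim
    case (elim k)
    have "real (k + 1) ^ P \<le> fact P / 1 ^ P * exp (1 * real (k + 1))"
      by (intro power_le_fact_exp) auto
    then have "real (k + 1) ^ P \<le> fact P * exp 1 * exp 1 ^ k"
      by (simp add: exp_add exp_of_nat_mult[symmetric] mult_ac)
    then have "real (k + 1) ^ P * (K ^ k * exp (- (q * real k ^ 2))) \<le> fact P * exp 1 * exp 1 ^ k * (K ^ k * exp (- (q * real k ^ 2)))"
      using K by (intro mult_right_mono) auto
    also have "exp (- (q * real k ^ 2)) = exp (- (q * real k)) ^ k"
      by (simp add: exp_of_nat_mult[symmetric] power2_eq_square mult_ac)
    also have "fact P * exp 1 * exp 1 ^ k * (K ^ k * exp (- (q * real k)) ^ k) =
        fact P * exp 1 * (exp 1 * K * exp (- (q * real k))) ^ k"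
      by (simp add: power_mult_distrib)
    also have "\<dots> \<le> fact P * exp 1 * (1 / 2) ^ k"
      using elim K by (intro mult_left_mono power_mono) auto
    finally show ?case
      using K by (simp add: mult_ac exp_of_nat_mult[symmetric] power2_eq_square)
  qed
  show ?thesis
    by (rule summable_comparison_test_ev[OF ev]) (intro summable_mult summable_geometric, auto)
qed


definition spectral_coeff :: "nat \<Rightarrow> real \<Rightarrow> nat \<Rightarrow> nat \<Rightarrow> real" where
  "spectral_coeff n t m k = sigma_coeff n k m * exp (- real (4 * k * (k + 2 * n + 2 * m + 1) + 8 * n * m) * t)"

lemma kernel_term_eq:
  "kernel_term n t r \<phi> m k = spectral_coeff n t m k * (cos r ^ 2) ^ m
     * poly (shifted_jacobi m 0 0) ((cos \<phi>)\<^sup>2) * poly (shifted_jacobi k (2 * n - 1) (2 * m + 1)) ((cos r)\<^sup>2)"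
  unfolding kernel_term_def spectral_coeff_def
  by (simp only: cos_double_cos poly_jacobi_poly power_mult)

text \<open>A dominating product of a function of m and a function of k permits both summations to
  be handled separately by the M-test. The polynomial growth is split by N \<le>
  (2m+2n+1)(k+1).\<close>

lemma spectral_coeff_bound:
  assumes n: "n \<ge> 1" and t: "t > 0"
  obtains a b :: "nat \<Rightarrow> real" where "summable a" "summable b" "\<And>m. 0 \<le> a m" "\<And>k. 0 \<le> b k"
    "\<And>m k v. v \<in> {0..1} \<Longrightarrow>
      \<bar>spectral_coeff n t m k * poly (shifted_jacobi k (2 * n - 1) (2 * m + 1)) v\<bar> \<le> a m * b k"
proof -
  define C where "C = Gamma (2 * real n) / (4 * pi ^ (2 * n + 2)) * 2 * 2 ^ (2 * n - 1)"
  have Gamma: "Gamma (2 * real n) / (4 * pi ^ (2 * n + 2)) \<ge> 0"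
    using n by (intro divide_nonneg_nonneg Gamma_real_nonneg) auto
  then have C: "C \<ge> 0"
    unfolding C_def by (intro mult_nonneg_nonneg) auto
  define a where "a m = C * ((2 * real m + real (2 * n + 1)) ^ (2 * n + 1) * exp (- ((8 * real n * t) * real m)))" for m
  define b where "b k = real (k + 1) ^ (2 * n + 1) * (1 / t) ^ k * exp (- (2 * t * real k ^ 2))" for k
  have "summable a"
    unfolding a_def using n t by (intro summable_mult summable_power_exp_linear) auto
  moreover have "summable b"
    unfolding b_def using t by (intro summable_power_exp_quadratic) auto
  moreover have "0 \<le> a m" "0 \<le> b k" for m k
    using C t by (simp_all add: a_def b_def)
  moreover have "\<bar>spectral_coeff n t m k * poly (shifted_jacobi k (2 * n - 1) (2 * m + 1)) v\<bar> \<le> a m * b k"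
    if v: "v \<in> {0..1}" for m k v
  proof -
    \<comment> \<open>The bracket in the eigenvalue part 4k(k+2n+2m+1). It also dominates the base
      in the Jacobi bound and, up to a factor 2, the factors of \<open>sigma_coeff\<close>.\<close>
    define N where "N = k + 2 * m + 2 * n + 1"
    have "(k + 2 * m + 2 * n) choose (2 * n - 1) \<le> (k + 2 * m + 2 * n) ^ (2 * n - 1)"
      by (intro binomial_le_pow) simp
    also have "\<dots> \<le> N ^ (2 * n - 1)"
      by (intro power_mono) (auto simp: N_def)
    finally have ch: "real ((k + 2 * m + 2 * n) choose (2 * n - 1)) \<le> real N ^ (2 * n - 1)"
      by (metis of_nat_le_iff of_nat_power)
    have "\<bar>sigma_coeff n k m\<bar> = Gamma (2 * real n) / (4 * pi ^ (2 * n + 2)) *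
        (real (2 * k + 2 * m + 2 * n + 1) * real (2 * m + 1) * real ((k + 2 * m + 2 * n) choose (2 * n - 1)))"
      by (simp only: sigma_coeff_def abs_mult abs_of_nonneg[OF Gamma] abs_of_nat mult.assoc)
    also have "\<dots> \<le> Gamma (2 * real n) / (4 * pi ^ (2 * n + 2)) * ((2 * real N) * real N * real N ^ (2 * n - 1))"
      using Gamma ch by (intro mult_left_mono mult_mono) (auto simp: N_def)
    also have "(2 * real N) * real N * real N ^ (2 * n - 1) = 2 * real N ^ (2 * n + 1)"
    proof -
      have "2 * n + 1 = Suc (Suc (2 * n - 1))" using n by simp
      then show ?thesis by (simp only: power_Suc)
    qed
    finally have 1: "\<bar>sigma_coeff n k m\<bar> \<le> Gamma (2 * real n) / (4 * pi ^ (2 * n + 2)) * (2 * real N ^ (2 * n + 1))" .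
    have "\<bar>poly (shifted_jacobi k (2 * n - 1) (2 * m + 1)) v\<bar> \<le> 2 ^ (2 * n - 1 + k) * real (2 * m + 1 + k + 1) ^ k"
      using v by (intro abs_poly_shifted_jacobi_le) auto
    also have "\<dots> \<le> 2 ^ (2 * n - 1 + k) * real N ^ k"
      using n by (intro mult_left_mono power_mono) (auto simp: N_def)
    finally have 2: "\<bar>poly (shifted_jacobi k (2 * n - 1) (2 * m + 1)) v\<bar> \<le> 2 ^ (2 * n - 1) * 2 ^ k * real N ^ k"
      by (simp add: power_add)
    have 3: "real N ^ (2 * n + 1) \<le> (2 * real m + real (2 * n + 1)) ^ (2 * n + 1) * real (k + 1) ^ (2 * n + 1)"
      unfolding power_mult_distrib[symmetric] by (intro power_mono) (auto simp: N_def algebra_simps)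
    \<comment> \<open>The factor exp(-4kNt) is used as two copies of exp(-2tN)^k. The first absorbs
      N^k from the Jacobi bound, by z exp(-z) \<le> 1; the second yields the Gaussian decay in k,
      and exp(-8nmt) is left for the decay in m.\<close>
    have "2 * t * real N \<le> exp (2 * t * real N)"
      using exp_ge_add_one_self[of "2 * t * real N"] by linarith
    then have "real N * exp (- (2 * t * real N)) \<le> 1 / (2 * t)"
      using t by (simp add: exp_minus field_simps)
    then have 4: "(real N * exp (- (2 * t * real N))) ^ k \<le> (1 / (2 * t)) ^ k"
      by (intro power_mono) auto
    have 5: "exp (- (2 * t * real N)) ^ k \<le> exp (- (2 * t * real k ^ 2))"
      using t by (simp add: exp_of_nat_mult[symmetric] power2_eq_square N_def mult_left_mono)
    have "exp (- real (4 * k * (k + 2 * n + 2 * m + 1) + 8 * n * m) * t) =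
        exp (- (2 * t * real N)) ^ k * exp (- (2 * t * real N)) ^ k * exp (- ((8 * real n * t) * real m))"
      by (simp add: exp_of_nat_mult[symmetric] N_def algebra_simps flip: exp_add)
    then have "\<bar>spectral_coeff n t m k * poly (shifted_jacobi k (2 * n - 1) (2 * m + 1)) v\<bar> =
        \<bar>sigma_coeff n k m\<bar> * \<bar>poly (shifted_jacobi k (2 * n - 1) (2 * m + 1)) v\<bar> *
        (exp (- (2 * t * real N)) ^ k * exp (- (2 * t * real N)) ^ k * exp (- ((8 * real n * t) * real m)))"
      by (simp add: spectral_coeff_def abs_mult)
    also have "\<dots> \<le> (Gamma (2 * real n) / (4 * pi ^ (2 * n + 2)) * (2 * real N ^ (2 * n + 1))) *
       (2 ^ (2 * n - 1) * 2 ^ k * real N ^ k) *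
        (exp (- (2 * t * real N)) ^ k * exp (- (2 * t * real N)) ^ k * exp (- ((8 * real n * t) * real m)))"
      by (intro mult_right_mono mult_mono 1 2 mult_nonneg_nonneg Gamma) auto
    also have "\<dots> = C * 2 ^ k * exp (- ((8 * real n * t) * real m)) *
        (real N ^ (2 * n + 1) * ((real N * exp (- (2 * t * real N))) ^ k * exp (- (2 * t * real N)) ^ k))"
      by (simp add: C_def power_mult_distrib mult_ac)
    also have "\<dots> \<le> C * 2 ^ k * exp (- ((8 * real n * t) * real m)) *
        (((2 * real m + real (2 * n + 1)) ^ (2 * n + 1) * real (k + 1) ^ (2 * n + 1)) * ((1 / (2 * t)) ^ k * exp (- (2 * t * real k ^ 2))))"
      using C t by (intro mult_left_mono mult_mono 3 4 5) auto
    also have "\<dots> = C * ((2 * real m + real (2 * n + 1)) ^ (2 * n + 1) * exp (- ((8 * real n * t) * real m))) *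
        (real (k + 1) ^ (2 * n + 1) * (2 ^ k * (1 / (2 * t)) ^ k) * exp (- (2 * t * real k ^ 2)))"
      by (simp only: mult_ac)
    also have "2 ^ k * (1 / (2 * t)) ^ k = (1 / t) ^ k"
      by (simp flip: power_mult_distrib)
    finally show ?thesis
      by (simp only: a_def b_def)
  qed
  ultimately show ?thesis
    by (rule that)
qed

text \<open>The origin of \<open>sigma_coeff\<close>: times the squared norm of the eigenfunction,
  where 1/(2m+1) is the Legendre part, it gives the value of the eigenfunction at the north pole
  divided by the constant of the measure.\<close>

lemma sigma_coeff_norm:
  assumes n: "n \<ge> 1"
  shows "sigma_coeff n k m * poly_integral ([:1, -1:] ^ (2 * n - 1) * [:0, 1:] ^ (2 * m + 1)
      * shifted_jacobi k (2 * n - 1) (2 * m + 1) * shifted_jacobi k (2 * n - 1) (2 * m + 1)) / real (2 * m + 1) =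
    Gamma (2 * real n) / (4 * pi ^ (2 * n + 2)) * real ((k + 2 * n - 1) choose k)"
proof -
  obtain a where a: "2 * n - 1 = a" "2 * n = Suc a"
    using n by (metis Suc_diff_1 mult_is_0 not_one_le_zero zero_neq_numeral gr0I)
  have 1: "real ((k + 2 * m + 2 * n) choose a) = fact (k + a + (2 * m + 1)) / (fact a * fact (k + (2 * m + 1)))"
    using binomial_fact[of a "k + 2 * m + Suc a", where 'a = real] by (simp add: a add_ac)
  have 2: "real ((k + 2 * n - 1) choose k) = fact (k + a) / (fact k * fact a)"
    using binomial_fact[of k "k + a", where 'a = real] by (simp add: a)
  have 3: "2 * k + a + (2 * m + 1) + 1 = 2 * k + 2 * m + 2 * n + 1"
    using a by simp
  have cancel: "g * x * y * (f4 / (fa * f2)) * (f1 * f2 / (x * f3 * f4)) / y = g * (f1 / (f3 * fa))"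
    if "x \<noteq> 0" "y \<noteq> 0" "f2 \<noteq> 0" "f4 \<noteq> 0" for g x y f1 f2 f3 f4 fa :: real
    using that by simp
  show ?thesis
    unfolding shifted_jacobi_norm sigma_coeff_def a(1) 1 2 3
    by (rule cancel) (simp_all del: of_nat_add of_nat_mult of_nat_Suc)
qed

text \<open>The Legendre coefficients of \<open>G\<close> in the second variable are functions of the first, and
  these are identified by their Jacobi coefficients.\<close>

lemma spectral_expansion:
  fixes G :: "real \<times> real \<Rightarrow> real"
  assumes n: "n \<ge> 1" and t: "t > 0"
    and G: "continuous_on ({0..1} \<times> {0..1}) G"
    and coeffs: "\<And>m k. integral {0..1} (\<lambda>v. (1 - v) ^ (2 * n - 1) * v ^ (m + 1)
        * poly (shifted_jacobi k (2 * n - 1) (2 * m + 1)) v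
        * integral {0..1} (\<lambda>p. G (v, p) * poly (shifted_jacobi m 0 0) p)) =
      Gamma (2 * real n) / (4 * pi ^ (2 * n + 2))
        * exp (- real (4 * k * (k + 2 * n + 2 * m + 1) + 8 * n * m) * t) * real ((k + 2 * n - 1) choose k)"
    and v: "v \<in> {0..1}" and p: "p \<in> {0..1}"
  defines "term \<equiv> \<lambda>m k. spectral_coeff n t m k * v ^ m * poly (shifted_jacobi m 0 0) p
     * poly (shifted_jacobi k (2 * n - 1) (2 * m + 1)) v"
  shows "(\<forall>m. summable (term m)) \<and> (\<lambda>m. \<Sum>k. term m k) sums G (v, p)"
proof -
  define J where "J m k = shifted_jacobi k (2 * n - 1) (2 * m + 1)" for m k
  define Q where "Q m = shifted_jacobi m 0 0" for m
  define c where "c = spectral_coeff n t"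
  obtain a b where ab: "summable a" "summable b" "\<And>m. 0 \<le> a m" "\<And>k. 0 \<le> b k"
    and bound: "\<And>m k v. v \<in> {0..1} \<Longrightarrow> \<bar>c m k * poly (J m k) v\<bar> \<le> a m * b k"
    unfolding c_def J_def using spectral_coeff_bound[OF n t] by metis
  have Q: "\<bar>poly (Q m) p\<bar> \<le> 1" if "p \<in> {0..1}" for m p
    unfolding Q_def using that by (intro abs_poly_shifted_legendre_le) auto
  \<comment> \<open>The m-th Legendre coefficient of the series is v^m \<open>T m v\<close> /
    (2m+1), the divisor coming from the squared norm of the Legendre polynomial.\<close>
  define T where "T m v = (\<Sum>k. c m k * poly (J m k) v)" for m v
  have sumb: "summable (\<lambda>k. a m * b k)" for m
    using ab by (intro summable_mult)
  have summable_T: "summable (\<lambda>k. c m k * poly (J m k) v)" if "v \<in> {0..1}" for m v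
    using bound[OF that] by (intro summable_comparison_test[OF _ sumb[of m]]) auto
  have cont_T: "continuous_on {0..1} (T m)" for m
    unfolding T_def using bound by (intro continuous_on_suminf_M_test[OF _ _ sumb[of m]] continuous_intros) auto
  have T_le: "\<bar>T m v\<bar> \<le> a m * suminf b" if "v \<in> {0..1}" for m v
  proof -
    have "norm (T m v) \<le> (\<Sum>k. a m * b k)"
      unfolding T_def using bound[OF that] by (intro norm_suminf_le sumb) auto
    then show ?thesis
      using ab by (simp add: suminf_mult)
  qed
  have int: "f integrable_on {0..1}" if "continuous_on {0..1} f" for f :: "real \<Rightarrow> real"
    using that by (rule integrable_continuous_real)
  define S where "S v p = (\<Sum>m. v ^ m * T m v * poly (Q m) p)" for v p
  have b_nonneg: "0 \<le> suminf b"
    using ab by (intro suminf_nonneg) auto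
  have S_bound: "\<bar>v ^ m * T m v * poly (Q m) p\<bar> \<le> a m * suminf b" if "v \<in> {0..1}" "p \<in> {0..1}" for m v p
  proof -
    have "\<bar>v ^ m * T m v * poly (Q m) p\<bar> = \<bar>v\<bar> ^ m * \<bar>T m v\<bar> * \<bar>poly (Q m) p\<bar>"
      by (simp add: abs_mult power_abs)
    also have "\<dots> \<le> 1 * (a m * suminf b) * 1"
      using that T_le[OF that(1), of m] Q[OF that(2)] ab(3)[of m] b_nonneg
      by (intro mult_mono power_le_one mult_nonneg_nonneg) auto
    finally show ?thesis by simp
  qed
  have sum_ab: "summable (\<lambda>m. a m * suminf b)"
    using ab by (intro summable_mult2)
  have cont_G1: "continuous_on {0..1} (\<lambda>p. G (v, p))" if "v \<in> {0..1}" for v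
    using that by (intro continuous_on_compose2[OF G] continuous_intros) auto
  define g where "g m v = integral {0..1} (\<lambda>p. G (v, p) * poly (Q m) p)" for m v
  have cont_g: "continuous_on {0..1} (g m)" for m
  proof -
    have "continuous_on ({0..1} \<times> cbox 0 1) (\<lambda>(v, p). G (v, p) * poly (Q m) p)"
      unfolding split_beta by (intro continuous_intros continuous_on_compose2[OF G]) auto
    from integral_continuous_on_param[OF this] show ?thesis
      by (simp add: g_def[abs_def])
  qed
  have g: "g m v = v ^ m * T m v / real (2 * m + 1)" if v: "v \<in> {0..1}" for m v
  proof -
    define W where "W k = poly_integral ([:1, -1:] ^ (2 * n - 1) * [:0, 1:] ^ (2 * m + 1) * J m k * J m k)" for k
    define \<delta> where "\<delta> v = g m v - v ^ m * T m v / real (2 * m + 1)" for v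
    have cont_\<delta>: "continuous_on {0..1} \<delta>"
      unfolding \<delta>_def by (intro continuous_intros cont_g cont_T) (simp del: of_nat_add of_nat_mult of_nat_Suc)
    have "integral {0..1} (\<lambda>v. \<delta> v * ((1 - v) ^ (2 * n - 1) * v ^ (m + 1)) * poly (J m k) v) = 0" for k
    proof -
      \<comment> \<open>The weight v^(m+1) of the hypothesis and the factor v^m in front of
        \<open>T m v\<close> multiply to v^(2m+1), the weight for which the family
        \<open>J m\<close> is orthogonal.\<close>
      define w where "w v = (1 - v) ^ (2 * n - 1) * v ^ (2 * m + 1) * poly (J m k) v" for v
      have cont_w: "continuous_on {0..1} w"
        unfolding w_def by (intro continuous_intros)
      obtain M where M: "\<And>x. x \<in> {0..1} \<Longrightarrow> \<bar>w x\<bar> \<le> M"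
        using compact_imp_bounded[OF compact_continuous_image[OF cont_w compact_Icc]]
        unfolding bounded_iff by (auto simp del: atLeastAtMost_iff)
      have "(\<lambda>j. integral {0..1} (\<lambda>v. w v * (c m j * poly (J m j) v))) sums
          integral {0..1} (\<lambda>v. \<Sum>j. w v * (c m j * poly (J m j) v))"
      proof (rule integral_sums_M_test)
        show "\<bar>w v * (c m j * poly (J m j) v)\<bar> \<le> M * (a m * b j)" if "v \<in> {0..1}" for j v
          unfolding abs_mult[of "w v"] using M[OF that] bound[OF that, of m j] by (intro mult_mono) auto
      qed (intro continuous_intros cont_w summable_mult ab)+
      also have "integral {0..1} (\<lambda>v. \<Sum>j. w v * (c m j * poly (J m j) v)) = integral {0..1} (\<lambda>v. w v * T m v)"
        unfolding T_def by (intro integral_cong suminf_mult summable_T)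
      also have "(\<lambda>j. integral {0..1} (\<lambda>v. w v * (c m j * poly (J m j) v))) = (\<lambda>j. if j = k then c m k * W k else 0)"
      proof
        fix j
        have "integral {0..1} (\<lambda>v. w v * (c m j * poly (J m j) v)) =
            integral {0..1} (\<lambda>v. c m j * poly ([:1, -1:] ^ (2 * n - 1) * [:0, 1:] ^ (2 * m + 1) * J m k * J m j) v)"
          by (intro integral_cong) (simp add: w_def mult_ac)
        also have "\<dots> = c m j * poly_integral ([:1, -1:] ^ (2 * n - 1) * [:0, 1:] ^ (2 * m + 1) * J m k * J m j)"
          by (simp only: poly_integral_def integral_mult_right)
        also have "\<dots> = (if j = k then c m k * W k else 0)"
          using shifted_jacobi_orthogonal[of k j "2 * n - 1" "2 * m + 1"] by (auto simp: W_def J_def)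
        finally show "integral {0..1} (\<lambda>v. w v * (c m j * poly (J m j) v)) = (if j = k then c m k * W k else 0)" .
      qed
      finally have wT: "integral {0..1} (\<lambda>v. w v * T m v) = c m k * W k"
        using sums_If_finite_set[of "{k}" "\<lambda>_. c m k * W k"] by (simp add: sums_iff)
      have "integral {0..1} (\<lambda>v. \<delta> v * ((1 - v) ^ (2 * n - 1) * v ^ (m + 1)) * poly (J m k) v) =
          integral {0..1} (\<lambda>v. (1 - v) ^ (2 * n - 1) * v ^ (m + 1) * poly (J m k) v * g m v - w v * T m v / real (2 * m + 1))"
      proof (intro integral_cong)
        fix v :: real
        have "v ^ (2 * m + 1) = v ^ (m + 1) * v ^ m"
          by (simp add: mult_2 flip: power_add)
        then show "\<delta> v * ((1 - v) ^ (2 * n - 1) * v ^ (m + 1)) * poly (J m k) v =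
            (1 - v) ^ (2 * n - 1) * v ^ (m + 1) * poly (J m k) v * g m v - w v * T m v / real (2 * m + 1)"
          by (simp add: \<delta>_def w_def algebra_simps del: of_nat_add of_nat_mult of_nat_Suc power_Suc)
      qed
      also have "\<dots> = integral {0..1} (\<lambda>v. (1 - v) ^ (2 * n - 1) * v ^ (m + 1) * poly (J m k) v * g m v)
          - integral {0..1} (\<lambda>v. w v * T m v / real (2 * m + 1))"
        by (intro integral_diff int continuous_intros cont_g cont_T cont_w) auto
      also have "\<dots> = Gamma (2 * real n) / (4 * pi ^ (2 * n + 2))
          * exp (- real (4 * k * (k + 2 * n + 2 * m + 1) + 8 * n * m) * t) * real ((k + 2 * n - 1) choose k)
          - c m k * W k / real (2 * m + 1)"
        unfolding g_def J_def Q_def coeffs integral_divide wT[unfolded J_def] ..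
      also have "c m k * W k / real (2 * m + 1) = Gamma (2 * real n) / (4 * pi ^ (2 * n + 2))
          * exp (- real (4 * k * (k + 2 * n + 2 * m + 1) + 8 * n * m) * t) * real ((k + 2 * n - 1) choose k)"
      proof -
        define E where "E = exp (- real (4 * k * (k + 2 * n + 2 * m + 1) + 8 * n * m) * t)"
        have "c m k * W k / real (2 * m + 1) = sigma_coeff n k m * W k / real (2 * m + 1) * E"
          by (simp add: c_def spectral_coeff_def E_def del: of_nat_add of_nat_mult of_nat_Suc)
        also have "\<dots> = Gamma (2 * real n) / (4 * pi ^ (2 * n + 2)) * real ((k + 2 * n - 1) choose k) * E"
          unfolding W_def J_def sigma_coeff_norm[OF n] ..
        finally show ?thesis
          unfolding E_def[symmetric] by (simp only: mult_ac)
      qed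
      finally show ?thesis by simp
    qed
    then have *: "\<delta> x * ((1 - x) ^ (2 * n - 1) * x ^ (m + 1)) = 0" if "x \<in> {0..1}" for x
      using that by (intro continuous_orthogonal_poly_basis[of "\<lambda>v. \<delta> v * ((1 - v) ^ (2 * n - 1) * v ^ (m + 1))" "J m"]
        continuous_intros cont_\<delta>) (auto simp: J_def degree_shifted_jacobi_le coeff_shifted_jacobi)
    \<comment> \<open>The weight vanishes at the end points, so the basis argument gives nothing
      there; continuity closes the gap.\<close>
    have "\<delta> x = 0" if "x \<in> {0<..<1}" for x
      using *[of x] that by auto
    then have "\<delta> v = 0"
      using v cont_\<delta> continuous_constant_on_closure[of "{0<..<1}" \<delta> 0 v] by simp
    then show ?thesis
      by (simp add: \<delta>_def)
  qed
  \<comment> \<open>For fixed v both sides are continuous in p and, by \<open>g\<close>, have the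
    same Legendre coefficients.\<close>
  have G_eq: "G (v, p) = S v p"
  proof -
    have cont_S: "continuous_on {0..1} (S v)"
      unfolding S_def using S_bound[OF v]
      by (intro continuous_on_suminf_M_test[OF _ _ sum_ab] continuous_intros) auto
    have "integral {0..1} (\<lambda>p. (G (v, p) - S v p) * poly (Q j) p) = 0" for j
    proof -
      have "(\<lambda>m. integral {0..1} (\<lambda>p. v ^ m * T m v * poly (Q m) p * poly (Q j) p)) sums
          integral {0..1} (\<lambda>p. \<Sum>m. v ^ m * T m v * poly (Q m) p * poly (Q j) p)"
      proof (rule integral_sums_M_test)
        show "\<bar>v ^ m * T m v * poly (Q m) p * poly (Q j) p\<bar> \<le> a m * suminf b" if "p \<in> {0..1}" for m p
        proof -
          have "\<bar>v ^ m * T m v * poly (Q m) p\<bar> * \<bar>poly (Q j) p\<bar> \<le> (a m * suminf b) * 1"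
            using S_bound[OF v that, of m] Q[OF that, of j] by (intro mult_mono) auto
          then show ?thesis by (simp add: abs_mult)
        qed
      qed (intro continuous_intros sum_ab)+
      also have "integral {0..1} (\<lambda>p. \<Sum>m. v ^ m * T m v * poly (Q m) p * poly (Q j) p) =
          integral {0..1} (\<lambda>p. S v p * poly (Q j) p)"
        unfolding S_def using S_bound[OF v]
        by (intro integral_cong suminf_mult2[symmetric] summable_comparison_test[OF _ sum_ab]) auto
      also have "(\<lambda>m. integral {0..1} (\<lambda>p. v ^ m * T m v * poly (Q m) p * poly (Q j) p)) =
          (\<lambda>m. if m = j then v ^ j * T j v / real (2 * j + 1) else 0)"
      proof
        fix m
        have "integral {0..1} (\<lambda>p. v ^ m * T m v * poly (Q m) p * poly (Q j) p) =
            integral {0..1} (\<lambda>p. v ^ m * T m v * poly ([:1, -1:] ^ 0 * [:0, 1:] ^ 0 * Q m * Q j) p)"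
          by (intro integral_cong) (simp add: mult_ac)
        also have "\<dots> = v ^ m * T m v * poly_integral ([:1, -1:] ^ 0 * [:0, 1:] ^ 0 * Q m * Q j)"
          by (simp only: poly_integral_def integral_mult_right)
        also have "\<dots> = (if m = j then v ^ j * T j v / real (2 * j + 1) else 0)"
        proof (cases "m = j")
          case True
          then show ?thesis
            unfolding Q_def using shifted_jacobi_norm[of 0 0 j] by simp
        next
          case False
          then show ?thesis
            using shifted_jacobi_orthogonal[OF False, of 0 0] by (simp add: Q_def)
        qed
        finally show "integral {0..1} (\<lambda>p. v ^ m * T m v * poly (Q m) p * poly (Q j) p) =
          (if m = j then v ^ j * T j v / real (2 * j + 1) else 0)" .
      qed
      finally have "integral {0..1} (\<lambda>p. S v p * poly (Q j) p) = v ^ j * T j v / real (2 * j + 1)"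
        using sums_If_finite_set[of "{j}" "\<lambda>_. v ^ j * T j v / real (2 * j + 1)"] by (simp add: sums_iff)
      also have "\<dots> = integral {0..1} (\<lambda>p. G (v, p) * poly (Q j) p)"
        using g[OF v, of j] by (simp add: g_def)
      finally show ?thesis
        unfolding left_diff_distrib
        by (subst integral_diff) (auto intro!: int continuous_intros cont_G1 cont_S v)
    qed
    then have "G (v, p) - S v p = 0"
      using p v by (intro continuous_orthogonal_poly_basis[of "\<lambda>p. G (v, p) - S v p" Q] continuous_intros cont_G1 cont_S)
        (auto simp: Q_def degree_shifted_jacobi_le coeff_shifted_jacobi)
    then show ?thesis by simp
  qed
  have summand: "term m k = v ^ m * poly (Q m) p * (c m k * poly (J m k) v)" for m k
    by (simp add: term_def c_def J_def Q_def mult_ac)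
  have "summable (term m)" for m
    unfolding summand by (intro summable_mult summable_T v)
  moreover have "(\<Sum>k. term m k) = v ^ m * T m v * poly (Q m) p" for m
    unfolding summand T_def by (subst suminf_mult[OF summable_T[OF v]]) (simp add: mult_ac)
  moreover have "summable (\<lambda>m. v ^ m * T m v * poly (Q m) p)"
    using S_bound[OF v p] by (intro summable_comparison_test[OF _ sum_ab]) auto
  ultimately show ?thesis
    unfolding G_eq S_def by (simp add: summable_sums)
qed

subsection \<open>Functions of class \<open>C\<^sup>2\<close>\<close>

lemma C2_onE:
  assumes "C2_on U F"
  obtains D H where "\<And>x. x \<in> U \<Longrightarrow> (F has_derivative blinfun_apply (D x)) (at x)"
    "\<And>x. x \<in> U \<Longrightarrow> (D has_derivative blinfun_apply (H x)) (at x)"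
    "continuous_on U H" "continuous_on U D" "continuous_on U F"
proof -
  obtain D H where D: "\<And>x. x \<in> U \<Longrightarrow> (F has_derivative blinfun_apply (D x)) (at x)"
    "\<And>x. x \<in> U \<Longrightarrow> (D has_derivative blinfun_apply (H x)) (at x)" "continuous_on U H"
    using assms unfolding C2_on_def by blast
  moreover have "continuous_on U D" "continuous_on U F"
    using D(1,2) by (meson continuous_at_imp_continuous_on has_derivative_continuous)+
  ultimately show ?thesis
    by (rule that)
qed

lemma C2_onI:
  assumes "\<And>x. x \<in> U \<Longrightarrow> (F has_derivative blinfun_apply (D x)) (at x)"
    "\<And>x. x \<in> U \<Longrightarrow> (D has_derivative blinfun_apply (H x)) (at x)" "continuous_on U H"
  shows "C2_on U F"
  using assms unfolding C2_on_def by blast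

lemma C2_on_const [intro]: "C2_on U (\<lambda>_. c)"
  by (rule C2_onI[where D = "\<lambda>_. 0" and H = "\<lambda>_. 0"]) (auto simp: zero_blinfun.rep_eq[abs_def])

lemma C2_on_add [intro]:
  assumes "C2_on U F" "C2_on U G"
  shows "C2_on U (\<lambda>x. F x + G x)"
proof -
  obtain DF D2F where F: "\<And>x. x \<in> U \<Longrightarrow> (F has_derivative blinfun_apply (DF x)) (at x)"
    "\<And>x. x \<in> U \<Longrightarrow> (DF has_derivative blinfun_apply (D2F x)) (at x)" "continuous_on U D2F"
    by (rule C2_onE[OF assms(1)]) blast
  obtain DG D2G where G: "\<And>x. x \<in> U \<Longrightarrow> (G has_derivative blinfun_apply (DG x)) (at x)"
    "\<And>x. x \<in> U \<Longrightarrow> (DG has_derivative blinfun_apply (D2G x)) (at x)" "continuous_on U D2G"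
    by (rule C2_onE[OF assms(2)]) blast
  show ?thesis
    by (rule C2_onI[where D = "\<lambda>x. DF x + DG x" and H = "\<lambda>x. D2F x + D2G x"])
       (auto intro!: derivative_eq_intros F G continuous_intros simp: blinfun.add_left)
qed

lemma C2_on_mult [intro]:
  assumes "C2_on U F" "C2_on U G"
  shows "C2_on U (\<lambda>x. F x * G x)"
proof -
  obtain DF D2F where F: "\<And>x. x \<in> U \<Longrightarrow> (F has_derivative blinfun_apply (DF x)) (at x)"
    "\<And>x. x \<in> U \<Longrightarrow> (DF has_derivative blinfun_apply (D2F x)) (at x)" "continuous_on U D2F"
    "continuous_on U DF" "continuous_on U F"
    by (rule C2_onE[OF assms(1)]) blast
  obtain DG D2G where G: "\<And>x. x \<in> U \<Longrightarrow> (G has_derivative blinfun_apply (DG x)) (at x)"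
    "\<And>x. x \<in> U \<Longrightarrow> (DG has_derivative blinfun_apply (D2G x)) (at x)" "continuous_on U D2G"
    "continuous_on U DG" "continuous_on U G"
    by (rule C2_onE[OF assms(2)]) blast
  note [continuous_intros] = bounded_linear.continuous_on[OF bounded_linear_blinfun_scaleR_left]
    bounded_bilinear.continuous_on[OF bounded_bilinear_blinfun_compose]
  show ?thesis
  proof (rule C2_onI)
    fix x assume x: "x \<in> U"
    show "((\<lambda>x. F x * G x) has_derivative blinfun_apply (F x *\<^sub>R DG x + G x *\<^sub>R DF x)) (at x)"
      using x by (auto intro!: derivative_eq_intros F G simp: blinfun.add_left blinfun.scaleR_left)
    show "((\<lambda>x. F x *\<^sub>R DG x + G x *\<^sub>R DF x) has_derivative blinfun_apply
        (F x *\<^sub>R D2G x + (blinfun_scaleR_left (DG x) o\<^sub>L DF x) + (G x *\<^sub>R D2F x + (blinfun_scaleR_left (DF x) o\<^sub>L DG x)))) (at x)"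
      using x by (auto intro!: derivative_eq_intros F G simp: blinfun.add_left blinfun.scaleR_left)
  next
    show "continuous_on U (\<lambda>x. F x *\<^sub>R D2G x + (blinfun_scaleR_left (DG x) o\<^sub>L DF x) + (G x *\<^sub>R D2F x + (blinfun_scaleR_left (DF x) o\<^sub>L DG x)))"
      by (intro continuous_intros F G)
  qed
qed

lemma C2_on_inverse:
  assumes "C2_on U F" and nz: "\<And>x. x \<in> U \<Longrightarrow> F x \<noteq> 0"
  shows "C2_on U (\<lambda>x. inverse (F x))"
proof -
  obtain DF D2F where F: "\<And>x. x \<in> U \<Longrightarrow> (F has_derivative blinfun_apply (DF x)) (at x)"
    "\<And>x. x \<in> U \<Longrightarrow> (DF has_derivative blinfun_apply (D2F x)) (at x)" "continuous_on U D2F"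
    "continuous_on U DF" "continuous_on U F"
    by (rule C2_onE[OF assms(1)]) blast
  note [continuous_intros] = bounded_linear.continuous_on[OF bounded_linear_blinfun_scaleR_left]
    bounded_bilinear.continuous_on[OF bounded_bilinear_blinfun_compose]
  show ?thesis
  proof (rule C2_onI)
    fix x assume x: "x \<in> U"
    show "((\<lambda>x. inverse (F x)) has_derivative blinfun_apply ((- (inverse (F x) * inverse (F x))) *\<^sub>R DF x)) (at x)"
      using x nz[OF x] by (auto intro!: derivative_eq_intros F simp: blinfun.scaleR_left blinfun.minus_left fun_eq_iff)
    show "((\<lambda>x. (- (inverse (F x) * inverse (F x))) *\<^sub>R DF x) has_derivative blinfun_apply
        ((- (inverse (F x) * inverse (F x))) *\<^sub>R D2F x + (2 * inverse (F x) ^ 3) *\<^sub>R (blinfun_scaleR_left (DF x) o\<^sub>L DF x))) (at x)"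
      using x nz[OF x] by (auto intro!: derivative_eq_intros F simp: blinfun.add_left blinfun.diff_left blinfun.minus_left blinfun.scaleR_left power3_eq_cube algebra_simps scaleR_2 fun_eq_iff)
  next
    show "continuous_on U (\<lambda>x. (- (inverse (F x) * inverse (F x))) *\<^sub>R D2F x + (2 * inverse (F x) ^ 3) *\<^sub>R (blinfun_scaleR_left (DF x) o\<^sub>L DF x))"
      using nz by (intro continuous_intros F) auto
  qed
qed

text \<open>The derivative is itself linear in x, so the second derivative is constant. The squared
  norm and the squared moduli of the components are all of this form.\<close>

lemma C2_on_inner_linear:
  fixes L :: "'a::real_normed_vector \<Rightarrow> 'b::real_inner"
  assumes L: "bounded_linear L"
  shows "C2_on U (\<lambda>x. L x \<bullet> L x)"
proof -
  define D where "D x = 2 *\<^sub>R (blinfun_inner_right (L x) o\<^sub>L Blinfun L)" for x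
  have bl: "bounded_linear D"
    unfolding D_def
    by (intro bounded_linear_const_scaleR bounded_bilinear.bounded_linear_left[OF bounded_bilinear_blinfun_compose, THEN bounded_linear_compose]
        bounded_linear_compose[OF bounded_linear_blinfun_inner_right L])
  show ?thesis
  proof (rule C2_onI)
    fix x assume "x \<in> U"
    show "((\<lambda>x. L x \<bullet> L x) has_derivative blinfun_apply (D x)) (at x)"
      by (auto intro!: derivative_eq_intros bounded_linear.has_derivative[OF L]
          simp: D_def blinfun.scaleR_left bounded_linear_Blinfun_apply[OF L] inner_commute)
    show "(D has_derivative blinfun_apply (Blinfun D)) (at x)"
      unfolding bounded_linear_Blinfun_apply[OF bl] by (rule bounded_linear_imp_has_derivative[OF bl])
  qed auto
qed

lemma C2_on_sum [intro]: "(\<And>i. i \<in> I \<Longrightarrow> C2_on U (F i)) \<Longrightarrow> C2_on U (\<lambda>x. \<Sum>i\<in>I. F i x)"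
  by (induction I rule: infinite_finite_induct) auto

lemma C2_on_power [intro]: "C2_on U F \<Longrightarrow> C2_on U (\<lambda>x. F x ^ k)"
  by (induction k) auto

lemma C2_on_poly [intro]: "C2_on U F \<Longrightarrow> C2_on U (\<lambda>x. poly p (F x))"
  by (induction p) auto

subsection \<open>The horizontal space\<close>

lemma quat_Basis: "(Basis :: quat set) = {(1, 0), (\<i>, 0), (0, 1), (0, \<i>)}"
  by (auto simp: Basis_prod_def Basis_complex_def)

lemma sum_quat_Basis: "(\<Sum>e\<in>(Basis :: quat set). f e) = f (1, 0) + f (\<i>, 0) + f (0, 1) + f (0, \<i>)"
  by (simp add: quat_Basis add.assoc)

text \<open>Multiplicativity of the quaternion norm, polarised in the left factor. Summed over the
  coordinates it makes q, Iq, Jq, Kq orthonormal for a unit vector q.\<close>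

lemma inner_qmult: "qmult g x \<bullet> qmult g' x = (g \<bullet> g') * (x \<bullet> x)"
  by (cases g; cases g'; cases x) (simp add: qmult_def inner_prod_def inner_complex_def algebra_simps)

lemma inner_qscale: "qscale g q \<bullet> qscale g' q = (g \<bullet> g') * (q \<bullet> q)"
  by (simp add: qscale_def inner_prod_def[where 'b = quat] inner_vec_def inner_qmult sum_distrib_left distrib_left)

lemma qmult_linear: "linear (\<lambda>g. qmult g x)"
  by (rule linearI) (auto simp: qmult_def algebra_simps scaleR_prod_def)

lemma qscale_linear: "linear (\<lambda>g. qscale g q)"
  by (rule linearI) (auto simp: qscale_def vec_eq_iff linear_add[OF qmult_linear] linear_scale[OF qmult_linear])

lemma qscale_Basis: "qscale g q = (\<Sum>e\<in>Basis. (g \<bullet> e) *\<^sub>R qscale e q)"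
  using linear_sum[OF qscale_linear[of q], of "\<lambda>e. (g \<bullet> e) *\<^sub>R e" Basis]
  by (simp add: euclidean_representation linear_scale[OF qscale_linear])

lemma horizontal_frame_exists: "\<exists>B. horizontal_frame q B"
proof -
  have "subspace (horizontal_space q)"
    unfolding horizontal_space_def by (auto simp: subspace_def inner_add_left)
  then show ?thesis
    unfolding horizontal_frame_def by (metis orthonormal_basis_subspace)
qed

lemma horizontal_frame_finite:
  assumes "horizontal_frame q B"
  shows "finite B"
proof -
  have "0 \<notin> B"
    using assms unfolding horizontal_frame_def by force
  then have "independent B"
    using assms unfolding horizontal_frame_def by (intro pairwise_orthogonal_independent) auto
  then show ?thesis
    by (rule independent_imp_finite)
qed

text \<open>A horizontal frame completed by q, Iq, Jq, Kq is an orthonormal basis of the whole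
  space. Sums over a frame that is only known to exist thus become explicit sums over four
  vectors.\<close>

lemma horizontal_frame_parseval:
  assumes q: "norm q = 1" and B: "horizontal_frame q B"
  shows "(\<Sum>v\<in>B. (x \<bullet> v) * (y \<bullet> v)) = x \<bullet> y - (\<Sum>e\<in>Basis. (x \<bullet> qscale e q) * (y \<bullet> qscale e q))"
proof -
  have fin: "finite B" by (rule horizontal_frame_finite[OF B])
  have orth: "v \<bullet> w = (if v = w then 1 else 0)" if "v \<in> B" "w \<in> B" for v w
    using B that unfolding horizontal_frame_def pairwise_def orthogonal_def
    by (auto simp: norm_eq_1)
  have vert: "v \<bullet> qscale g q = 0" if "v \<in> B" for v g
  proof -
    have "v \<in> horizontal_space q"
      using B span_base[OF that] unfolding horizontal_frame_def by auto
    then show ?thesis unfolding horizontal_space_def by blast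
  qed
  have qq: "q \<bullet> q = 1"
    using q by (simp add: norm_eq_1)
  \<comment> \<open>The remainder of the expansion of x: orthogonal to the four vertical and normal
    vectors it lies in the span of B, and orthogonal to B it must vanish.\<close>
  define z where "z = x - (\<Sum>v\<in>B. (x \<bullet> v) *\<^sub>R v) - (\<Sum>e\<in>Basis. (x \<bullet> qscale e q) *\<^sub>R qscale e q)"
  have z_vert: "z \<bullet> qscale e q = 0" if e: "e \<in> Basis" for e
  proof -
    have "(\<Sum>i\<in>Basis. (x \<bullet> qscale i q) * (i \<bullet> e)) = x \<bullet> qscale e q"
      using e by (subst sum.remove[of _ e]) (auto intro!: sum.neutral simp: inner_not_same_Basis)
    then show ?thesis
      by (simp add: z_def inner_diff_left inner_sum_left vert inner_qscale qq)
  qed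
  have "z \<bullet> qscale g q = 0" for g
    unfolding qscale_Basis[of g] by (simp add: inner_sum_right z_vert)
  then have "z \<in> span B"
    using B by (auto simp: horizontal_frame_def horizontal_space_def)
  moreover have "orthogonal z v" if v: "v \<in> B" for v
  proof -
    have "(\<Sum>w\<in>B. (x \<bullet> w) * (w \<bullet> v)) = x \<bullet> v"
      using v fin by (subst sum.remove[of _ v]) (auto intro!: sum.neutral simp: orth)
    then show ?thesis
      using vert[OF v] by (simp add: orthogonal_def z_def inner_diff_left inner_sum_left inner_commute[of "qscale _ q"])
  qed
  ultimately have "orthogonal z z"
    using orthogonal_to_span by blast
  then have "z = 0"
    by (simp add: orthogonal_self)
  then have "z \<bullet> y = 0"
    by simp
  then show ?thesis
    unfolding z_def inner_diff_left inner_sum_left by (simp add: inner_commute[of y])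
qed

context
  fixes q :: "'n::finite hvec" and B
  assumes q: "norm q = 1" and B: "horizontal_frame q B"
begin

lemma norm_components:
  "(norm (fst (snd q)))\<^sup>2 = Re (fst (snd q)) * Re (fst (snd q)) + Im (fst (snd q)) * Im (fst (snd q))"
  "(norm (snd (snd q)))\<^sup>2 = Re (snd (snd q)) * Re (snd (snd q)) + Im (snd (snd q)) * Im (snd (snd q))"
  "(norm (snd q))\<^sup>2 = Re (fst (snd q)) * Re (fst (snd q)) + Im (fst (snd q)) * Im (fst (snd q))
     + (Re (snd (snd q)) * Re (snd (snd q)) + Im (snd (snd q)) * Im (snd (snd q)))"
  by (simp_all add: power2_norm_eq_inner inner_prod_def inner_complex_def)

text \<open>The vector (0, (a, 0)), with a the first complex component of the last quaternion, is
  half the gradient of |a|^2. The sum is therefore the horizontal squared length of this half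
  gradient and, up to a factor 4, the coefficient of a pure second derivative.\<close>

lemma frame_sum_first: "(\<Sum>v\<in>B. (fst (snd q) \<bullet> fst (snd v))\<^sup>2) =
    (norm (fst (snd q)))\<^sup>2 * (1 - (norm (snd q))\<^sup>2)"
proof -
  have "(\<Sum>v\<in>B. (fst (snd q) \<bullet> fst (snd v))\<^sup>2) = (\<Sum>v\<in>B. ((0, (fst (snd q), 0)) \<bullet> v) * ((0, (fst (snd q), 0)) \<bullet> v))"
    by (simp add: inner_prod_def power2_eq_square)
  then show ?thesis
    unfolding horizontal_frame_parseval[OF q B] norm_components
    by (simp add: sum_quat_Basis qscale_def qmult_def inner_prod_def inner_complex_def algebra_simps)
qed

lemma frame_sum_second: "(\<Sum>v\<in>B. (snd (snd q) \<bullet> snd (snd v))\<^sup>2) =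
    (norm (snd (snd q)))\<^sup>2 * (1 - (norm (snd q))\<^sup>2)"
proof -
  have "(\<Sum>v\<in>B. (snd (snd q) \<bullet> snd (snd v))\<^sup>2) = (\<Sum>v\<in>B. ((0, (0, snd (snd q))) \<bullet> v) * ((0, (0, snd (snd q))) \<bullet> v))"
    by (simp add: inner_prod_def power2_eq_square)
  then show ?thesis
    unfolding horizontal_frame_parseval[OF q B] norm_components
    by (simp add: sum_quat_Basis qscale_def qmult_def inner_prod_def inner_complex_def algebra_simps)
qed

text \<open>For the last quaternion a + bJ the contribution |a|^2 |b|^2 of q is cancelled by those
  of Jq and Kq, which add up to -|ab|^2, while Iq contributes nothing. Hence the operator has no
  mixed derivative.\<close>

lemma frame_sum_mixed: "(\<Sum>v\<in>B. (fst (snd q) \<bullet> fst (snd v)) * (snd (snd q) \<bullet> snd (snd v))) = 0"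
proof -
  have "(\<Sum>v\<in>B. (fst (snd q) \<bullet> fst (snd v)) * (snd (snd q) \<bullet> snd (snd v))) =
      (\<Sum>v\<in>B. ((0, (fst (snd q), 0)) \<bullet> v) * ((0, (0, snd (snd q))) \<bullet> v))"
    by (simp add: inner_prod_def)
  then show ?thesis
    unfolding horizontal_frame_parseval[OF q B]
    by (simp add: sum_quat_Basis qscale_def qmult_def inner_prod_def inner_complex_def algebra_simps)
qed

text \<open>The trace of the horizontal projection over the two real directions of the component;
  each unit direction loses the squared norm of \<open>snd q\<close> to the four removed
  vectors.\<close>

lemma frame_sum_norm_first: "(\<Sum>v\<in>B. (norm (fst (snd v)))\<^sup>2) = 2 * (1 - (norm (snd q))\<^sup>2)"
proof -
  have "(\<Sum>v\<in>B. (norm (fst (snd v)))\<^sup>2) =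
      (\<Sum>v\<in>B. ((0, (1, 0)) \<bullet> v) * ((0, (1, 0)) \<bullet> v)) + (\<Sum>v\<in>B. ((0, (\<i>, 0)) \<bullet> v) * ((0, (\<i>, 0)) \<bullet> v))"
    unfolding sum.distrib[symmetric]
    by (intro sum.cong refl) (simp add: inner_prod_def inner_complex_def power2_norm_eq_inner)
  then show ?thesis
    unfolding horizontal_frame_parseval[OF q B] norm_components
    by (simp add: sum_quat_Basis qscale_def qmult_def inner_prod_def inner_complex_def algebra_simps)
qed

lemma frame_sum_norm_second: "(\<Sum>v\<in>B. (norm (snd (snd v)))\<^sup>2) = 2 * (1 - (norm (snd q))\<^sup>2)"
proof -
  have "(\<Sum>v\<in>B. (norm (snd (snd v)))\<^sup>2) =
      (\<Sum>v\<in>B. ((0, (0, 1)) \<bullet> v) * ((0, (0, 1)) \<bullet> v)) + (\<Sum>v\<in>B. ((0, (0, \<i>)) \<bullet> v) * ((0, (0, \<i>)) \<bullet> v))"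
    unfolding sum.distrib[symmetric]
    by (intro sum.cong refl) (simp add: inner_prod_def inner_complex_def power2_norm_eq_inner)
  then show ?thesis
    unfolding horizontal_frame_parseval[OF q B] norm_components
    by (simp add: sum_quat_Basis qscale_def qmult_def inner_prod_def inner_complex_def algebra_simps)
qed

text \<open>The trace of the horizontal projection: the full dimension 4n + 4 minus the four
  orthonormal vectors removed.\<close>

lemma frame_card: "real (card B) = 4 * real CARD('n)"
proof -
  have "real (card B) = (\<Sum>v\<in>B. v \<bullet> v)"
    using B by (simp add: horizontal_frame_def norm_eq_1)
  also have "\<dots> = (\<Sum>v\<in>B. \<Sum>e\<in>Basis. (e \<bullet> v) * (e \<bullet> v))"
    by (intro sum.cong refl) (simp add: euclidean_inner[of v v for v] inner_commute)
  also have "\<dots> = (\<Sum>e\<in>(Basis :: 'n hvec set). \<Sum>v\<in>B. (e \<bullet> v) * (e \<bullet> v))"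
    by (rule sum.swap)
  also have "\<dots> = real DIM('n hvec) - (\<Sum>e\<in>(Basis :: 'n hvec set). \<Sum>u\<in>Basis. (e \<bullet> qscale u q) * (e \<bullet> qscale u q))"
    unfolding horizontal_frame_parseval[OF q B] sum_subtractf by simp
  also have "(\<Sum>e\<in>(Basis :: 'n hvec set). \<Sum>u\<in>Basis. (e \<bullet> qscale u q) * (e \<bullet> qscale u q)) =
     (\<Sum>u\<in>Basis. qscale u q \<bullet> qscale u q)"
    by (subst sum.swap) (simp add: euclidean_inner[of "qscale u q" "qscale u q" for u] inner_commute)
  also have "\<dots> = 4"
    using q by (simp add: inner_qscale norm_eq_1)
  finally show ?thesis
    by simp
qed

end

subsection \<open>The sub-Laplacian of functions of the last quaternion coordinate\<close>

lemma has_real_derivative_chain2: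
  assumes "((\<lambda>z. \<Psi> (fst z) (snd z)) has_derivative (\<lambda>h. a * fst h + b * snd h)) (at (X s, Y s))"
    and "(X has_real_derivative X') (at s)" "(Y has_real_derivative Y') (at s)"
  shows "((\<lambda>s. \<Psi> (X s) (Y s)) has_real_derivative a * X' + b * Y') (at s)"
proof -
  have "((\<lambda>s. (X s, Y s)) has_derivative (\<lambda>h. (X' * h, Y' * h))) (at s)"
    using assms(2,3) by (auto intro!: has_derivative_Pair simp: has_field_derivative_def)
  from has_derivative_compose[OF this assms(1)]
  have "((\<lambda>s. \<Psi> (X s) (Y s)) has_derivative (\<lambda>h. a * (X' * h) + b * (Y' * h))) (at s)"
    by simp
  then show ?thesis
    unfolding has_field_derivative_def by (rule has_derivative_eq_rhs) (simp add: fun_eq_iff algebra_simps)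
qed

lemma second_derivative_chain2:
  fixes \<Psi> \<Psi>x \<Psi>y :: "real \<Rightarrow> real \<Rightarrow> real"
  assumes \<Psi>: "\<And>x y. ((\<lambda>z. \<Psi> (fst z) (snd z)) has_derivative (\<lambda>h. \<Psi>x x y * fst h + \<Psi>y x y * snd h)) (at (x, y))"
    and \<Psi>x: "\<And>x y. ((\<lambda>z. \<Psi>x (fst z) (snd z)) has_derivative (\<lambda>h. \<Psi>xx x y * fst h + \<Psi>xy x y * snd h)) (at (x, y))"
    and \<Psi>y: "\<And>x y. ((\<lambda>z. \<Psi>y (fst z) (snd z)) has_derivative (\<lambda>h. \<Psi>xy x y * fst h + \<Psi>yy x y * snd h)) (at (x, y))"
    and X: "\<And>s. (X has_real_derivative X1 s) (at s)" "(X1 has_real_derivative X2) (at 0)"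
    and Y: "\<And>s. (Y has_real_derivative Y1 s) (at s)" "(Y1 has_real_derivative Y2) (at 0)"
  shows "(deriv ^^ 2) (\<lambda>s. \<Psi> (X s) (Y s)) 0 =
    \<Psi>xx (X 0) (Y 0) * (X1 0)\<^sup>2 + 2 * \<Psi>xy (X 0) (Y 0) * (X1 0 * Y1 0) + \<Psi>yy (X 0) (Y 0) * (Y1 0)\<^sup>2
      + \<Psi>x (X 0) (Y 0) * X2 + \<Psi>y (X 0) (Y 0) * Y2"
proof -
  have "deriv (\<lambda>s. \<Psi> (X s) (Y s)) = (\<lambda>s. \<Psi>x (X s) (Y s) * X1 s + \<Psi>y (X s) (Y s) * Y1 s)"
    by (intro ext DERIV_imp_deriv has_real_derivative_chain2 \<Psi> X Y)
  moreover have "deriv (\<lambda>s. \<Psi>x (X s) (Y s) * X1 s + \<Psi>y (X s) (Y s) * Y1 s) 0 =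
      (\<Psi>xx (X 0) (Y 0) * X1 0 + \<Psi>xy (X 0) (Y 0) * Y1 0) * X1 0 + X2 * \<Psi>x (X 0) (Y 0)
      + ((\<Psi>xy (X 0) (Y 0) * X1 0 + \<Psi>yy (X 0) (Y 0) * Y1 0) * Y1 0 + Y2 * \<Psi>y (X 0) (Y 0))"
    by (intro DERIV_imp_deriv DERIV_add DERIV_mult has_real_derivative_chain2 \<Psi>x \<Psi>y X Y)
  ultimately show ?thesis
    by (simp add: numeral_2_eq_2 power2_eq_square algebra_simps)
qed

text \<open>A single component of a great circle traces an ellipse, whence the general a and v. Its
  squared norm is a quadratic form in cos s and sin s.\<close>

lemma norm_great_circle:
  fixes a v :: "'a::real_inner"
  shows "((\<lambda>s. (norm (cos s *\<^sub>R a + sin s *\<^sub>R v))\<^sup>2) has_real_derivative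
      2 * cos s * sin s * ((norm v)\<^sup>2 - (norm a)\<^sup>2) + 2 * ((cos s)\<^sup>2 - (sin s)\<^sup>2) * (a \<bullet> v)) (at s)"
    "((\<lambda>s. 2 * cos s * sin s * ((norm v)\<^sup>2 - (norm a)\<^sup>2) + 2 * ((cos s)\<^sup>2 - (sin s)\<^sup>2) * (a \<bullet> v)) has_real_derivative
      2 * ((norm v)\<^sup>2 - (norm a)\<^sup>2)) (at 0)"
proof -
  have "(\<lambda>s. (norm (cos s *\<^sub>R a + sin s *\<^sub>R v))\<^sup>2) =
      (\<lambda>s. (cos s)\<^sup>2 * (norm a)\<^sup>2 + 2 * cos s * sin s * (a \<bullet> v) + (sin s)\<^sup>2 * (norm v)\<^sup>2)"
    unfolding power2_norm_eq_inner
    by (simp add: inner_add_left inner_add_right inner_commute power2_eq_square algebra_simps)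
  then show "((\<lambda>s. (norm (cos s *\<^sub>R a + sin s *\<^sub>R v))\<^sup>2) has_real_derivative
      2 * cos s * sin s * ((norm v)\<^sup>2 - (norm a)\<^sup>2) + 2 * ((cos s)\<^sup>2 - (sin s)\<^sup>2) * (a \<bullet> v)) (at s)"
    by (auto intro!: derivative_eq_intros simp: power2_eq_square algebra_simps)
  show "((\<lambda>s. 2 * cos s * sin s * ((norm v)\<^sup>2 - (norm a)\<^sup>2) + 2 * ((cos s)\<^sup>2 - (sin s)\<^sup>2) * (a \<bullet> v)) has_real_derivative
      2 * ((norm v)\<^sup>2 - (norm a)\<^sup>2)) (at 0)"
    by (auto intro!: derivative_eq_intros)
qed

abbreviation inv_first :: "'n::finite hvec \<Rightarrow> real" where
  "inv_first q \<equiv> (norm (fst (snd q)))\<^sup>2"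

abbreviation inv_second :: "'n::finite hvec \<Rightarrow> real" where
  "inv_second q \<equiv> (norm (snd (snd q)))\<^sup>2"

lemma norm_snd_eq: "(norm (snd q))\<^sup>2 = inv_first q + inv_second q"
  by (simp add: power2_norm_eq_inner inner_prod_def)

text \<open>Along each great circle the chain rule produces quadratic expressions in the frame
  vector, and only their sums over the frame enter. Working with the squared moduli instead of (r,
  \<phi>) gives polynomial coefficients on the whole sphere.\<close>

lemma sub_laplacian_chain:
  fixes q :: "'n::finite hvec" and f :: "'n cp_point \<Rightarrow> real" and \<Psi> \<Psi>x \<Psi>y :: "real \<Rightarrow> real \<Rightarrow> real"
  assumes \<Psi>: "\<And>x y. ((\<lambda>z. \<Psi> (fst z) (snd z)) has_derivative (\<lambda>h. \<Psi>x x y * fst h + \<Psi>y x y * snd h)) (at (x, y))"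
    and \<Psi>x: "\<And>x y. ((\<lambda>z. \<Psi>x (fst z) (snd z)) has_derivative (\<lambda>h. \<Psi>xx x y * fst h + \<Psi>xy x y * snd h)) (at (x, y))"
    and \<Psi>y: "\<And>x y. ((\<lambda>z. \<Psi>y (fst z) (snd z)) has_derivative (\<lambda>h. \<Psi>xy x y * fst h + \<Psi>yy x y * snd h)) (at (x, y))"
    and f: "\<And>q. f (cp_class q) = \<Psi> (inv_first q) (inv_second q)"
    and q: "norm q = 1"
  defines "x \<equiv> inv_first q" and "y \<equiv> inv_second q"
  shows "sub_laplacian f q =
    4 * (1 - (x + y)) * (x * \<Psi>xx x y + y * \<Psi>yy x y + \<Psi>x x y + \<Psi>y x y)
      - 8 * real CARD('n) * (x * \<Psi>x x y + y * \<Psi>y x y)"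
proof -
  define B where "B = (SOME B. horizontal_frame q B)"
  have B: "horizontal_frame q B"
    unfolding B_def by (rule someI_ex[OF horizontal_frame_exists])
  define a where "a v = fst (snd q) \<bullet> fst (snd v)" for v :: "'n hvec"
  define b where "b v = snd (snd q) \<bullet> snd (snd v)" for v :: "'n hvec"
  have D: "(deriv ^^ 2) (\<lambda>s. f (cp_class (cos s *\<^sub>R q + sin s *\<^sub>R v))) 0 =
      \<Psi>xx x y * (4 * (a v)\<^sup>2) + 2 * \<Psi>xy x y * (4 * (a v * b v)) + \<Psi>yy x y * (4 * (b v)\<^sup>2)
      + \<Psi>x x y * (2 * ((norm (fst (snd v)))\<^sup>2 - x)) + \<Psi>y x y * (2 * ((norm (snd (snd v)))\<^sup>2 - y))" for v
    unfolding f
    using second_derivative_chain2[OF \<Psi> \<Psi>x \<Psi>y, OF norm_great_circle[where a = "fst (snd q)" and v = "fst (snd v)"]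
        norm_great_circle[where a = "snd (snd q)" and v = "snd (snd v)"]]
    by (simp add: a_def b_def x_def y_def power_mult_distrib)
  \<comment> \<open>The terms with \<open>card B\<close> stem from the bending of the great circle
    towards -q; with 4n frame vectors they become the Euler term with factor 8n.\<close>
  have "sub_laplacian f q = \<Psi>xx x y * (4 * (\<Sum>v\<in>B. (a v)\<^sup>2)) + 2 * \<Psi>xy x y * (4 * (\<Sum>v\<in>B. a v * b v))
      + \<Psi>yy x y * (4 * (\<Sum>v\<in>B. (b v)\<^sup>2))
      + \<Psi>x x y * (2 * ((\<Sum>v\<in>B. (norm (fst (snd v)))\<^sup>2) - real (card B) * x))
      + \<Psi>y x y * (2 * ((\<Sum>v\<in>B. (norm (snd (snd v)))\<^sup>2) - real (card B) * y))"
    unfolding sub_laplacian_def B_def[symmetric] D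
    by (simp only: sum.distrib sum_subtractf sum_distrib_left[symmetric] sum_constant)
  also have "\<dots> = 4 * (1 - (x + y)) * (x * \<Psi>xx x y + y * \<Psi>yy x y + \<Psi>x x y + \<Psi>y x y)
      - 8 * real CARD('n) * (x * \<Psi>x x y + y * \<Psi>y x y)"
    unfolding a_def b_def frame_sum_first[OF q B] frame_sum_second[OF q B] frame_sum_mixed[OF q B]
      frame_sum_norm_first[OF q B] frame_sum_norm_second[OF q B] frame_card[OF q B] norm_snd_eq
      x_def[symmetric] y_def[symmetric]
    by (simp add: algebra_simps)
  finally show ?thesis .
qed

text \<open>The homogenised Legendre polynomial: with x = vp and y = v(1-p) it equals v^m times the
  shifted Legendre polynomial in p. In this form it is smooth also where v = 0 and p has no
  meaning.\<close>

definition solid_legendre :: "nat \<Rightarrow> real \<Rightarrow> real \<Rightarrow> real" where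
  "solid_legendre m x y = (\<Sum>s\<le>m. (real (m choose s))\<^sup>2 * ((- y) ^ s * x ^ (m - s)))"

lemma solid_legendre_eq: "solid_legendre m (v * p) (v * (1 - p)) = v ^ m * poly (shifted_jacobi m 0 0) p"
  unfolding solid_legendre_def poly_shifted_jacobi sum_distrib_left
proof (intro sum.cong refl)
  fix s assume s: "s \<in> {..m}"
  then have "v ^ m = v ^ s * v ^ (m - s)"
    by (simp flip: power_add)
  moreover have "(- (v * (1 - p))) ^ s = v ^ s * (p - 1) ^ s"
    by (simp add: algebra_simps flip: power_mult_distrib)
  ultimately show "(real (m choose s))\<^sup>2 * ((- (v * (1 - p))) ^ s * (v * p) ^ (m - s)) =
      v ^ m * (real (0 + m choose (m - s)) * real (0 + m choose s) * ((p - 1) ^ s * p ^ (m - s)))"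
    using s binomial_symmetric[of s m] by (simp add: power2_eq_square power_mult_distrib)
qed

text \<open>The family is general enough to be closed under both partial derivatives, so the same
  rule also yields the second derivatives.\<close>

lemma has_derivative_bivariate_sum:
  fixes c :: "nat \<Rightarrow> real"
  shows "((\<lambda>z. \<Sum>s\<in>S. c s * ((- snd z) ^ i s * fst z ^ j s)) has_derivative
    (\<lambda>h. (\<Sum>s\<in>S. c s * real (j s) * ((- y) ^ i s * x ^ (j s - 1))) * fst h
        + (\<Sum>s\<in>S. - (c s * real (i s)) * ((- y) ^ (i s - 1) * x ^ j s)) * snd h)) (at (x, y :: real))"
proof -
  have "((\<lambda>z. \<Sum>s\<in>S. c s * ((- snd z) ^ i s * fst z ^ j s)) has_derivative
    (\<lambda>h. \<Sum>s\<in>S. c s * real (j s) * ((- y) ^ i s * x ^ (j s - 1)) * fst h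
        + - (c s * real (i s)) * ((- y) ^ (i s - 1) * x ^ j s) * snd h)) (at (x, y))"
    by (intro has_derivative_sum) (auto intro!: derivative_eq_intros simp: fun_eq_iff algebra_simps)
  then show ?thesis
    by (simp only: sum.distrib sum_distrib_right)
qed

text \<open>The solid Legendre polynomial is harmonic and homogeneous, so that its product with a
  function of \<open>x + y\<close> is mapped to a product of the same form.\<close>

lemma sub_laplacian_solid_legendre:
  fixes q :: "'n::finite hvec" and f :: "'n cp_point \<Rightarrow> real"
  assumes f: "\<And>q. f (cp_class q) = solid_legendre m (inv_first q) (inv_second q) * poly g (inv_first q + inv_second q)"
    and q: "norm q = 1"
  defines "x \<equiv> inv_first q" and "y \<equiv> inv_second q"
  shows "sub_laplacian f q = solid_legendre m x y *
    (4 * (1 - (x + y)) * ((x + y) * poly (pderiv (pderiv g)) (x + y) + 2 * real (m + 1) * poly (pderiv g) (x + y))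
      - 8 * real CARD('n) * ((x + y) * poly (pderiv g) (x + y) + real m * poly g (x + y)))"
proof -
  define c where "c s = (real (m choose s))\<^sup>2" for s
  define R where "R x y = (\<Sum>s\<le>m. c s * ((- y) ^ s * x ^ (m - s)))" for x y :: real
  define Rx where "Rx x y = (\<Sum>s\<le>m. c s * real (m - s) * ((- y) ^ s * x ^ (m - s - 1)))" for x y :: real
  define Ry where "Ry x y = (\<Sum>s\<le>m. - (c s * real s) * ((- y) ^ (s - 1) * x ^ (m - s)))" for x y :: real
  \<comment> \<open>The unsimplified signs and exponents are those that
    \<open>has_derivative_bivariate_sum\<close> produces when applied to \<open>Rx\<close> and
    \<open>Ry\<close>.\<close>
  define Rxx where "Rxx x y = (\<Sum>s\<le>m. c s * real (m - s) * real (m - s - 1) * ((- y) ^ s * x ^ (m - s - 1 - 1)))" for x y :: real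
  define Rxy where "Rxy x y = (\<Sum>s\<le>m. - (c s * real (m - s) * real s) * ((- y) ^ (s - 1) * x ^ (m - s - 1)))" for x y :: real
  define Ryy where "Ryy x y = (\<Sum>s\<le>m. - (- (c s * real s) * real (s - 1)) * ((- y) ^ (s - 1 - 1) * x ^ (m - s)))" for x y :: real
  have R_eq: "solid_legendre m = R"
    by (simp add: fun_eq_iff solid_legendre_def R_def c_def)
  have dR: "((\<lambda>z. R (fst z) (snd z)) has_derivative (\<lambda>h. Rx x y * fst h + Ry x y * snd h)) (at (x, y))" for x y
    unfolding R_def Rx_def Ry_def by (rule has_derivative_bivariate_sum)
  have dRx: "((\<lambda>z. Rx (fst z) (snd z)) has_derivative (\<lambda>h. Rxx x y * fst h + Rxy x y * snd h)) (at (x, y))" for x y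
    unfolding Rx_def Rxx_def Rxy_def by (rule has_derivative_bivariate_sum)
  \<comment> \<open>The symmetry of the mixed derivative: the two orders of differentiation differ
    only in the arrangement of the coefficient.\<close>
  have Rxy: "Rxy x y = (\<Sum>s\<le>m. - (c s * real s) * real (m - s) * ((- y) ^ (s - 1) * x ^ (m - s - 1)))" for x y
    unfolding Rxy_def by (intro sum.cong refl) (simp add: mult_ac)
  have dRy: "((\<lambda>z. Ry (fst z) (snd z)) has_derivative (\<lambda>h. Rxy x y * fst h + Ryy x y * snd h)) (at (x, y))" for x y
    unfolding Ry_def Rxy Ryy_def by (rule has_derivative_bivariate_sum)
  define G G1 G2 where "G x y = poly g (x + y)" and "G1 x y = poly (pderiv g) (x + y)"
    and "G2 x y = poly (pderiv (pderiv g)) (x + y)" for x y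
  have dpoly: "((\<lambda>z. poly p (fst z + snd z)) has_derivative (\<lambda>h. poly (pderiv p) (x + y) * (fst h + snd h))) (at (x, y))"
    for p :: "real poly" and x y
  proof -
    have "((\<lambda>z. fst z + snd z) has_derivative (\<lambda>h. fst h + snd h)) (at (x, y))"
      by (auto intro!: derivative_eq_intros)
    moreover have "(poly p has_derivative (*) (poly (pderiv p) (x + y))) (at (fst (x, y) + snd (x, y)))"
      using poly_DERIV[of p "x + y"] by (simp add: has_field_derivative_def)
    ultimately show ?thesis
      by (rule has_derivative_compose)
  qed
  note dG = dpoly[of g, folded G_def G1_def] and dG1 = dpoly[of "pderiv g", folded G1_def G2_def]
  define \<Psi> where "\<Psi> x y = R x y * G x y" for x y
  define \<Psi>x where "\<Psi>x x y = Rx x y * G x y + R x y * G1 x y" for x y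
  define \<Psi>y where "\<Psi>y x y = Ry x y * G x y + R x y * G1 x y" for x y
  define \<Psi>xx where "\<Psi>xx x y = Rxx x y * G x y + 2 * Rx x y * G1 x y + R x y * G2 x y" for x y
  define \<Psi>xy where "\<Psi>xy x y = Rxy x y * G x y + (Rx x y + Ry x y) * G1 x y + R x y * G2 x y" for x y
  define \<Psi>yy where "\<Psi>yy x y = Ryy x y * G x y + 2 * Ry x y * G1 x y + R x y * G2 x y" for x y
  have "((\<lambda>z. \<Psi> (fst z) (snd z)) has_derivative (\<lambda>h. \<Psi>x x y * fst h + \<Psi>y x y * snd h)) (at (x, y))" for x y
    unfolding \<Psi>_def \<Psi>x_def \<Psi>y_def
    by (rule has_derivative_eq_rhs[OF has_derivative_mult[OF dR dG]]) (simp add: fun_eq_iff algebra_simps)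
  moreover have "((\<lambda>z. \<Psi>x (fst z) (snd z)) has_derivative (\<lambda>h. \<Psi>xx x y * fst h + \<Psi>xy x y * snd h)) (at (x, y))" for x y
    unfolding \<Psi>x_def \<Psi>xx_def \<Psi>xy_def
    by (rule has_derivative_eq_rhs[OF has_derivative_add[OF has_derivative_mult[OF dRx dG] has_derivative_mult[OF dR dG1]]])
      (simp add: fun_eq_iff algebra_simps)
  moreover have "((\<lambda>z. \<Psi>y (fst z) (snd z)) has_derivative (\<lambda>h. \<Psi>xy x y * fst h + \<Psi>yy x y * snd h)) (at (x, y))" for x y
    unfolding \<Psi>y_def \<Psi>yy_def \<Psi>xy_def
    by (rule has_derivative_eq_rhs[OF has_derivative_add[OF has_derivative_mult[OF dRy dG] has_derivative_mult[OF dR dG1]]])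
      (simp add: fun_eq_iff algebra_simps)
  moreover have "f (cp_class q) = \<Psi> (inv_first q) (inv_second q)" for q
    by (simp add: f R_eq \<Psi>_def G_def)
  ultimately have L: "sub_laplacian f q =
    4 * (1 - (x + y)) * (x * \<Psi>xx x y + y * \<Psi>yy x y + \<Psi>x x y + \<Psi>y x y)
      - 8 * real CARD('n) * (x * \<Psi>x x y + y * \<Psi>y x y)"
    unfolding x_def y_def using q by (rule sub_laplacian_chain)
  have euler: "x * Rx x y + y * Ry x y = real m * R x y"
    unfolding R_def Rx_def Ry_def sum_distrib_left sum.distrib[symmetric]
  proof (intro sum.cong refl)
    fix s assume "s \<in> {..m}"
    then obtain i where m: "m = s + i" using le_Suc_ex by auto
    have "real i * (x * x ^ (i - 1)) = real i * x ^ i" "real s * (y * (- y) ^ (s - 1)) = - (real s * (- y) ^ s)"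
      by (cases i; simp) (cases s; simp)
    moreover have "x * (c s * real (m - s) * ((- y) ^ s * x ^ (m - s - 1))) + y * (- (c s * real s) * ((- y) ^ (s - 1) * x ^ (m - s)))
        = c s * ((- y) ^ s * (real i * (x * x ^ (i - 1))) - (real s * (y * (- y) ^ (s - 1))) * x ^ i)"
      unfolding m by (simp add: algebra_simps)
    ultimately show "x * (c s * real (m - s) * ((- y) ^ s * x ^ (m - s - 1))) + y * (- (c s * real s) * ((- y) ^ (s - 1) * x ^ (m - s)))
        = real m * (c s * ((- y) ^ s * x ^ (m - s)))"
      by (simp only:) (simp add: m algebra_simps)
  qed
  have "x * Rxx x y + Rx x y = (\<Sum>s\<le>m. c s * (real (m - s))\<^sup>2 * ((- y) ^ s * x ^ (m - s - 1)))"
    unfolding Rx_def Rxx_def sum_distrib_left sum.distrib[symmetric]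
  proof (intro sum.cong refl)
    fix s
    have "real i * (real (i - 1) * (x * x ^ (i - 1 - 1)) + x ^ (i - 1)) = (real i)\<^sup>2 * x ^ (i - 1)" for i
    proof (cases i)
      case (Suc j)
      then show ?thesis by (cases j) (auto simp: power2_eq_square algebra_simps)
    qed simp
    note 1 = this[of "m - s"]
    have "x * (c s * real (m - s) * real (m - s - 1) * ((- y) ^ s * x ^ (m - s - 1 - 1)))
        + c s * real (m - s) * ((- y) ^ s * x ^ (m - s - 1)) =
      c s * (- y) ^ s * (real (m - s) * (real (m - s - 1) * (x * x ^ (m - s - 1 - 1)) + x ^ (m - s - 1)))"
      by (simp only: distrib_left mult_ac)
    also have "\<dots> = c s * (real (m - s))\<^sup>2 * ((- y) ^ s * x ^ (m - s - 1))"
      unfolding 1 by (simp only: mult_ac)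
    finally show "x * (c s * real (m - s) * real (m - s - 1) * ((- y) ^ s * x ^ (m - s - 1 - 1)))
        + c s * real (m - s) * ((- y) ^ s * x ^ (m - s - 1)) = c s * (real (m - s))\<^sup>2 * ((- y) ^ s * x ^ (m - s - 1))" .
  qed
  also have "\<dots> = (\<Sum>s<m. c s * (real (m - s))\<^sup>2 * ((- y) ^ s * x ^ (m - s - 1)))"
    by (simp flip: lessThan_Suc_atMost)
  finally have harmonic_x: "x * Rxx x y + Rx x y = (\<Sum>s<m. c s * (real (m - s))\<^sup>2 * ((- y) ^ s * x ^ (m - s - 1)))" .
  have "y * Ryy x y + Ry x y = (\<Sum>s\<le>m. - (c s * (real s)\<^sup>2 * ((- y) ^ (s - 1) * x ^ (m - s))))"
    unfolding Ry_def Ryy_def sum_distrib_left sum.distrib[symmetric]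
  proof (intro sum.cong refl)
    fix s
    have "real s * (real (s - 1) * (y * (- y) ^ (s - 1 - 1)) - (- y) ^ (s - 1)) = - (real s)\<^sup>2 * (- y) ^ (s - 1)"
    proof (cases s)
      case (Suc j)
      then show ?thesis by (cases j) (auto simp: power2_eq_square algebra_simps)
    qed simp
    note 1 = this
    have "y * (- (- (c s * real s) * real (s - 1)) * ((- y) ^ (s - 1 - 1) * x ^ (m - s)))
        + - (c s * real s) * ((- y) ^ (s - 1) * x ^ (m - s)) =
      c s * x ^ (m - s) * (real s * (real (s - 1) * (y * (- y) ^ (s - 1 - 1)) - (- y) ^ (s - 1)))"
      by (simp only: right_diff_distrib mult_ac mult_minus_left mult_minus_right minus_minus add_uminus_conv_diff)
    also have "\<dots> = - (c s * (real s)\<^sup>2 * ((- y) ^ (s - 1) * x ^ (m - s)))"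
      unfolding 1 by (simp only: mult_ac mult_minus_left mult_minus_right)
    finally show "y * (- (- (c s * real s) * real (s - 1)) * ((- y) ^ (s - 1 - 1) * x ^ (m - s)))
        + - (c s * real s) * ((- y) ^ (s - 1) * x ^ (m - s)) = - (c s * (real s)\<^sup>2 * ((- y) ^ (s - 1) * x ^ (m - s)))" .
  qed
  also have "\<dots> = (\<Sum>s<m. - (c (Suc s) * (real (Suc s))\<^sup>2 * ((- y) ^ s * x ^ (m - Suc s))))"
    by (subst sum.atMost_shift) (simp del: of_nat_Suc)
  also have "\<dots> = (\<Sum>s<m. - (c s * (real (m - s))\<^sup>2 * ((- y) ^ s * x ^ (m - s - 1))))"
  proof (intro sum.cong refl)
    fix s
    \<comment> \<open>This absorption identity, squared, is the reason for the squared binomials: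
      the x-part and the shifted y-part of the harmonic operator cancel term by term.\<close>
    have "real (Suc s) * real (m choose Suc s) = real (m - s) * real (m choose s)"
      by (simp only: binomial_absorption binomial_absorb_comp flip: of_nat_mult)
    then have "(real (Suc s) * real (m choose Suc s))\<^sup>2 = (real (m - s) * real (m choose s))\<^sup>2"
      by (rule arg_cong)
    then have "c (Suc s) * (real (Suc s))\<^sup>2 = c s * (real (m - s))\<^sup>2"
      unfolding c_def power_mult_distrib by (simp only: mult.commute)
    then show "- (c (Suc s) * (real (Suc s))\<^sup>2 * ((- y) ^ s * x ^ (m - Suc s))) = - (c s * (real (m - s))\<^sup>2 * ((- y) ^ s * x ^ (m - s - 1)))"
      by (simp only:) simp
  qed
  finally have harmonic: "y * Ryy x y + Ry x y = - (x * Rxx x y + Rx x y)"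
    unfolding harmonic_x sum_negf .
  \<comment> \<open>Harmonicity removes every term with G undifferentiated, and Euler's identity
    turns the cross terms 2 (x Rx + y Ry) G1 into 2m R G1. Thus R factors out.\<close>
  have 1: "x * \<Psi>xx x y + y * \<Psi>yy x y + \<Psi>x x y + \<Psi>y x y =
      R x y * ((x + y) * G2 x y + 2 * real (m + 1) * G1 x y)"
  proof -
    have "x * \<Psi>xx x y + y * \<Psi>yy x y + \<Psi>x x y + \<Psi>y x y =
      (x * Rxx x y + Rx x y + (y * Ryy x y + Ry x y)) * G x y + 2 * (x * Rx x y + y * Ry x y) * G1 x y
       + R x y * ((x + y) * G2 x y + 2 * G1 x y)"
      unfolding \<Psi>xx_def \<Psi>yy_def \<Psi>x_def \<Psi>y_def by algebra
    then show ?thesis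
      unfolding harmonic euler by (simp add: algebra_simps)
  qed
  have 2: "x * \<Psi>x x y + y * \<Psi>y x y = R x y * ((x + y) * G1 x y + real m * G x y)"
  proof -
    have "x * \<Psi>x x y + y * \<Psi>y x y = (x * Rx x y + y * Ry x y) * G x y + R x y * ((x + y) * G1 x y)"
      unfolding \<Psi>x_def \<Psi>y_def by algebra
    then show ?thesis
      unfolding euler by (simp add: algebra_simps)
  qed
  show ?thesis
    unfolding L 1 2 R_eq G_def G1_def G2_def by (simp add: algebra_simps)
qed

subsection \<open>Eigenfunctions of the sub-Laplacian\<close>

text \<open>Descends a function from the sphere to the orbits by way of a chosen representative; for
  circle invariant functions the choice is immaterial.\<close>

definition cp_lift :: "('n::finite hvec \<Rightarrow> 'a) \<Rightarrow> 'n cp_point \<Rightarrow> 'a" where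
  "cp_lift F X = F (SOME q. q \<in> X)"

lemma cp_lift_class:
  assumes "\<And>\<theta> q. F (qscale (cis \<theta>, 0) q) = F q"
  shows "cp_lift F (cp_class q) = F q"
proof -
  have "(SOME x. x \<in> cp_class q) \<in> cp_class q"
    by (rule someI[of _ "qscale (cis 0, 0) q"]) (unfold cp_class_def, rule rangeI)
  then obtain \<theta> where "(SOME x. x \<in> cp_class q) = qscale (cis \<theta>, 0) q"
    unfolding cp_class_def by (elim rangeE)
  then show ?thesis
    using assms[of \<theta> q] by (simp add: cp_lift_def)
qed

lemma inv_circle:
  "inv_first (qscale (cis \<theta>, 0) q) = inv_first q" "inv_second (qscale (cis \<theta>, 0) q) = inv_second q"
  by (simp_all add: qscale_def qmult_def norm_mult)

definition zonal_function :: "nat \<Rightarrow> real poly \<Rightarrow> 'n::finite cp_point \<Rightarrow> real" where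
  "zonal_function m g = cp_lift (\<lambda>q. solid_legendre m (inv_first q) (inv_second q) * poly g (inv_first q + inv_second q))"

lemma zonal_function_class:
  "zonal_function m g (cp_class q) = solid_legendre m (inv_first q) (inv_second q) * poly g (inv_first q + inv_second q)"
  unfolding zonal_function_def by (rule cp_lift_class) (simp add: inv_circle)

lemma C2_on_CP_zonal_function: "C2_on_CP (zonal_function m g :: 'n::finite cp_point \<Rightarrow> real)"
proof -
  have "C2_on (- {0}) (\<lambda>x :: 'n hvec. fst (snd x) \<bullet> fst (snd x))" "C2_on (- {0}) (\<lambda>x :: 'n hvec. snd (snd x) \<bullet> snd (snd x))"
    by (intro C2_on_inner_linear bounded_linear_intros)+
  moreover have "C2_on (- {0}) (\<lambda>x :: 'n hvec. inverse (x \<bullet> x))"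
    by (intro C2_on_inverse C2_on_inner_linear bounded_linear_ident) auto
  \<comment> \<open>Extended constantly along rays, the squared moduli are quotients of quadratic
    forms by the squared norm, hence of class C2 away from the origin.\<close>
  moreover have "inv_first (x /\<^sub>R norm x) = inverse (x \<bullet> x) * (fst (snd x) \<bullet> fst (snd x))"
    "inv_second (x /\<^sub>R norm x) = inverse (x \<bullet> x) * (snd (snd x) \<bullet> snd (snd x))" for x :: "'n hvec"
    by (simp_all add: power_mult_distrib power2_norm_eq_inner[symmetric] power_inverse)
  ultimately have "C2_on (- {0}) (\<lambda>x :: 'n hvec. inv_first (x /\<^sub>R norm x))" "C2_on (- {0}) (\<lambda>x :: 'n hvec. inv_second (x /\<^sub>R norm x))"
    by auto
  from this(1) C2_on_mult[OF C2_on_const[of _ "-1"] this(2)] this(2) show ?thesis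
    unfolding C2_on_CP_def zonal_function_class solid_legendre_def
    by (intro C2_on_mult C2_on_sum C2_on_const C2_on_power[of _ "\<lambda>x. - F x" for F]
        C2_on_power[of _ "\<lambda>x. inv_first (F x)" for F] C2_on_poly C2_on_add) simp_all
qed

text \<open>A separated solution: the Jacobi equation in v contributes 4k(k+2n+2m+1) to the decay
  rate, and the Euler field acting on the homogeneous factor of degree m contributes 8nm.\<close>

lemma heat_solution_zonal_function:
  fixes n m k :: nat
  assumes n: "n = CARD('n::finite)"
  shows "heat_solution (\<lambda>t. zonal_function m
    (smult (exp (- real (4 * k * (k + 2 * n + 2 * m + 1) + 8 * n * m) * t)) (shifted_jacobi k (2 * n - 1) (2 * m + 1)))
    :: 'n cp_point \<Rightarrow> real)"
proof -
  define ev where "ev = real (4 * k * (k + 2 * n + 2 * m + 1) + 8 * n * m)"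
  define J where "J = shifted_jacobi k (2 * n - 1) (2 * m + 1)"
  define u where "u t = (zonal_function m (smult (exp (- ev * t)) J) :: 'n cp_point \<Rightarrow> real)" for t
  have u: "u t (cp_class q) = exp (- ev * t) * (solid_legendre m (inv_first q) (inv_second q) * poly J (inv_first q + inv_second q))" for t q
    by (simp add: u_def zonal_function_class mult_ac)
  have "n \<ge> 1" using n by (simp add: Suc_leI)
  have "heat_solution u"
    unfolding heat_solution_def
  proof (intro conjI allI impI ballI)
    show "continuous_on ({0..} \<times> sphere 0 1) (\<lambda>(t, q). u t (cp_class q))"
      unfolding u split_beta solid_legendre_def by (intro continuous_intros)
    show "C2_on_CP (u t)" for t
      unfolding u_def by (rule C2_on_CP_zonal_function)
    fix t :: real and q :: "'n hvec" assume q: "q \<in> sphere 0 1"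
    define x y where "x = inv_first q" and "y = inv_second q"
    define A where "A = x + y"
    define J0 J1 J2 where "J0 = poly J A" and "J1 = poly (pderiv J) A" and "J2 = poly (pderiv (pderiv J)) A"
    define E where "E = exp (- ev * t)"
    have "sub_laplacian (u t) q = solid_legendre m x y *
        (4 * (1 - A) * (A * (E * J2) + 2 * real (m + 1) * (E * J1)) - 8 * real CARD('n) * (A * (E * J1) + real m * (E * J0)))"
      using sub_laplacian_solid_legendre[OF zonal_function_class, of q m "smult (exp (- ev * t)) J"] q
      unfolding u_def x_def[symmetric] y_def[symmetric] A_def[symmetric] E_def[symmetric]
      by (simp add: pderiv_smult J0_def J1_def J2_def)
    also have "\<dots> = solid_legendre m x y * E *
        (4 * (A * (1 - A) * J2 + (2 * real m + 2 - (2 * real n + 2 * real m + 2) * A) * J1) - 8 * real n * real m * J0)"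
      unfolding n[symmetric] by (simp add: algebra_simps)
    \<comment> \<open>The factor 2m+2 is b+1 and 2n+2m+2 is a+b+2 for a = 2n-1 and b = 2m+1, which
      fixes the Jacobi parameters.\<close>
    also have "A * (1 - A) * J2 + (2 * real m + 2 - (2 * real n + 2 * real m + 2) * A) * J1 =
        - (real (k * (k + 2 * n + 2 * m + 1)) * J0)"
    proof -
      have "2 * n - 1 + (2 * m + 1) + 2 = 2 * n + 2 * m + 2" "k + (2 * n - 1) + (2 * m + 1) + 1 = k + 2 * n + 2 * m + 1"
        using \<open>n \<ge> 1\<close> by auto
      then show ?thesis
        using shifted_jacobi_ode[of A k "2 * n - 1" "2 * m + 1"]
        unfolding J_def[symmetric] J0_def J1_def J2_def
        by (simp only: of_nat_add of_nat_mult) (simp add: algebra_simps)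
    qed
    also have "solid_legendre m x y * E * (4 * - (real (k * (k + 2 * n + 2 * m + 1)) * J0) - 8 * real n * real m * J0) =
        - ev * E * (solid_legendre m x y * J0)"
      by (simp add: ev_def algebra_simps)
    finally have "sub_laplacian (u t) q = - ev * E * (solid_legendre m x y * J0)" .
    then show "((\<lambda>s. u s (cp_class q)) has_real_derivative sub_laplacian (u t) q) (at t)"
      unfolding u E_def x_def y_def J0_def A_def by (auto intro!: derivative_eq_intros)
  qed
  then show ?thesis
    unfolding u_def ev_def J_def .
qed

text \<open>The north pole has v = p = 1, where the Legendre factor equals 1.\<close>

lemma zonal_function_north: "zonal_function m g (cp_class (north :: 'n::finite hvec)) = poly g 1"
  using solid_legendre_eq[of m 1 1] by (simp add: zonal_function_class north_def poly_shifted_jacobi_1)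

subsection \<open>The sphere measure in the coordinates\<close>

text \<open>The density is the derivative of the ball volume as a function of the squared radius.
  Both measures agree on the half-lines \<open>{..a}\<close>, which generate the Borel sets.\<close>

lemma nn_integral_norm_square:
  fixes g :: "real \<Rightarrow> ennreal"
  assumes g[measurable]: "g \<in> borel_measurable borel" and d: "DIM('a::euclidean_space) = 2 * d"
  shows "(\<integral>\<^sup>+x. g ((norm x)\<^sup>2) \<partial>(lborel :: 'a measure)) =
    ennreal (real d * unit_ball_vol (real (2 * d))) * (\<integral>\<^sup>+X. ennreal (X ^ (d - 1)) * indicator {0..} X * g X \<partial>lborel)"
proof -
  define \<omega> where "\<omega> = unit_ball_vol (real (2 * d))"
  have \<omega>: "\<omega> \<ge> 0" by (simp add: \<omega>_def)
  have "d \<ge> 1" using d DIM_positive[where 'a = 'a] by simp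
  define N where "N = density lborel (\<lambda>X. ennreal (real d * \<omega> * X ^ (d - 1)) * indicator {0..} X)"
  have N: "emeasure N {..a} = (if a \<ge> 0 then ennreal (\<omega> * a ^ d) else 0)" for a
  proof -
    have "emeasure N {..a} = (\<integral>\<^sup>+X. ennreal (real d * \<omega> * X ^ (d - 1)) * indicator {0..a} X \<partial>lborel)"
      unfolding N_def by (subst emeasure_density) (auto intro!: nn_integral_cong split: split_indicator)
    also have "\<dots> = (if a \<ge> 0 then ennreal (\<omega> * a ^ d) else 0)"
    proof (cases "a \<ge> 0")
      case True
      have "(\<integral>\<^sup>+X. ennreal (real d * \<omega> * X ^ (d - 1)) * indicator {0..a} X \<partial>lborel) = ennreal (\<omega> * a ^ d - \<omega> * 0 ^ d)"
        using True \<omega> by (intro nn_integral_FTC_Icc) (auto intro!: derivative_eq_intros)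
      then show ?thesis using True \<open>d \<ge> 1\<close> by (simp add: power_0_left)
    qed (simp add: indicator_def)
    finally show ?thesis .
  qed
  have M: "emeasure (distr (lborel :: 'a measure) borel (\<lambda>x. (norm x)\<^sup>2)) {..a} = (if a \<ge> 0 then ennreal (\<omega> * a ^ d) else 0)" for a
  proof -
    have "emeasure (distr (lborel :: 'a measure) borel (\<lambda>x. (norm x)\<^sup>2)) {..a} = emeasure lborel {x :: 'a. (norm x)\<^sup>2 \<le> a}"
      by (subst emeasure_distr) (auto intro!: arg_cong[where f = "emeasure lborel"])
    also have "\<dots> = (if a \<ge> 0 then ennreal (\<omega> * a ^ d) else 0)"
    proof (cases "a \<ge> 0")
      case True
      then have "{x :: 'a. (norm x)\<^sup>2 \<le> a} = cball 0 (sqrt a)"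
        by (auto simp: real_le_rsqrt) (metis norm_ge_zero real_sqrt_le_iff real_sqrt_pow2_iff real_sqrt_unique)
      then show ?thesis
        using True by (simp add: emeasure_cball d \<omega>_def power_mult)
    next
      case False
      then have "{x :: 'a. (norm x)\<^sup>2 \<le> a} = {}"
        by (auto simp: not_le intro: less_le_trans)
      then show ?thesis using False by simp
    qed
    finally show ?thesis .
  qed
  have sets_borel: "sets (borel :: real measure) = sigma_sets UNIV (range (\<lambda>a. {..a}))"
    by (subst borel_eq_atMost) simp
  have sets_N: "sets N = sets borel"
    by (simp add: N_def)
  have "distr (lborel :: 'a measure) borel (\<lambda>x. (norm x)\<^sup>2) = N"
  proof (rule measure_eqI_generator_eq[where \<Omega> = UNIV and E = "range (\<lambda>a::real. {..a})" and A = "\<lambda>i. {..real i}"])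
    show "Int_stable (range (\<lambda>a::real. {..a}))"
    proof -
      have "{..a} \<inter> {..b} = {..min a b}" for a b :: real
        by auto
      then show ?thesis by (auto simp: Int_stable_def)
    qed
    show "(\<Union>i. {..real i}) = UNIV"
      by (auto intro: real_arch_simple)
  qed (auto simp: M N sets_N sets_borel)
  then have "(\<integral>\<^sup>+x. g ((norm x)\<^sup>2) \<partial>(lborel :: 'a measure)) = integral\<^sup>N N g"
    by (subst nn_integral_distr[symmetric, of "\<lambda>x. (norm x)\<^sup>2"]) auto
  also have "\<dots> = (\<integral>\<^sup>+X. ennreal (real d * \<omega> * X ^ (d - 1)) * indicator {0..} X * g X \<partial>lborel)"
    unfolding N_def by (subst nn_integral_density) auto
  also have "\<dots> = (\<integral>\<^sup>+X. ennreal (real d * \<omega>) * (ennreal (X ^ (d - 1)) * indicator {0..} X * g X) \<partial>lborel)"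
    using \<omega> by (intro nn_integral_cong) (auto split: split_indicator simp: ennreal_mult mult_ac)
  also have "\<dots> = ennreal (real d * \<omega>) * (\<integral>\<^sup>+X. ennreal (X ^ (d - 1)) * indicator {0..} X * g X \<partial>lborel)"
    by (rule nn_integral_cmult) measurable
  finally show ?thesis
    unfolding \<omega>_def .
qed

text \<open>The substitution W = Y + Z, p = Y / W with Jacobian W, carried out as a translation in
  Z, an exchange of the integrals and a dilation in Y.\<close>

lemma nn_integral_sum_ratio:
  fixes g :: "real \<times> real \<Rightarrow> ennreal"
  assumes g[measurable]: "g \<in> borel_measurable borel"
  shows "(\<integral>\<^sup>+Y. \<integral>\<^sup>+Z. indicator {0..} Y * indicator {0..} Z * g (Y + Z, Y / (Y + Z)) \<partial>lborel \<partial>lborel) =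
    (\<integral>\<^sup>+W. \<integral>\<^sup>+p. indicator {0..} W * indicator {0..1} p * ennreal W * g (W, p) \<partial>lborel \<partial>lborel)"
proof -
  have "(\<integral>\<^sup>+Z. indicator {0..} Y * indicator {0..} Z * g (Y + Z, Y / (Y + Z)) \<partial>lborel) =
      (\<integral>\<^sup>+W. indicator {0..} Y * indicator {0..} (W - Y) * g (W, Y / W) \<partial>lborel)" for Y :: real
    using nn_integral_real_affine[of "\<lambda>Z. indicator {0..} Y * indicator {0..} Z * g (Y + Z, Y / (Y + Z))" 1 "- Y"]
    by (simp add: algebra_simps)
  then have "(\<integral>\<^sup>+Y. \<integral>\<^sup>+Z. indicator {0..} Y * indicator {0..} Z * g (Y + Z, Y / (Y + Z)) \<partial>lborel \<partial>lborel) =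
      (\<integral>\<^sup>+Y. \<integral>\<^sup>+W. indicator {0..} Y * indicator {0..} (W - Y) * g (W, Y / W) \<partial>lborel \<partial>lborel)"
    by simp
  also have "\<dots> = (\<integral>\<^sup>+W. \<integral>\<^sup>+Y. indicator {0..} Y * indicator {0..} (W - Y) * g (W, Y / W) \<partial>lborel \<partial>lborel)"
    by (rule lborel_pair.Fubini'[symmetric]) measurable
  also have "\<dots> = (\<integral>\<^sup>+W. \<integral>\<^sup>+p. indicator {0..} W * indicator {0..1} p * ennreal W * g (W, p) \<partial>lborel \<partial>lborel)"
  proof (rule nn_integral_cong)
    fix W :: real
    consider "W < 0" | "W = 0" | "W > 0" by linarith
    then show "(\<integral>\<^sup>+Y. indicator {0..} Y * indicator {0..} (W - Y) * g (W, Y / W) \<partial>lborel) =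
        (\<integral>\<^sup>+p. indicator {0..} W * indicator {0..1} p * ennreal W * g (W, p) \<partial>lborel)"
    proof cases
      case 1
      then have "(\<lambda>Y. indicator {0..} Y * indicator {0..} (W - Y) * g (W, Y / W)) = (\<lambda>_. 0)"
        by (intro ext) (auto split: split_indicator)
      with 1 show ?thesis by (simp only:) simp
    next
      \<comment> \<open>For W = 0 the indicators leave only Y = 0, a null set, while the other side
        carries the factor W.\<close>
      case 2
      have "(\<integral>\<^sup>+Y. indicator {0..} Y * indicator {0..} (W - Y) * g (W, Y / W) \<partial>lborel) = (\<integral>\<^sup>+Y. 0 \<partial>(lborel :: real measure))"
      proof (rule nn_integral_cong_AE)
        show "AE Y in lborel. indicator {0..} Y * indicator {0..} (W - Y) * g (W, Y / W) = 0"
          using AE_lborel_singleton[of "0::real"]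
          by eventually_elim (auto split: split_indicator simp: 2)
      qed
      with 2 show ?thesis by simp
    next
      case 3
      have "(\<integral>\<^sup>+Y. indicator {0..} Y * indicator {0..} (W - Y) * g (W, Y / W) \<partial>lborel) =
          ennreal W * (\<integral>\<^sup>+p. indicator {0..} (W * p) * indicator {0..} (W - W * p) * g (W, p) \<partial>lborel)"
        using nn_integral_real_affine[of "\<lambda>Y. indicator {0..} Y * indicator {0..} (W - Y) * g (W, Y / W)" W 0] 3
        by simp
      also have "\<dots> = (\<integral>\<^sup>+p. ennreal W * (indicator {0..} (W * p) * indicator {0..} (W - W * p) * g (W, p)) \<partial>lborel)"
        by (rule nn_integral_cmult[symmetric]) measurable
      also have "\<dots> = (\<integral>\<^sup>+p. indicator {0..} W * indicator {0..1} p * ennreal W * g (W, p) \<partial>lborel)"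
        using 3 by (intro nn_integral_cong) (auto split: split_indicator simp: zero_le_mult_iff mult_ac)
      finally show ?thesis .
    qed
  qed
  finally show ?thesis .
qed

text \<open>Two sum-ratio substitutions: (Y, Z) becomes (W, p), then (W, X) becomes (T, v). The
  squared radius T in the unit ball separates with exponent k + 2, namely k from X^k, one from W and
  one from the Jacobian, and integrates to 1/(k+3).\<close>

lemma nn_integral_simplex:
  fixes f :: "real \<times> real \<Rightarrow> ennreal"
  assumes f[measurable]: "f \<in> borel_measurable borel"
  shows "(\<integral>\<^sup>+X. ennreal (X ^ k) * indicator {0..} X * (\<integral>\<^sup>+Y. \<integral>\<^sup>+Z. indicator {0..} Y * indicator {0..} Z *
      (f ((Y + Z) / (X + (Y + Z)), Y / (Y + Z)) * indicator {..1} (X + (Y + Z))) \<partial>lborel \<partial>lborel) \<partial>lborel) =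
    ennreal (1 / real (k + 3)) * (\<integral>\<^sup>+v. \<integral>\<^sup>+p. indicator {0..1} v * indicator {0..1} p * ennreal ((1 - v) ^ k * v) * f (v, p) \<partial>lborel \<partial>lborel)"
proof -
  have [measurable]: "f \<in> borel_measurable (borel \<Otimes>\<^sub>M borel)"
    by (simp add: borel_prod)
  define F where "F v = (\<integral>\<^sup>+p. indicator {0..1} p * f (v, p) \<partial>lborel)" for v
  have [measurable]: "F \<in> borel_measurable borel"
    unfolding F_def by measurable
  have F_eq: "(\<integral>\<^sup>+p. c * (indicator {0..1} p * f (v, p)) \<partial>lborel) = c * F v" for c v
    unfolding F_def by (rule nn_integral_cmult) measurable
  have E: "(\<integral>\<^sup>+p. indicator {0..1} v * indicator {0..1} p * ennreal ((1 - v) ^ k * v) * f (v, p) \<partial>lborel) =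
      indicator {0..1} v * ennreal ((1 - v) ^ k * v) * F v" for v
    unfolding F_eq[symmetric] by (intro nn_integral_cong) (simp add: mult_ac)
  have "(\<integral>\<^sup>+Y. \<integral>\<^sup>+Z. indicator {0..} Y * indicator {0..} Z *
      (f ((Y + Z) / (X + (Y + Z)), Y / (Y + Z)) * indicator {..1} (X + (Y + Z))) \<partial>lborel \<partial>lborel) =
      (\<integral>\<^sup>+W. indicator {0..} W * ennreal W * indicator {..1} (X + W) * F (W / (X + W)) \<partial>lborel)" for X :: real
  proof -
    have "(\<lambda>z. f (fst z / (X + fst z), snd z) * indicator {..1} (X + fst z)) \<in> borel_measurable borel"
      unfolding borel_prod[symmetric] by measurable
    note 1 = nn_integral_sum_ratio[OF this]
    have 2: "(\<integral>\<^sup>+p. indicator {0..} W * indicator {0..1} p * ennreal W * (f (W / (X + W), p) * indicator {..1} (X + W)) \<partial>lborel) =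
        indicator {0..} W * ennreal W * indicator {..1} (X + W) * F (W / (X + W))" for W
      unfolding F_eq[symmetric] by (intro nn_integral_cong) (simp add: mult_ac)
    show ?thesis
      using 1 unfolding fst_conv snd_conv 2 .
  qed
  then have "(\<integral>\<^sup>+X. ennreal (X ^ k) * indicator {0..} X * (\<integral>\<^sup>+Y. \<integral>\<^sup>+Z. indicator {0..} Y * indicator {0..} Z *
      (f ((Y + Z) / (X + (Y + Z)), Y / (Y + Z)) * indicator {..1} (X + (Y + Z))) \<partial>lborel \<partial>lborel) \<partial>lborel) =
    (\<integral>\<^sup>+X. \<integral>\<^sup>+W. ennreal (X ^ k) * indicator {0..} X * (indicator {0..} W * ennreal W * indicator {..1} (X + W) * F (W / (X + W))) \<partial>lborel \<partial>lborel)"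
    by (simp add: nn_integral_cmult)
  also have "\<dots> = (\<integral>\<^sup>+W. \<integral>\<^sup>+X. ennreal (X ^ k) * indicator {0..} X * (indicator {0..} W * ennreal W * indicator {..1} (X + W) * F (W / (X + W))) \<partial>lborel \<partial>lborel)"
    by (rule lborel_pair.Fubini'[symmetric]) measurable
  \<comment> \<open>The integrand is expressed through T = W + X and v = W / T by means of X =
    T(1-v) and W = Tv.\<close>
  also have "\<dots> = (\<integral>\<^sup>+W. \<integral>\<^sup>+X. indicator {0..} W * indicator {0..} X * (\<lambda>z. ennreal ((fst z * (1 - snd z)) ^ k * (fst z * snd z))
      * indicator {..1} (fst z) * F (snd z)) (W + X, W / (W + X)) \<partial>lborel \<partial>lborel)"
  proof (intro nn_integral_cong)
    fix W X :: real
    show "ennreal (X ^ k) * indicator {0..} X * (indicator {0..} W * ennreal W * indicator {..1} (X + W) * F (W / (X + W))) =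
      indicator {0..} W * indicator {0..} X * (\<lambda>z. ennreal ((fst z * (1 - snd z)) ^ k * (fst z * snd z))
      * indicator {..1} (fst z) * F (snd z)) (W + X, W / (W + X))"
    proof (cases "W \<ge> 0 \<and> X \<ge> 0")
      case True
      then have "(W + X) * (W / (W + X)) = W" "(W + X) * (1 - W / (W + X)) = X"
        by (cases "W + X = 0"; simp add: field_simps)+
      with True show ?thesis
        by (simp add: ennreal_mult add.commute mult_ac)
    qed (auto split: split_indicator)
  qed
  also have "\<dots> = (\<integral>\<^sup>+T. \<integral>\<^sup>+v. indicator {0..} T * indicator {0..1} v * ennreal T * (\<lambda>z. ennreal ((fst z * (1 - snd z)) ^ k * (fst z * snd z))
      * indicator {..1} (fst z) * F (snd z)) (T, v) \<partial>lborel \<partial>lborel)"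
    by (rule nn_integral_sum_ratio) (unfold borel_prod[symmetric], measurable)
  also have "\<dots> = (\<integral>\<^sup>+T. \<integral>\<^sup>+v. ennreal (T ^ (k + 2)) * indicator {0..1} T * (indicator {0..1} v * ennreal ((1 - v) ^ k * v) * F v) \<partial>lborel \<partial>lborel)"
  proof (intro nn_integral_cong)
    fix T v :: real
    show "indicator {0..} T * indicator {0..1} v * ennreal T * (\<lambda>z. ennreal ((fst z * (1 - snd z)) ^ k * (fst z * snd z))
      * indicator {..1} (fst z) * F (snd z)) (T, v) =
      ennreal (T ^ (k + 2)) * indicator {0..1} T * (indicator {0..1} v * ennreal ((1 - v) ^ k * v) * F v)"
    proof (cases "T \<in> {0..1} \<and> v \<in> {0..1}")
      case True
      then have "ennreal T * ennreal ((T * (1 - v)) ^ k * (T * v)) = ennreal (T ^ (k + 2)) * ennreal ((1 - v) ^ k * v)"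
        by (simp add: power_mult_distrib power_add power2_eq_square mult_ac flip: ennreal_mult)
      with True show ?thesis
        by (simp add: mult.assoc[symmetric])
    qed (auto split: split_indicator)
  qed
  also have "\<dots> = (\<integral>\<^sup>+T. ennreal (T ^ (k + 2)) * indicator {0..1} T \<partial>lborel) * (\<integral>\<^sup>+v. indicator {0..1} v * ennreal ((1 - v) ^ k * v) * F v \<partial>lborel)"
    by (subst nn_integral_cmult, measurable)+ (subst nn_integral_multc, measurable)
  also have "(\<integral>\<^sup>+T. ennreal (T ^ (k + 2)) * indicator {0..1} T \<partial>lborel) = ennreal (1 ^ (k + 3) / real (k + 3) - 0 ^ (k + 3) / real (k + 3))"
  proof (intro nn_integral_FTC_Icc)
    show "((\<lambda>T. T ^ (k + 3) / real (k + 3)) has_real_derivative T ^ (k + 2)) (at T)" for T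
      using DERIV_cdivide[OF DERIV_pow[of "k + 3" T], of "real (k + 3)"]
      by (simp del: of_nat_add add: numeral_3_eq_3)
  qed auto
  finally show ?thesis
    unfolding E by (simp add: power_0_left)
qed

text \<open>The pair \<open>(cos\<^sup>2 r, cos\<^sup>2 \<phi>)\<close>.\<close>

definition square_coords :: "'n::finite hvec \<Rightarrow> real \<times> real" where
  "square_coords q = ((norm (snd q))\<^sup>2, (norm (fst (snd q)))\<^sup>2 / (norm (snd q))\<^sup>2)"

lemma square_coords_measurable [measurable]: "square_coords \<in> borel_measurable borel"
  unfolding square_coords_def[abs_def]
  by (intro borel_measurable_Pair borel_measurable_divide borel_measurable_continuous_onI continuous_intros)

lemma nn_integral_sphere_measure:
  fixes F :: "'a::euclidean_space \<Rightarrow> ennreal"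
  assumes F[measurable]: "F \<in> borel_measurable borel"
  shows "(\<integral>\<^sup>+q. F q \<partial>sphere_measure) = of_nat DIM('a) * (\<integral>\<^sup>+x. F (x /\<^sub>R norm x) * indicator (cball 0 1 - {0}) x \<partial>lborel)"
proof -
  have T: "(\<lambda>x::'a. x /\<^sub>R norm x) \<in> measurable (restrict_space lborel (cball 0 1 - {0})) (restrict_space borel (sphere 0 1))"
    by (intro measurable_restrict_space2 measurable_restrict_space1) (auto simp: space_restrict_space)
  have F': "F \<in> borel_measurable (restrict_space borel (sphere 0 1))"
    by (rule measurable_restrict_space1) measurable
  have "(\<integral>\<^sup>+q. F q \<partial>sphere_measure) = of_nat DIM('a) * (\<integral>\<^sup>+x. F (x /\<^sub>R norm x) \<partial>restrict_space lborel (cball 0 1 - {0}))"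
    unfolding sphere_measure_def
    by (subst nn_integral_scale_measure) (auto intro!: measurable_restrict_space1 simp: nn_integral_distr[OF T] F' measurable_distr_eq1)
  then show ?thesis
    by (subst (asm) nn_integral_restrict_space) auto
qed

lemma measurable_ratio:
  fixes f :: "real \<times> real \<Rightarrow> ennreal"
  assumes f: "f \<in> borel_measurable borel"
    and [measurable]: "a \<in> borel_measurable M" "b \<in> borel_measurable M" "c \<in> borel_measurable M"
  shows "(\<lambda>x. f ((b x + c x) / (a x + (b x + c x)), b x / (b x + c x)) * indicator {..1::real} (a x + (b x + c x)))
    \<in> borel_measurable M"
proof -
  have [measurable]: "f \<in> borel_measurable (borel \<Otimes>\<^sub>M borel)"
    using f by (simp add: borel_prod)
  show ?thesis by measurable
qed

text \<open>The space splits into real dimensions 4n, 2 and 2, so the squared norms of the parts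
  have densities with exponents 2n-1, 0 and 0. The constant K stays abstract, because the
  normalisation of the reference measure compensates for it.\<close>

lemma nn_integral_square_coords:
  obtains K where "K > 0"
    "\<And>f. f \<in> borel_measurable borel \<Longrightarrow> (\<integral>\<^sup>+q. f (square_coords q) \<partial>(sphere_measure :: 'n::finite hvec measure)) =
      ennreal K * (\<integral>\<^sup>+v. \<integral>\<^sup>+p. indicator {0..1} v * indicator {0..1} p * ennreal ((1 - v) ^ (2 * CARD('n) - 1) * v) * f (v, p) \<partial>lborel \<partial>lborel)"
proof -
  define n where "n = CARD('n)"
  have "n \<ge> 1" by (simp add: n_def Suc_leI)
  define \<omega>1 where "\<omega>1 = real 1 * unit_ball_vol (real (2 * 1))"
  define \<omega>n where "\<omega>n = real (2 * n) * unit_ball_vol (real (2 * (2 * n)))"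
  define K where "K = real DIM('n hvec) * (\<omega>n * (\<omega>1 * (\<omega>1 * (1 / real (2 * n - 1 + 3)))))"
  have \<omega>: "\<omega>1 > 0" "\<omega>n > 0"
    using \<open>n \<ge> 1\<close> by (simp_all add: \<omega>1_def \<omega>n_def)
  then have "K > 0"
    by (simp add: K_def)
  moreover have "(\<integral>\<^sup>+q. f (square_coords q) \<partial>(sphere_measure :: 'n hvec measure)) =
      ennreal K * (\<integral>\<^sup>+v. \<integral>\<^sup>+p. indicator {0..1} v * indicator {0..1} p * ennreal ((1 - v) ^ (2 * n - 1) * v) * f (v, p) \<partial>lborel \<partial>lborel)"
    if f: "f \<in> borel_measurable borel" for f
  proof -
    have [measurable]: "f \<in> borel_measurable (borel \<Otimes>\<^sub>M borel)"
      using f by (simp add: borel_prod)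
    define H where "H X Y Z = f ((Y + Z) / (X + (Y + Z)), Y / (Y + Z)) * indicator {..1} (X + (Y + Z))" for X Y Z :: real
    have H[measurable (raw)]: "a \<in> borel_measurable M \<Longrightarrow> b \<in> borel_measurable M \<Longrightarrow> c \<in> borel_measurable M \<Longrightarrow>
      (\<lambda>x. H (a x) (b x) (c x)) \<in> borel_measurable M" for a b c M
      unfolding H_def by (rule measurable_ratio[OF f])
    have "(\<integral>\<^sup>+q. f (square_coords q) \<partial>(sphere_measure :: 'n hvec measure)) =
        of_nat DIM('n hvec) * (\<integral>\<^sup>+x. f (square_coords (x /\<^sub>R norm x)) * indicator (cball 0 1 - {0}) x \<partial>(lborel :: 'n hvec measure))"
      using f by (intro nn_integral_sphere_measure measurable_compose[OF square_coords_measurable])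
    also have "(\<integral>\<^sup>+x. f (square_coords (x /\<^sub>R norm x)) * indicator (cball 0 1 - {0}) x \<partial>(lborel :: 'n hvec measure)) =
        (\<integral>\<^sup>+x. H ((norm (fst x))\<^sup>2) ((norm (fst (snd x)))\<^sup>2) ((norm (snd (snd x)))\<^sup>2) \<partial>(lborel :: 'n hvec measure))"
    proof (rule nn_integral_cong_AE)
      show "AE x in lborel. f (square_coords (x /\<^sub>R norm x)) * indicator (cball 0 1 - {0}) x =
          H ((norm (fst x))\<^sup>2) ((norm (fst (snd x)))\<^sup>2) ((norm (snd (snd (x :: 'n hvec))))\<^sup>2)"
        using AE_lborel_singleton[of "0 :: 'n hvec"]
      proof eventually_elim
        case (elim x)
        have norms: "(norm x)\<^sup>2 = (norm (fst x))\<^sup>2 + ((norm (fst (snd x)))\<^sup>2 + (norm (snd (snd x)))\<^sup>2)"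
          "(norm (snd x))\<^sup>2 = (norm (fst (snd x)))\<^sup>2 + (norm (snd (snd x)))\<^sup>2"
          by (simp_all add: power2_norm_eq_inner inner_prod_def)
        have "square_coords (x /\<^sub>R norm x) = ((norm (snd x))\<^sup>2 / (norm x)\<^sup>2, (norm (fst (snd x)))\<^sup>2 / (norm (snd x))\<^sup>2)"
          using elim by (simp add: square_coords_def power_mult_distrib field_simps)
        moreover have "indicator (cball 0 1 - {0}) x = (indicator {..1} ((norm x)\<^sup>2) :: ennreal)"
          using elim by (simp add: indicator_def abs_square_le_1[of "norm x", simplified])
        ultimately show ?case
          unfolding H_def norms by simp
      qed
    qed
    also have "\<dots> = (\<integral>\<^sup>+y. \<integral>\<^sup>+z. \<integral>\<^sup>+w. H ((norm y)\<^sup>2) ((norm z)\<^sup>2) ((norm w)\<^sup>2)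
        \<partial>(lborel :: complex measure) \<partial>(lborel :: complex measure) \<partial>(lborel :: (quat ^ 'n) measure))"
    proof -
      have "(\<integral>\<^sup>+x. H ((norm (fst x))\<^sup>2) ((norm (fst (snd x)))\<^sup>2) ((norm (snd (snd x)))\<^sup>2) \<partial>(lborel :: 'n hvec measure)) =
          (\<integral>\<^sup>+y. \<integral>\<^sup>+q. H ((norm y)\<^sup>2) ((norm (fst q))\<^sup>2) ((norm (snd q))\<^sup>2) \<partial>(lborel :: quat measure) \<partial>(lborel :: (quat ^ 'n) measure))"
        unfolding lborel_prod[symmetric, where 'a = "quat ^ 'n" and 'b = quat]
      proof (subst lborel.nn_integral_fst[symmetric])
        show "(\<lambda>x :: 'n hvec. H ((norm (fst x))\<^sup>2) ((norm (fst (snd x)))\<^sup>2) ((norm (snd (snd x)))\<^sup>2)) \<in> borel_measurable (lborel \<Otimes>\<^sub>M lborel)"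
          unfolding H_def lborel_prod measurable_lborel2
          by (intro measurable_ratio[OF f] borel_measurable_continuous_onI continuous_intros)
      qed simp
      moreover have "(\<integral>\<^sup>+q. H ((norm y)\<^sup>2) ((norm (fst q))\<^sup>2) ((norm (snd q))\<^sup>2) \<partial>(lborel :: quat measure)) =
          (\<integral>\<^sup>+z. \<integral>\<^sup>+w. H ((norm y)\<^sup>2) ((norm z)\<^sup>2) ((norm w)\<^sup>2) \<partial>(lborel :: complex measure) \<partial>(lborel :: complex measure))" for y :: "quat ^ 'n"
        unfolding lborel_prod[symmetric, where 'a = complex and 'b = complex]
      proof (subst lborel.nn_integral_fst[symmetric])
        show "(\<lambda>x :: quat. H ((norm y)\<^sup>2) ((norm (fst x))\<^sup>2) ((norm (snd x))\<^sup>2)) \<in> borel_measurable (lborel \<Otimes>\<^sub>M lborel)"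
          unfolding H_def lborel_prod measurable_lborel2
          by (intro measurable_ratio[OF f] borel_measurable_continuous_onI continuous_intros)
      qed simp
      ultimately show ?thesis by simp
    qed
    also have "\<dots> = (\<integral>\<^sup>+y. ennreal \<omega>1 * (ennreal \<omega>1 * (\<integral>\<^sup>+Y. \<integral>\<^sup>+Z. indicator {0..} Y * indicator {0..} Z * H ((norm y)\<^sup>2) Y Z \<partial>lborel \<partial>lborel)) \<partial>(lborel :: (quat ^ 'n) measure))"
    proof (intro nn_integral_cong)
      fix y :: "quat ^ 'n"
      define x where "x = (norm y)\<^sup>2"
      have "(\<integral>\<^sup>+z. \<integral>\<^sup>+w. H x ((norm z)\<^sup>2) ((norm w)\<^sup>2) \<partial>(lborel :: complex measure) \<partial>(lborel :: complex measure)) =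
         (\<integral>\<^sup>+z. ennreal \<omega>1 * (\<integral>\<^sup>+Z. indicator {0..} Z * H x ((norm z)\<^sup>2) Z \<partial>lborel) \<partial>(lborel :: complex measure))"
        unfolding \<omega>1_def by (subst nn_integral_norm_square[where d = 1]) simp_all
      also have "\<dots> = ennreal \<omega>1 * (\<integral>\<^sup>+z. (\<integral>\<^sup>+Z. indicator {0..} Z * H x ((norm z)\<^sup>2) Z \<partial>lborel) \<partial>(lborel :: complex measure))"
        by (rule nn_integral_cmult) measurable
      also have "(\<integral>\<^sup>+z. (\<integral>\<^sup>+Z. indicator {0..} Z * H x ((norm z)\<^sup>2) Z \<partial>lborel) \<partial>(lborel :: complex measure)) =
          ennreal \<omega>1 * (\<integral>\<^sup>+Y. indicator {0..} Y * (\<integral>\<^sup>+Z. indicator {0..} Z * H x Y Z \<partial>lborel) \<partial>lborel)"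
        unfolding \<omega>1_def by (subst nn_integral_norm_square[where d = 1]) simp_all
      also have "(\<integral>\<^sup>+Y. indicator {0..} Y * (\<integral>\<^sup>+Z. indicator {0..} Z * H x Y Z \<partial>lborel) \<partial>lborel) =
          (\<integral>\<^sup>+Y. \<integral>\<^sup>+Z. indicator {0..} Y * indicator {0..} Z * H x Y Z \<partial>lborel \<partial>lborel)"
        by (subst nn_integral_cmult[symmetric]) (simp_all add: mult.assoc)
      finally show "(\<integral>\<^sup>+z. \<integral>\<^sup>+w. H ((norm y)\<^sup>2) ((norm z)\<^sup>2) ((norm w)\<^sup>2) \<partial>(lborel :: complex measure) \<partial>(lborel :: complex measure)) =
        ennreal \<omega>1 * (ennreal \<omega>1 * (\<integral>\<^sup>+Y. \<integral>\<^sup>+Z. indicator {0..} Y * indicator {0..} Z * H ((norm y)\<^sup>2) Y Z \<partial>lborel \<partial>lborel))"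
        unfolding x_def .
    qed
    also have "\<dots> = ennreal \<omega>n * (\<integral>\<^sup>+X. ennreal (X ^ (2 * n - 1)) * indicator {0..} X *
        (ennreal \<omega>1 * (ennreal \<omega>1 * (\<integral>\<^sup>+Y. \<integral>\<^sup>+Z. indicator {0..} Y * indicator {0..} Z * H X Y Z \<partial>lborel \<partial>lborel))) \<partial>lborel)"
      unfolding \<omega>n_def by (rule nn_integral_norm_square) (measurable, simp add: n_def)
    also have "\<dots> = ennreal \<omega>n * (\<integral>\<^sup>+X. ennreal \<omega>1 * (ennreal \<omega>1 * (ennreal (X ^ (2 * n - 1)) * indicator {0..} X *
        (\<integral>\<^sup>+Y. \<integral>\<^sup>+Z. indicator {0..} Y * indicator {0..} Z * H X Y Z \<partial>lborel \<partial>lborel))) \<partial>lborel)"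
      by (simp add: mult_ac)
    also have "\<dots> = ennreal \<omega>n * (ennreal \<omega>1 * (ennreal \<omega>1 * (\<integral>\<^sup>+X. ennreal (X ^ (2 * n - 1)) * indicator {0..} X *
        (\<integral>\<^sup>+Y. \<integral>\<^sup>+Z. indicator {0..} Y * indicator {0..} Z * H X Y Z \<partial>lborel \<partial>lborel) \<partial>lborel)))"
      by (subst nn_integral_cmult, measurable)+
    also have "(\<integral>\<^sup>+X. ennreal (X ^ (2 * n - 1)) * indicator {0..} X *
        (\<integral>\<^sup>+Y. \<integral>\<^sup>+Z. indicator {0..} Y * indicator {0..} Z * H X Y Z \<partial>lborel \<partial>lborel) \<partial>lborel) =
      ennreal (1 / real (2 * n - 1 + 3)) * (\<integral>\<^sup>+v. \<integral>\<^sup>+p. indicator {0..1} v * indicator {0..1} p * ennreal ((1 - v) ^ (2 * n - 1) * v) * f (v, p) \<partial>lborel \<partial>lborel)"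
      unfolding H_def by (rule nn_integral_simplex[OF f])
    finally show ?thesis
      using \<omega> unfolding K_def ennreal_of_nat_eq_real_of_nat
      by (simp add: ennreal_mult[symmetric] mult.assoc[symmetric] del: of_nat_add of_nat_mult of_nat_Suc)
  qed
  ultimately show ?thesis
    using that unfolding n_def by blast
qed

subsection \<open>The reference measure\<close>

text \<open>The variable is first reflected to 1 - v, because sin^2 r is increasing on the interval,
  as the substitution rule requires.\<close>

lemma nn_integral_cos_square:
  fixes F :: "real \<Rightarrow> ennreal"
  assumes F[measurable]: "F \<in> borel_measurable borel"
  shows "(\<integral>\<^sup>+v. indicator {0..1} v * F v \<partial>lborel) =
    (\<integral>\<^sup>+r. indicator {0..pi/2} r * (ennreal (2 * sin r * cos r) * F ((cos r)\<^sup>2)) \<partial>lborel)"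
proof -
  have "(\<integral>\<^sup>+v. indicator {0..1} v * F v \<partial>lborel) = (\<integral>\<^sup>+x. F (1 - x) * indicator {(sin 0)\<^sup>2..(sin (pi/2))\<^sup>2} x \<partial>lborel)"
    using nn_integral_real_affine[of "\<lambda>v. indicator {0..1} v * F v" "-1" 1]
    by (auto intro!: nn_integral_cong split: split_indicator)
  also have "\<dots> = (\<integral>\<^sup>+r. F (1 - (sin r)\<^sup>2) * ennreal (2 * sin r * cos r) * indicator {0..pi/2} r \<partial>lborel)"
    by (rule nn_integral_substitution_aux)
       (auto intro!: derivative_eq_intros continuous_intros mult_nonneg_nonneg sin_ge_zero cos_ge_zero)
  also have "\<dots> = (\<integral>\<^sup>+r. indicator {0..pi/2} r * (ennreal (2 * sin r * cos r) * F ((cos r)\<^sup>2)) \<partial>lborel)"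
    by (simp add: cos_squared_eq mult_ac)
  finally show ?thesis .
qed

text \<open>Clamping the argument makes the inverse of the coordinate change continuous everywhere.\<close>

definition angle_coords :: "real \<times> real \<Rightarrow> real \<times> real" where
  "angle_coords z = (arccos (max 0 (min 1 (sqrt (fst z)))), arccos (max 0 (min 1 (sqrt (snd z)))))"

lemma angle_coords_measurable [measurable]: "angle_coords \<in> borel_measurable borel"
  unfolding angle_coords_def[abs_def]
  by (intro borel_measurable_continuous_onI continuous_intros) auto

lemma angle_coords_cos:
  assumes "r \<in> {0..pi/2}" "\<phi> \<in> {0..pi/2}"
  shows "angle_coords ((cos r)\<^sup>2, (cos \<phi>)\<^sup>2) = (r, \<phi>)"
  using assms cos_ge_zero[of r] cos_ge_zero[of \<phi>]
  by (simp add: angle_coords_def arccos_cos min_absorb2 max_absorb2)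

text \<open>This includes the points with \<open>snd q = 0\<close>: division by zero gives 0 in both
  coordinate systems, so the second angle is the arccosine of 0 on either side.\<close>

lemma angle_coords_square_coords:
  assumes "q \<in> sphere 0 1"
  shows "angle_coords (square_coords q) = (coord_r q, coord_phi q)"
proof -
  have "norm (snd q) \<le> 1"
    using assms norm_snd_le[of "snd q" "fst q"] by simp
  moreover have "norm (fst (snd q)) / norm (snd q) \<le> 1"
    using norm_fst_le[of "fst (snd q)" "snd (snd q)"] by (auto simp: divide_le_eq_1 zero_less_norm_iff)
  ultimately show ?thesis
    by (simp add: angle_coords_def square_coords_def coord_r_def coord_phi_def real_sqrt_divide)
qed

text \<open>Under v = cos^2 r and p = cos^2 \<phi> the density (1-v)^(2n-1) v becomes 2 (sin
  r)^(4n-1) (cos r)^3 sin 2\<phi>; the 2 accounts for the constant 4 in place of 8.\<close>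

lemma nn_integral_angle_coords:
  fixes f :: "real \<times> real \<Rightarrow> ennreal"
  assumes f: "f \<in> borel_measurable borel" and n: "n \<ge> 1"
  shows "(\<integral>\<^sup>+z. f z \<partial>radial_measure n) = ennreal (4 * pi ^ (2*n+2) / Gamma (2 * real n)) *
    (\<integral>\<^sup>+v. \<integral>\<^sup>+p. indicator {0..1} v * indicator {0..1} p * ennreal ((1 - v) ^ (2 * n - 1) * v) * f (angle_coords (v, p)) \<partial>lborel \<partial>lborel)"
proof -
  have [measurable]: "f \<in> borel_measurable (borel \<Otimes>\<^sub>M borel)" "angle_coords \<in> borel_measurable (borel \<Otimes>\<^sub>M borel)"
    using f by (simp_all add: borel_prod)
  define g where "g z = f (angle_coords z)" for z
  have [measurable]: "g \<in> borel_measurable (borel \<Otimes>\<^sub>M borel)"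
    unfolding g_def borel_prod using f by (intro measurable_compose[OF angle_coords_measurable])
  define G where "G v = (\<integral>\<^sup>+p. indicator {0..1} p * g (v, p) \<partial>lborel)" for v
  have [measurable]: "G \<in> borel_measurable borel"
    unfolding G_def by measurable
  define c where "c = 4 * pi ^ (2*n+2) / Gamma (2 * real n)"
  have c: "c \<ge> 0"
    unfolding c_def using n by (intro divide_nonneg_nonneg Gamma_real_nonneg) auto
  have "(\<integral>\<^sup>+v. \<integral>\<^sup>+p. indicator {0..1} v * indicator {0..1} p * ennreal ((1 - v) ^ (2 * n - 1) * v) * g (v, p) \<partial>lborel \<partial>lborel) =
      (\<integral>\<^sup>+v. indicator {0..1} v * (ennreal ((1 - v) ^ (2 * n - 1) * v) * G v) \<partial>lborel)"
  proof (rule nn_integral_cong)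
    fix v :: real
    have "(\<integral>\<^sup>+p. (indicator {0..1} v * ennreal ((1 - v) ^ (2 * n - 1) * v)) * (indicator {0..1} p * g (v, p)) \<partial>lborel) =
        (indicator {0..1} v * ennreal ((1 - v) ^ (2 * n - 1) * v)) * G v"
      unfolding G_def by (rule nn_integral_cmult) measurable
    then show "(\<integral>\<^sup>+p. indicator {0..1} v * indicator {0..1} p * ennreal ((1 - v) ^ (2 * n - 1) * v) * g (v, p) \<partial>lborel) =
        indicator {0..1} v * (ennreal ((1 - v) ^ (2 * n - 1) * v) * G v)"
      by (simp only: mult_ac)
  qed
  also have "\<dots> = (\<integral>\<^sup>+r. indicator {0..pi/2} r * (ennreal (2 * sin r * cos r) * (ennreal ((1 - (cos r)\<^sup>2) ^ (2 * n - 1) * (cos r)\<^sup>2) * G ((cos r)\<^sup>2))) \<partial>lborel)"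
    by (rule nn_integral_cos_square) measurable
  also have "\<dots> = (\<integral>\<^sup>+r. \<integral>\<^sup>+\<phi>. indicator {0..pi/2} r * indicator {0..pi/2} \<phi> *
      ennreal (2 * (sin r ^ (4*n-1) * cos r ^ 3 * sin (2*\<phi>))) * f (r, \<phi>) \<partial>lborel \<partial>lborel)"
  proof (rule nn_integral_cong)
    fix r :: real
    show "indicator {0..pi/2} r * (ennreal (2 * sin r * cos r) * (ennreal ((1 - (cos r)\<^sup>2) ^ (2 * n - 1) * (cos r)\<^sup>2) * G ((cos r)\<^sup>2))) =
      (\<integral>\<^sup>+\<phi>. indicator {0..pi/2} r * indicator {0..pi/2} \<phi> *
      ennreal (2 * (sin r ^ (4*n-1) * cos r ^ 3 * sin (2*\<phi>))) * f (r, \<phi>) \<partial>lborel)"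
    proof (cases "r \<in> {0..pi/2}")
      case True
      then have sc: "sin r \<ge> 0" "cos r \<ge> 0"
        by (auto intro: sin_ge_zero cos_ge_zero)
      have p: "2 * sin r * cos r * ((1 - (cos r)\<^sup>2) ^ (2 * n - 1) * (cos r)\<^sup>2) = 2 * (sin r ^ (4*n-1) * cos r ^ 3)"
      proof -
        have "4 * n - 1 = Suc (2 * (2 * n - 1))" using n by simp
        then have "sin r ^ (4*n-1) = sin r * ((sin r)\<^sup>2) ^ (2 * n - 1)"
          by (simp add: power_mult)
        then show ?thesis
          unfolding sin_squared_eq[symmetric] by (simp add: power3_eq_cube power2_eq_square mult_ac)
      qed
      have "G ((cos r)\<^sup>2) = (\<integral>\<^sup>+\<phi>. indicator {0..pi/2} \<phi> * (ennreal (2 * sin \<phi> * cos \<phi>) * g ((cos r)\<^sup>2, (cos \<phi>)\<^sup>2)) \<partial>lborel)"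
        unfolding G_def by (rule nn_integral_cos_square) measurable
      also have "\<dots> = (\<integral>\<^sup>+\<phi>. indicator {0..pi/2} \<phi> * (ennreal (sin (2 * \<phi>)) * f (r, \<phi>)) \<partial>lborel)"
        using True by (intro nn_integral_cong) (auto split: split_indicator simp: g_def angle_coords_cos sin_double)
      finally have G_eq: "G ((cos r)\<^sup>2) = (\<integral>\<^sup>+\<phi>. indicator {0..pi/2} \<phi> * (ennreal (sin (2 * \<phi>)) * f (r, \<phi>)) \<partial>lborel)" .
      have pe: "ennreal (2 * sin r * cos r) * ennreal ((1 - (cos r)\<^sup>2) ^ (2 * n - 1) * (cos r)\<^sup>2) =
          ennreal (2 * (sin r ^ (4*n-1) * cos r ^ 3))"
        unfolding p[symmetric] sin_squared_eq[symmetric] using sc by (intro ennreal_mult[symmetric]) auto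
      have "indicator {0..pi/2} r * (ennreal (2 * sin r * cos r) * (ennreal ((1 - (cos r)\<^sup>2) ^ (2 * n - 1) * (cos r)\<^sup>2) * G ((cos r)\<^sup>2))) =
          ennreal (2 * (sin r ^ (4*n-1) * cos r ^ 3)) * (\<integral>\<^sup>+\<phi>. indicator {0..pi/2} \<phi> * (ennreal (sin (2 * \<phi>)) * f (r, \<phi>)) \<partial>lborel)"
        unfolding G_eq indicator_simps(1)[OF True] pe[symmetric] by (simp only: mult_1_left mult.assoc)
      also have "\<dots> = (\<integral>\<^sup>+\<phi>. ennreal (2 * (sin r ^ (4*n-1) * cos r ^ 3)) * (indicator {0..pi/2} \<phi> * (ennreal (sin (2 * \<phi>)) * f (r, \<phi>))) \<partial>lborel)"
        by (rule nn_integral_cmult[symmetric]) measurable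
      also have "\<dots> = (\<integral>\<^sup>+\<phi>. indicator {0..pi/2} r * indicator {0..pi/2} \<phi> *
        ennreal (2 * (sin r ^ (4*n-1) * cos r ^ 3 * sin (2*\<phi>))) * f (r, \<phi>) \<partial>lborel)"
        using True sc by (intro nn_integral_cong) (auto split: split_indicator simp: ennreal_mult'[symmetric] mult.assoc[symmetric])
      finally show ?thesis .
    qed simp
  qed
  finally have *: "(\<integral>\<^sup>+v. \<integral>\<^sup>+p. indicator {0..1} v * indicator {0..1} p * ennreal ((1 - v) ^ (2 * n - 1) * v) * g (v, p) \<partial>lborel \<partial>lborel) =
     (\<integral>\<^sup>+r. \<integral>\<^sup>+\<phi>. indicator {0..pi/2} r * indicator {0..pi/2} \<phi> *
      ennreal (2 * (sin r ^ (4*n-1) * cos r ^ 3 * sin (2*\<phi>))) * f (r, \<phi>) \<partial>lborel \<partial>lborel)" .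
  define w where "w z = (case z of (r, \<phi>) \<Rightarrow>
     if r \<in> {0..pi/2} \<and> \<phi> \<in> {0..pi/2}
     then ennreal (8 * pi ^ (2*n+2) / Gamma (2 * real n) * sin r ^ (4*n-1) * cos r ^ 3 * sin (2*\<phi>))
     else 0)" for z
  have w[measurable]: "w \<in> borel_measurable (borel \<Otimes>\<^sub>M borel)"
    unfolding w_def by measurable
  have "(\<integral>\<^sup>+z. f z \<partial>radial_measure n) = (\<integral>\<^sup>+z. w z * f z \<partial>(lborel \<Otimes>\<^sub>M lborel))"
    unfolding radial_measure_def w_def[symmetric, abs_def] lborel_prod
    using f w by (intro nn_integral_density) (auto simp: borel_prod)
  also have "\<dots> = (\<integral>\<^sup>+r. \<integral>\<^sup>+\<phi>. w (r, \<phi>) * f (r, \<phi>) \<partial>lborel \<partial>lborel)"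
    by (rule lborel.nn_integral_fst[symmetric]) measurable
  also have "\<dots> = (\<integral>\<^sup>+r. \<integral>\<^sup>+\<phi>. ennreal c * (indicator {0..pi/2} r * indicator {0..pi/2} \<phi> *
      ennreal (2 * (sin r ^ (4*n-1) * cos r ^ 3 * sin (2*\<phi>))) * f (r, \<phi>)) \<partial>lborel \<partial>lborel)"
  proof (intro nn_integral_cong)
    fix r \<phi> :: real
    show "w (r, \<phi>) * f (r, \<phi>) = ennreal c * (indicator {0..pi/2} r * indicator {0..pi/2} \<phi> *
      ennreal (2 * (sin r ^ (4*n-1) * cos r ^ 3 * sin (2*\<phi>))) * f (r, \<phi>))"
      using c unfolding w_def c_def
      by (auto simp: ennreal_mult'[symmetric] mult.assoc[symmetric] split: split_indicator)
  qed
  also have "\<dots> = ennreal c * (\<integral>\<^sup>+r. \<integral>\<^sup>+\<phi>. indicator {0..pi/2} r * indicator {0..pi/2} \<phi> *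
      ennreal (2 * (sin r ^ (4*n-1) * cos r ^ 3 * sin (2*\<phi>))) * f (r, \<phi>) \<partial>lborel \<partial>lborel)"
    by (subst nn_integral_cmult, measurable)+
  finally show ?thesis
    unfolding *[symmetric] g_def c_def .
qed

lemma sphere_measure_space_sets:
  "space (sphere_measure :: 'a::euclidean_space measure) = sphere 0 1"
  "sets (sphere_measure :: 'a measure) = sets (restrict_space borel (sphere 0 1))"
  by (simp_all add: sphere_measure_def space_scale_measure space_restrict_space)

lemma measurable_sphere_measure: "f \<in> measurable borel M \<Longrightarrow> f \<in> measurable sphere_measure M"
  using measurable_cong_sets[OF sphere_measure_space_sets(2) refl] measurable_restrict_space1 by blast

text \<open>A positive and finite total mass makes the scaling factor in
  \<open>reference_measure\<close> unique.\<close>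

lemma emeasure_sphere_measure:
  "emeasure (sphere_measure :: 'a::euclidean_space measure) (sphere 0 1) \<noteq> 0"
  "emeasure (sphere_measure :: 'a measure) (sphere 0 1) \<noteq> \<infinity>"
proof -
  have "emeasure (sphere_measure :: 'a measure) (sphere 0 1) = (\<integral>\<^sup>+q. 1 \<partial>(sphere_measure :: 'a measure))"
    by (simp flip: sphere_measure_space_sets(1))
  also have "\<dots> = of_nat DIM('a) * (\<integral>\<^sup>+x. indicator (cball 0 1 - {0}) x \<partial>(lborel :: 'a measure))"
    using nn_integral_sphere_measure[of "\<lambda>_::'a. 1"] by simp
  also have "(\<integral>\<^sup>+x. indicator (cball 0 1 - {0}) x \<partial>(lborel :: 'a measure)) = (\<integral>\<^sup>+x. indicator (cball 0 1) x \<partial>(lborel :: 'a measure))"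
  proof (rule nn_integral_cong_AE)
    show "AE x in lborel. (indicator (cball 0 1 - {0}) x :: ennreal) = indicator (cball 0 1) (x :: 'a)"
      using AE_lborel_singleton[of "0 :: 'a"] by eventually_elim (auto split: split_indicator)
  qed
  also have "\<dots> = ennreal (unit_ball_vol (real DIM('a)))"
    by (simp add: emeasure_cball)
  finally have *: "emeasure (sphere_measure :: 'a measure) (sphere 0 1) = of_nat DIM('a) * ennreal (unit_ball_vol (real DIM('a)))" .
  show "emeasure (sphere_measure :: 'a measure) (sphere 0 1) \<noteq> 0" "emeasure (sphere_measure :: 'a measure) (sphere 0 1) \<noteq> \<infinity>"
    unfolding * by (simp_all add: ennreal_mult_eq_top_iff ennreal_of_nat_eq_real_of_nat ennreal_eq_0_iff not_le)
qed

text \<open>Resolves the definite description in \<open>reference_measure\<close>. Existence of the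
  factor follows from the proportional densities in (v, p), uniqueness from total masses; the
  product c K is the constant of the measure in these coordinates.\<close>

lemma reference_measure_eq:
  obtains c K where "c > 0" "K > 0" "c * K = 4 * pi ^ (2 * CARD('n) + 2) / Gamma (2 * real CARD('n))"
    "(reference_measure :: 'n::finite cp_point measure) = scale_measure (ennreal c) cp_volume"
    "distr (sphere_measure :: 'n hvec measure) borel square_coords =
      density lborel (\<lambda>z. ennreal (indicator ({0..1} \<times> {0..1}) z * (K * ((1 - fst z) ^ (2 * CARD('n) - 1) * fst z))))"
proof -
  define n where "n = CARD('n)"
  have n: "n \<ge> 1" by (simp add: n_def Suc_leI)
  define \<sigma> where "\<sigma> = (sphere_measure :: 'n hvec measure)"
  obtain K where K: "K > 0"
    "\<And>f. f \<in> borel_measurable borel \<Longrightarrow> (\<integral>\<^sup>+q. f (square_coords q) \<partial>\<sigma>) =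
      ennreal K * (\<integral>\<^sup>+v. \<integral>\<^sup>+p. indicator {0..1} v * indicator {0..1} p * ennreal ((1 - v) ^ (2 * n - 1) * v) * f (v, p) \<partial>lborel \<partial>lborel)"
    unfolding n_def \<sigma>_def by (rule nn_integral_square_coords[where 'n = 'n]) blast
  define \<kappa> where "\<kappa> = 4 * pi ^ (2 * n + 2) / Gamma (2 * real n)"
  have \<kappa>: "\<kappa> > 0"
    unfolding \<kappa>_def using n by (intro divide_pos_pos Gamma_real_pos) auto
  define c where "c = \<kappa> / K"
  have c: "c > 0" "c * K = \<kappa>"
    using \<kappa> K(1) by (simp_all add: c_def)
  define C where "C q = (coord_r q, coord_phi q)" for q :: "'n hvec"
  have "(\<lambda>q. angle_coords (square_coords q)) \<in> borel_measurable \<sigma>"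
    unfolding \<sigma>_def by (intro measurable_sphere_measure measurable_compose[OF square_coords_measurable angle_coords_measurable])
  \<comment> \<open>On the sphere the angles agree with the measurable composition through the
    squared coordinates.\<close>
  then have C[measurable]: "C \<in> borel_measurable \<sigma>"
    by (rule measurable_cong[THEN iffD1, rotated])
       (simp add: \<sigma>_def sphere_measure_space_sets angle_coords_square_coords C_def)
  have radial: "distr (scale_measure (ennreal c) \<sigma>) borel C = radial_measure n"
  proof (rule measure_eqI)
    fix A assume "A \<in> sets (distr (scale_measure (ennreal c) \<sigma>) borel C)"
    then have A[measurable]: "A \<in> sets borel" by simp
    have "emeasure (distr (scale_measure (ennreal c) \<sigma>) borel C) A = (\<integral>\<^sup>+x. indicator A x \<partial>distr (scale_measure (ennreal c) \<sigma>) borel C)"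
      by simp
    also have "\<dots> = ennreal c * (\<integral>\<^sup>+q. indicator A (C q) \<partial>\<sigma>)"
      by (subst nn_integral_distr) (auto simp: nn_integral_scale_measure)
    also have "(\<integral>\<^sup>+q. indicator A (C q) \<partial>\<sigma>) = (\<integral>\<^sup>+q. (\<lambda>z. indicator A (angle_coords z)) (square_coords q) \<partial>\<sigma>)"
      by (intro nn_integral_cong) (simp add: \<sigma>_def sphere_measure_space_sets angle_coords_square_coords C_def)
    also have "\<dots> = ennreal K * (\<integral>\<^sup>+v. \<integral>\<^sup>+p. indicator {0..1} v * indicator {0..1} p * ennreal ((1 - v) ^ (2 * n - 1) * v) * indicator A (angle_coords (v, p)) \<partial>lborel \<partial>lborel)"
      by (rule K(2)) measurable
    also have "ennreal c * \<dots> = ennreal \<kappa> * (\<integral>\<^sup>+v. \<integral>\<^sup>+p. indicator {0..1} v * indicator {0..1} p * ennreal ((1 - v) ^ (2 * n - 1) * v) * indicator A (angle_coords (v, p)) \<partial>lborel \<partial>lborel)"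
      using c K(1) by (simp add: mult.assoc[symmetric] ennreal_mult[symmetric])
    also have "\<dots> = (\<integral>\<^sup>+z. indicator A z \<partial>radial_measure n)"
      unfolding \<kappa>_def by (rule nn_integral_angle_coords[symmetric]) (use n in measurable)
    also have "\<dots> = emeasure (radial_measure n) A"
      by (rule nn_integral_indicator) (simp add: radial_measure_def)
    finally show "emeasure (distr (scale_measure (ennreal c) \<sigma>) borel C) A = emeasure (radial_measure n) A" .
  qed (simp add: radial_measure_def)
  have total: "emeasure (distr (scale_measure x \<sigma>) borel C) UNIV = x * emeasure \<sigma> (sphere 0 1)" for x
  proof -
    have "C \<in> borel_measurable (scale_measure x \<sigma>)"
      using C by (simp cong: measurable_cong_sets)
    then have "emeasure (distr (scale_measure x \<sigma>) borel C) UNIV = emeasure (scale_measure x \<sigma>) (space \<sigma>)"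
      by (subst emeasure_distr) (auto simp: space_scale_measure)
    then show ?thesis
      by (simp add: \<sigma>_def sphere_measure_space_sets)
  qed
  have "(THE x. distr (scale_measure x \<sigma>) borel C = radial_measure n) = ennreal c"
  proof (rule the_equality)
    show "distr (scale_measure (ennreal c) \<sigma>) borel C = radial_measure n"
      by (rule radial)
    fix x assume x: "distr (scale_measure x \<sigma>) borel C = radial_measure n"
    then have "x * emeasure \<sigma> (sphere 0 1) = ennreal c * emeasure \<sigma> (sphere 0 1)"
      using total[of x] total[of "ennreal c"] radial by simp
    then show "x = ennreal c"
      using emeasure_sphere_measure[where 'a = "'n hvec"] unfolding \<sigma>_def
      by (metis mult_divide_eq_ennreal infinity_ennreal_def)
  qed
  then have ref: "(reference_measure :: 'n cp_point measure) = scale_measure (ennreal c) cp_volume"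
    unfolding reference_measure_def \<sigma>_def C_def n_def by simp
  have distr: "distr \<sigma> borel square_coords =
      density lborel (\<lambda>z. ennreal (indicator ({0..1} \<times> {0..1}) z * (K * ((1 - fst z) ^ (2 * n - 1) * fst z))))"
  proof (rule measure_eqI)
    fix A assume "A \<in> sets (distr \<sigma> borel square_coords)"
    then have A[measurable]: "A \<in> sets borel" by simp
    have A2[measurable]: "A \<in> sets (borel \<Otimes>\<^sub>M borel)"
      unfolding borel_prod by (rule A)
    have sq: "square_coords \<in> borel_measurable \<sigma>"
      unfolding \<sigma>_def by (intro measurable_sphere_measure square_coords_measurable)
    have "emeasure (distr \<sigma> borel square_coords) A = (\<integral>\<^sup>+q. indicator A (square_coords q) \<partial>\<sigma>)"
      using sq by (subst nn_integral_distr[symmetric, where M' = borel]) auto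
    also have "\<dots> = ennreal K * (\<integral>\<^sup>+v. \<integral>\<^sup>+p. indicator {0..1} v * indicator {0..1} p * ennreal ((1 - v) ^ (2 * n - 1) * v) * indicator A (v, p) \<partial>lborel \<partial>lborel)"
      by (rule K(2)) measurable
    also have "\<dots> = (\<integral>\<^sup>+v. \<integral>\<^sup>+p. ennreal K * (indicator {0..1} v * indicator {0..1} p * ennreal ((1 - v) ^ (2 * n - 1) * v) * indicator A (v, p)) \<partial>lborel \<partial>lborel)"
      by (subst nn_integral_cmult, measurable)+
    also have "\<dots> = (\<integral>\<^sup>+v. \<integral>\<^sup>+p. ennreal (indicator ({0..1} \<times> {0..1}) (v, p) * (K * ((1 - fst (v, p)) ^ (2 * n - 1) * fst (v, p)))) * indicator A (v, p) \<partial>lborel \<partial>lborel)"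
      using K(1) by (intro nn_integral_cong) (auto split: split_indicator simp: ennreal_mult)
    also have "\<dots> = (\<integral>\<^sup>+z. ennreal (indicator ({0..1} \<times> {0..1}) z * (K * ((1 - fst z) ^ (2 * n - 1) * fst z))) * indicator A z \<partial>(lborel \<Otimes>\<^sub>M lborel))"
      by (rule lborel.nn_integral_fst) measurable
    also have "\<dots> = emeasure (density lborel (\<lambda>z. ennreal (indicator ({0..1} \<times> {0..1}) z * (K * ((1 - fst z) ^ (2 * n - 1) * fst z))))) A"
      unfolding lborel_prod by (subst emeasure_density) (auto simp flip: borel_prod)
    finally show "emeasure (distr \<sigma> borel square_coords) A =
       emeasure (density lborel (\<lambda>z. ennreal (indicator ({0..1} \<times> {0..1}) z * (K * ((1 - fst z) ^ (2 * n - 1) * fst z))))) A" .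
  qed simp
  show ?thesis
    using that[OF c(1) K(1)] c(2) ref distr unfolding \<kappa>_def n_def \<sigma>_def by blast
qed

section \<open>Integration over the quotient\<close>

lemma cp_class_measurable:
  "cp_class \<in> measurable (sphere_measure :: 'n::finite hvec measure)
     (sigma CP {A. A \<subseteq> CP \<and> {q \<in> sphere 0 1. cp_class q \<in> A} \<in> sets borel})"
proof (rule measurable_measure_of)
  show "cp_class \<in> space (sphere_measure :: 'n hvec measure) \<rightarrow> CP"
    by (auto simp: sphere_measure_space_sets CP_def)
next
  fix A :: "'n cp_point set" assume A: "A \<in> {A. A \<subseteq> CP \<and> {q \<in> sphere 0 1. cp_class q \<in> A} \<in> sets borel}"
  have "cp_class -` A \<inter> space (sphere_measure :: 'n hvec measure) = {q \<in> sphere 0 1. cp_class q \<in> A}"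
    by (auto simp: sphere_measure_space_sets)
  with A show "cp_class -` A \<inter> space (sphere_measure :: 'n hvec measure) \<in> sets sphere_measure"
    by (auto simp: sphere_measure_space_sets sets_restrict_space_iff)
qed auto

text \<open>The sets of orbits are measurable exactly when their preimages on the sphere are, so
  measurability is inherited from the lift.\<close>

lemma cp_function_measurable:
  fixes f :: "'n::finite cp_point \<Rightarrow> real"
  assumes "continuous_on (sphere 0 1) (\<lambda>q. f (cp_class q))"
  shows "f \<in> borel_measurable (sigma CP {A. A \<subseteq> CP \<and> {q \<in> sphere 0 1. cp_class q \<in> A} \<in> sets borel})"
proof (rule measurableI)
  fix S :: "real set" assume S: "S \<in> sets borel"
  have "(\<lambda>q. f (cp_class q)) \<in> borel_measurable (restrict_space borel (sphere 0 1))"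
    using assms by (rule borel_measurable_continuous_on_restrict)
  then have "(\<lambda>q. f (cp_class q)) -` S \<inter> space (restrict_space borel (sphere 0 1)) \<in> sets (restrict_space borel (sphere 0 1))"
    using S by (rule measurable_sets)
  moreover have "(\<lambda>q. f (cp_class q)) -` S \<inter> space (restrict_space borel (sphere 0 1)) =
      {q \<in> sphere 0 1. cp_class q \<in> f -` S \<inter> CP}"
    by (auto simp: space_restrict_space CP_def)
  ultimately have "{q \<in> sphere 0 1. cp_class q \<in> f -` S \<inter> CP} \<in> sets borel"
    by (simp add: sets_restrict_space_iff)
  then have "f -` S \<inter> CP \<in> {A. A \<subseteq> CP \<and> {q \<in> sphere 0 1. cp_class q \<in> A} \<in> sets borel}"
    by blast
  then have "f -` S \<inter> CP \<in> sets (sigma CP {A. A \<subseteq> CP \<and> {q \<in> sphere 0 1. cp_class q \<in> A} \<in> sets borel})"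
    by (rule in_measure_of[rotated]) blast
  moreover have "space (sigma CP {A. A \<subseteq> CP \<and> {q \<in> sphere 0 1. cp_class q \<in> A} \<in> sets borel}) = (CP :: 'n cp_point set)"
    by (rule space_measure_of) blast
  ultimately show "f -` S \<inter> space (sigma CP {A. A \<subseteq> CP \<and> {q \<in> sphere 0 1. cp_class q \<in> A} \<in> sets borel})
      \<in> sets (sigma CP {A. A \<subseteq> CP \<and> {q \<in> sphere 0 1. cp_class q \<in> A} \<in> sets borel})"
    by (simp only:)
qed simp

lemma integral_scale_measure:
  fixes f :: "'a \<Rightarrow> real"
  assumes f: "f \<in> borel_measurable M" and c: "c \<ge> 0"
  shows "integral\<^sup>L (scale_measure (ennreal c) M) f = c * integral\<^sup>L M f"
proof -
  have "scale_measure (ennreal c) M = density M (\<lambda>_. ennreal c)"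
    by (rule measure_eqI) (auto simp: emeasure_density nn_integral_cmult_indicator)
  then show ?thesis
    using f c by (simp add: integral_density)
qed

text \<open>The representation of f by g may fail where the last quaternion vanishes; this set is
  negligible, and the push-forward to the unit square does the rest.\<close>

lemma integral_reference_measure:
  fixes f :: "'n::finite cp_point \<Rightarrow> real" and g :: "real \<times> real \<Rightarrow> real"
  assumes f: "continuous_on (sphere 0 1) (\<lambda>q. f (cp_class q))"
    and fg: "\<And>q. q \<in> sphere 0 1 \<Longrightarrow> snd q \<noteq> 0 \<Longrightarrow> f (cp_class q) = g (square_coords q)"
    and g: "continuous_on UNIV g"
  defines "n \<equiv> CARD('n)"
  shows "(LINT x|reference_measure. f x) = 4 * pi ^ (2 * n + 2) / Gamma (2 * real n) *
    integral {0..1} (\<lambda>v. integral {0..1} (\<lambda>p. (1 - v) ^ (2 * n - 1) * v * g (v, p)))"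
proof -
  obtain c K where cK: "c > 0" "K > 0" "c * K = 4 * pi ^ (2 * n + 2) / Gamma (2 * real n)"
    and ref: "(reference_measure :: 'n cp_point measure) = scale_measure (ennreal c) cp_volume"
    and distr: "distr (sphere_measure :: 'n hvec measure) borel square_coords =
      density lborel (\<lambda>z. ennreal (indicator ({0..1} \<times> {0..1}) z * (K * ((1 - fst z) ^ (2 * n - 1) * fst z))))"
    unfolding n_def by (rule reference_measure_eq[where 'n = 'n]) blast
  define w where "w z = indicator ({0..1} \<times> {0..1}) z * (K * ((1 - fst z) ^ (2 * n - 1) * fst z))" for z :: "real \<times> real"
  have w[measurable]: "w \<in> borel_measurable borel"
    unfolding w_def borel_prod[symmetric] by measurable
  have w_nonneg: "w z \<ge> 0" for z
    using cK(2) by (auto simp: w_def split: split_indicator intro!: mult_nonneg_nonneg)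
  have gm[measurable]: "g \<in> borel_measurable borel"
    using g by (rule borel_measurable_continuous_onI)
  have sq[measurable]: "square_coords \<in> measurable (sphere_measure :: 'n hvec measure) borel"
    by (intro measurable_sphere_measure square_coords_measurable)
  have fm: "(\<lambda>q. f (cp_class q)) \<in> borel_measurable (sphere_measure :: 'n hvec measure)"
    using measurable_comp[OF cp_class_measurable cp_function_measurable[OF f]] by (simp add: comp_def)
  have "(LINT x|reference_measure. f x) = c * (LINT x|cp_volume. f x)"
    unfolding ref using cK cp_function_measurable[OF f] by (intro integral_scale_measure) (auto simp: cp_volume_def)
  also have "(LINT x|cp_volume. f x) = (LINT q|(sphere_measure :: 'n hvec measure). f (cp_class q))"
    unfolding cp_volume_def by (rule integral_distr[OF cp_class_measurable cp_function_measurable[OF f]])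
  also have "\<dots> = (LINT q|(sphere_measure :: 'n hvec measure). g (square_coords q))"
  proof (rule integral_cong_AE[OF fm])
    \<comment> \<open>The density contains the factor v, so it vanishes wherever v = 0.\<close>
    have "AE z in distr (sphere_measure :: 'n hvec measure) borel square_coords. fst z \<noteq> 0"
      unfolding distr w_def[symmetric]
    proof (subst AE_density)
      show "(\<lambda>z. ennreal (w z)) \<in> borel_measurable lborel"
        by measurable
    qed (auto simp: w_def)
    then have "AE q in (sphere_measure :: 'n hvec measure). fst (square_coords q) \<noteq> 0"
      by (rule AE_distrD[OF sq])
    then show "AE q in (sphere_measure :: 'n hvec measure). f (cp_class q) = g (square_coords q)"
      using AE_space by eventually_elim (auto simp: sphere_measure_space_sets square_coords_def intro!: fg[unfolded square_coords_def])
  qed measurable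
  also have "\<dots> = integral\<^sup>L (distr (sphere_measure :: 'n hvec measure) borel square_coords) g"
    by (rule integral_distr[symmetric]) measurable
  also have "\<dots> = (LINT z|lborel. w z * g z)"
    unfolding distr w_def[symmetric] using w_nonneg by (subst integral_density) auto
  also have "\<dots> = (LINT z:cbox (0, 0) (1, 1)|lborel. K * ((1 - fst z) ^ (2 * n - 1) * fst z * g z))"
    unfolding set_lebesgue_integral_def
    by (intro Bochner_Integration.integral_cong refl) (auto simp: w_def cbox_Pair_eq split: split_indicator)
  also have "\<dots> = integral (cbox (0, 0) (1, 1)) (\<lambda>z. K * ((1 - fst z) ^ (2 * n - 1) * fst z * g z))"
  proof (rule set_borel_integral_eq_integral(2))
    show "set_integrable lborel (cbox (0, 0) (1, 1)) (\<lambda>z. K * ((1 - fst z) ^ (2 * n - 1) * fst z * g z))"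
      unfolding set_integrable_def
      by (intro borel_integrable_compact compact_cbox continuous_intros continuous_on_subset[OF g]) auto
  qed
  also have "\<dots> = integral (cbox 0 1) (\<lambda>v. integral (cbox 0 1) (\<lambda>p. K * ((1 - fst (v, p)) ^ (2 * n - 1) * fst (v, p) * g (v, p))))"
    by (intro integral_prod_continuous continuous_intros continuous_on_subset[OF g]) auto
  also have "\<dots> = K * integral {0..1} (\<lambda>v. integral {0..1} (\<lambda>p. (1 - v) ^ (2 * n - 1) * v * g (v, p)))"
    by simp
  finally show ?thesis
    unfolding cK(3)[symmetric] by (simp add: mult.assoc)
qed

text \<open>Clamping makes the section continuous everywhere.\<close>

definition coord_section :: "real \<times> real \<Rightarrow> 'n::finite hvec" where
  "coord_section z = (sqrt (1 - max 0 (min 1 (fst z))) *\<^sub>R axis undefined (1, 0),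
     sqrt (max 0 (min 1 (fst z))) *\<^sub>R
       (of_real (sqrt (max 0 (min 1 (snd z)))), of_real (sqrt (1 - max 0 (min 1 (snd z))))))"

lemma coord_section_sphere: "coord_section z \<in> sphere 0 1"
  by (simp add: coord_section_def norm_prod_def norm_eq_sqrt_inner[of "axis _ _"] inner_axis_axis power_mult_distrib
      flip: distrib_left)

lemma continuous_on_coord_section: "continuous_on UNIV coord_section"
  unfolding coord_section_def by (intro continuous_intros)

text \<open>For v = 0 the last quaternion of the section is zero and p cannot be recovered, hence
  the strict inequality.\<close>

lemma square_coords_coord_section:
  assumes "0 < v" "v \<le> 1" "0 \<le> p" "p \<le> 1"
  shows "square_coords (coord_section (v, p)) = (v, p)" "snd (coord_section (v, p)) \<noteq> 0"
proof -
  have "v * p + v * (1 - p) = v"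
    by (simp add: algebra_simps)
  then show "square_coords (coord_section (v, p)) = (v, p)" "snd (coord_section (v, p)) \<noteq> 0"
    using assms by (simp_all add: square_coords_def coord_section_def norm_prod_def power_mult_distrib prod_eq_iff)
qed

lemma square_coords_range:
  assumes "q \<in> sphere 0 1" "snd q \<noteq> 0" "square_coords q = (v, p)"
  shows "0 < v" "v \<le> 1" "0 \<le> p" "p \<le> 1"
proof -
  have "norm (snd q) \<le> 1"
    using assms norm_snd_le[of "snd q" "fst q"] by simp
  moreover have "norm (fst (snd q)) \<le> norm (snd q)"
    using norm_fst_le[of "fst (snd q)" "snd (snd q)"] by simp
  ultimately show "0 < v" "v \<le> 1" "0 \<le> p" "p \<le> 1"
    using assms(2,3) by (auto simp: square_coords_def power_le_one intro!: power_mono divide_le_eq_1_pos[THEN iffD2])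
qed

lemma zonal_function_square_coords:
  assumes "snd q \<noteq> 0" "square_coords q = (v, p)"
  shows "zonal_function m g (cp_class q) = v ^ m * poly (shifted_jacobi m 0 0) p * poly g v"
proof -
  have "v \<noteq> 0" using assms by (auto simp: square_coords_def)
  then have "inv_first q = v * p"
    using assms by (auto simp: square_coords_def)
  moreover have sum: "inv_first q + inv_second q = v"
    using assms norm_snd_eq[of q] by (auto simp: square_coords_def)
  ultimately have "inv_second q = v * (1 - p)"
    by (simp add: algebra_simps)
  then show ?thesis
    unfolding zonal_function_class sum using \<open>inv_first q = v * p\<close> solid_legendre_eq[of m v p] by simp
qed

section \<open>Identification of the kernel with its expansion\<close>

theorem proposition3p1:
  fixes H :: "real \<Rightarrow> 'n::finite cp_point \<Rightarrow> real"
    and h :: "real \<Rightarrow> real \<Rightarrow> real \<Rightarrow> real"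
    and n :: nat
  assumes n: "n = CARD('n)"
    and kernel: "subelliptic_heat_kernel (cp_class north) H"
    and radial: "\<And>t q. t > 0 \<Longrightarrow> q \<in> sphere 0 1 \<Longrightarrow> snd q \<noteq> 0 \<Longrightarrow>
                   H t (cp_class q) = h t (coord_r q) (coord_phi q)"
    and "t > 0" and "0 \<le> r" "r < pi/2" and "0 \<le> \<phi>" "\<phi> \<le> pi/2"
  shows "(\<forall>m. summable (\<lambda>k. kernel_term n t r \<phi> m k)) \<and>
         (\<lambda>m. \<Sum>k. kernel_term n t r \<phi> m k) sums h t r \<phi>"
proof -
  have n1: "n \<ge> 1"
    by (simp add: n Suc_leI)
  \<comment> \<open>The kernel pulled back to the closed unit square along a continuous section.
    This is defined and continuous also at v = 0, as the completeness argument requires.\<close>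
  define G where "G z = H t (cp_class (coord_section z :: 'n hvec))" for z
  have cont_H: "continuous_on (sphere 0 1) (\<lambda>q. H t (cp_class q))"
    using kernel \<open>t > 0\<close> by (simp add: subelliptic_heat_kernel_def)
  have cont_G: "continuous_on UNIV G"
    unfolding G_def by (rule continuous_on_compose2[OF cont_H continuous_on_coord_section]) (use coord_section_sphere in auto)
  \<comment> \<open>A point and the section over its coordinates have the same angles, so the radial
    dependence off the locus \<open>snd q = 0\<close> gives them the same kernel value.\<close>
  have HG: "H t (cp_class q) = G (square_coords q)" if q: "q \<in> sphere 0 1" "snd q \<noteq> 0" for q :: "'n hvec"
  proof -
    obtain v p where vp: "square_coords q = (v, p)" by fastforce
    note range = square_coords_range[OF q vp]
    have "(coord_r (coord_section (v, p) :: 'n hvec), coord_phi (coord_section (v, p) :: 'n hvec)) = (coord_r q, coord_phi q)"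
      using angle_coords_square_coords[OF q(1)] angle_coords_square_coords[OF coord_section_sphere[where 'a = 'n and z = "(v, p)"]]
        square_coords_coord_section(1)[OF range, where 'a = 'n] vp
      by simp
    then show ?thesis
      unfolding G_def vp
      using radial[OF \<open>t > 0\<close> q] radial[OF \<open>t > 0\<close> coord_section_sphere square_coords_coord_section(2)[OF range]] by simp
  qed
  define ev where "ev m k = real (4 * k * (k + 2 * n + 2 * m + 1) + 8 * n * m)" for m k
  \<comment> \<open>The defining property of the kernel is applied to the separated solution:
    evaluation at the north pole at time t gives the damped binomial, and the initial value is the
    undamped eigenfunction against which the kernel is integrated.\<close>
  have coeffs: "integral {0..1} (\<lambda>v. (1 - v) ^ (2 * n - 1) * v ^ (m + 1)
        * poly (shifted_jacobi k (2 * n - 1) (2 * m + 1)) v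
        * integral {0..1} (\<lambda>p. G (v, p) * poly (shifted_jacobi m 0 0) p)) =
      Gamma (2 * real n) / (4 * pi ^ (2 * n + 2)) * exp (- ev m k * t) * real ((k + 2 * n - 1) choose k)" (is "?I = _") for m k
  proof -
    define J where "J = shifted_jacobi k (2 * n - 1) (2 * m + 1)"
    define u where "u s = (zonal_function m (smult (exp (- ev m k * s)) J) :: 'n cp_point \<Rightarrow> real)" for s
    have "heat_solution u"
      using heat_solution_zonal_function[OF n] unfolding u_def ev_def J_def .
    then have "u t (cp_class north) = (LINT x|reference_measure. H t x * u 0 x)"
      using kernel \<open>t > 0\<close> unfolding subelliptic_heat_kernel_def by blast
    also have "u t (cp_class north) = exp (- ev m k * t) * real ((k + 2 * n - 1) choose k)"
      using n1 by (simp add: u_def zonal_function_north J_def poly_shifted_jacobi_1 add.commute)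
    also have "(LINT x|reference_measure. H t x * u 0 x) = 4 * pi ^ (2 * n + 2) / Gamma (2 * real n) *
      integral {0..1} (\<lambda>v. integral {0..1} (\<lambda>p. (1 - v) ^ (2 * n - 1) * v *
        (\<lambda>z. G z * (fst z ^ m * poly (shifted_jacobi m 0 0) (snd z) * poly J (fst z))) (v, p)))"
      unfolding n
    proof (rule integral_reference_measure)
      show "continuous_on (sphere 0 1) (\<lambda>q. H t (cp_class q) * u 0 (cp_class q))"
        unfolding u_def zonal_function_class solid_legendre_def by (intro continuous_intros cont_H)
      show "H t (cp_class q) * u 0 (cp_class q) =
          (\<lambda>z. G z * (fst z ^ m * poly (shifted_jacobi m 0 0) (snd z) * poly J (fst z))) (square_coords q)"
        if "q \<in> sphere 0 1" "snd q \<noteq> 0" for q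
        using HG[OF that] zonal_function_square_coords[OF that(2), of "fst (square_coords q)" "snd (square_coords q)"]
        by (simp add: u_def)
      show "continuous_on UNIV (\<lambda>z. G z * (fst z ^ m * poly (shifted_jacobi m 0 0) (snd z) * poly J (fst z)))"
        by (intro continuous_intros cont_G)
    qed
    also have "integral {0..1} (\<lambda>v. integral {0..1} (\<lambda>p. (1 - v) ^ (2 * n - 1) * v *
        (\<lambda>z. G z * (fst z ^ m * poly (shifted_jacobi m 0 0) (snd z) * poly J (fst z))) (v, p))) = ?I"
    proof (rule integral_cong)
      fix v :: real
      have "integral {0..1} (\<lambda>p. (1 - v) ^ (2 * n - 1) * v *
          (\<lambda>z. G z * (fst z ^ m * poly (shifted_jacobi m 0 0) (snd z) * poly J (fst z))) (v, p)) =
        integral {0..1} (\<lambda>p. (1 - v) ^ (2 * n - 1) * v ^ (m + 1) * poly J v * (G (v, p) * poly (shifted_jacobi m 0 0) p))"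
        by (intro integral_cong) (simp add: mult_ac)
      then show "integral {0..1} (\<lambda>p. (1 - v) ^ (2 * n - 1) * v *
          (\<lambda>z. G z * (fst z ^ m * poly (shifted_jacobi m 0 0) (snd z) * poly J (fst z))) (v, p)) =
        (1 - v) ^ (2 * n - 1) * v ^ (m + 1) * poly (shifted_jacobi k (2 * n - 1) (2 * m + 1)) v
          * integral {0..1} (\<lambda>p. G (v, p) * poly (shifted_jacobi m 0 0) p)"
        by (simp only: integral_mult_right J_def)
    qed
    finally have "exp (- ev m k * t) * real ((k + 2 * n - 1) choose k) = 4 * pi ^ (2 * n + 2) / Gamma (2 * real n) * ?I" .
    moreover have "Gamma (2 * real n) > 0"
      using n1 by (intro Gamma_real_pos) auto
    ultimately show ?thesis
      by (simp add: field_simps)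
  qed
  \<comment> \<open>The bound r < pi/2 keeps the section off the locus where
    \<open>snd q = 0\<close>, so that h gives the value of the kernel there.\<close>
  have v: "0 < (cos r)\<^sup>2" "(cos r)\<^sup>2 \<le> 1"
    using cos_gt_zero_pi[of r] assms by (auto simp: abs_square_le_1)
  have p: "0 \<le> (cos \<phi>)\<^sup>2" "(cos \<phi>)\<^sup>2 \<le> 1"
    by (auto simp: abs_square_le_1)
  have "(\<forall>m. summable (kernel_term n t r \<phi> m)) \<and> (\<lambda>m. \<Sum>k. kernel_term n t r \<phi> m k) sums G ((cos r)\<^sup>2, (cos \<phi>)\<^sup>2)"
    using spectral_expansion[OF n1 \<open>t > 0\<close> continuous_on_subset[OF cont_G subset_UNIV] coeffs[unfolded ev_def], of "(cos r)\<^sup>2" "(cos \<phi>)\<^sup>2"] v p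
    by (simp add: kernel_term_eq[abs_def])
  also have "G ((cos r)\<^sup>2, (cos \<phi>)\<^sup>2) = h t r \<phi>"
    unfolding G_def
    using radial[OF \<open>t > 0\<close> coord_section_sphere square_coords_coord_section(2)[OF v p]]
      angle_coords_square_coords[OF coord_section_sphere[where 'a = 'n and z = "((cos r)\<^sup>2, (cos \<phi>)\<^sup>2)"]]
      square_coords_coord_section(1)[OF v p, where 'a = 'n] angle_coords_cos[of r \<phi>] assms
    by simp
  finally show ?thesis .
qed

end
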